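(* For any operator space $V$, the space $\mathcal{H}^\infty_{\mathrm{cb}}(B_V)$, with pointwise multiplication, is a completely contractive Banach algebra. More generally, for any operator algebra $\mathcal{A}\subseteq\mathcal{B}(H)$ (with the induced operator space structure), the space $\mathcal{H}^\infty_{\mathrm{cb}}(B_V,\mathcal{A})$, with pointwise multiplication, is a completely contractive Banach algebra.
   Context: All spaces are complex and operator spaces are complete; $B_X$ is the open unit ball of $X$, and $M_n(V)$ is the space of $n\times n$ matrices over the operator space $V$ with its given norm. A map $f:B_V\to W$ is holomorphic if it is (complex) Fréchet differentiable at every point. A holomorphic $f:B_V\to W$ is completely bounded holomorphic if $\|f\|_{\mathcal{H}^\infty_{\mathrm{cb}}}=\sup\{\|(f(x_{ij}))\|_{M_m(W)} : m\in\mathbb N,\ (x_{ij})\in B_{M_m(V)}\}<\infty$. The space of these is $\mathcal{H}^\infty_{\mathrm{cb}}(B_V,W)$, an operator space with matrix norms $\|(f_{k\ell})\|_{M_n(\mathcal{H}^\infty_{\mathrm{cb}}(B_V,W))}=\sup\{\|(f_{k\ell}(x_{ij}))\|_{M_{mn}(W)} : m\in\mathbb N,\ (x_{ij})\in B_{M_m(V)}\}$; $\mathcal{H}^\infty_{\mathrm{cb}}(B_V)=\mathcal{H}^\infty_{\mathrm{cb}}(B_V,\mathbb C)$. A completely contractive Banach algebra is an operator space $\mathcal{E}$ which is an associative algebra (not necessarily unital) whose multiplication $\mathcal{E}\times\mathcal{E}\to\mathcal{E}$ is jointly completely contractive, i.e. for all $p,q\in\mathbb N$, $(a_{kl})\in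 M_p(\mathcal{E})$, $(b_{rs})\in M_q(\mathcal{E})$ one has $\|(a_{kl}b_{rs})\|_{M_{pq}(\mathcal{E})}\le\|(a_{kl})\|_{M_p(\mathcal{E})}\|(b_{rs})\|_{M_q(\mathcal{E})}$. *)

theory Defs
  imports
    "HOL-Analysis.Analysis"
    "HOL-Library.Function_Algebras"
    "Jordan_Normal_Form.Matrix"
begin

text \<open>
  A complex vector space with matrix norms is given by its set of vectors, sitting inside a type
  that provides addition, together with the complex scalar multiplication and one function that
  is the norm of \<open>M\<^sub>n(V)\<close> on the \<open>n \<times> n\<close> matrices with entries in that set, for every \<open>n \<ge> 1\<close>.
\<close>

record 'a matrix_normed =
  vectors :: "'a set"
  cscale :: "complex \<Rightarrow> 'a \<Rightarrow> 'a"
  mnorm :: "'a mat \<Rightarrow> real"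

definition Mats :: "('a, 'z) matrix_normed_scheme \<Rightarrow> nat \<Rightarrow> 'a mat set" where
  "Mats V n = {X \<in> carrier_mat n n. elements_mat X \<subseteq> vectors V}"

definition vnorm :: "('a, 'z) matrix_normed_scheme \<Rightarrow> 'a \<Rightarrow> real" where
  "vnorm V x = mnorm V (Matrix.mat 1 1 (\<lambda>_. x))"

definition unit_ball :: "('a, 'z) matrix_normed_scheme \<Rightarrow> 'a set" where
  "unit_ball V = {x \<in> vectors V. vnorm V x < 1}"

definition mat_unit_ball :: "('a, 'z) matrix_normed_scheme \<Rightarrow> nat \<Rightarrow> 'a mat set" where
  "mat_unit_ball V m = {X \<in> Mats V m. mnorm V X < 1}"

text \<open>The norm of a rectangular scalar matrix as an operator between Euclidean spaces
  \<open>\<complex>\<^sup>c \<rightarrow> \<complex>\<^sup>r\<close>.\<close>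

definition cmat_norm :: "complex mat \<Rightarrow> real" where
  "cmat_norm \<alpha> =
    (SUP \<xi> \<in> {\<xi> :: nat \<Rightarrow> complex. L2_set (\<lambda>j. cmod (\<xi> j)) {..<dim_col \<alpha>} \<le> 1}.
      L2_set (\<lambda>i. cmod (\<Sum>j<dim_col \<alpha>. \<alpha> $$ (i, j) * \<xi> j)) {..<dim_row \<alpha>})"

definition scalar_conj ::
  "('a::ab_group_add, 'z) matrix_normed_scheme \<Rightarrow> complex mat \<Rightarrow> 'a mat \<Rightarrow> complex mat \<Rightarrow> 'a mat" where
  "scalar_conj V \<alpha> X \<beta> = Matrix.mat (dim_row \<alpha>) (dim_col \<beta>)
    (\<lambda>(i, j). \<Sum>k<dim_row X. \<Sum>l<dim_col X. cscale V (\<alpha> $$ (i, k) * \<beta> $$ (l, j)) (X $$ (k, l)))"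

definition direct_sum :: "'a::zero mat \<Rightarrow> 'a mat \<Rightarrow> 'a mat" where
  "direct_sum X Y = four_block_mat X (0\<^sub>m (dim_row X) (dim_col Y)) (0\<^sub>m (dim_row Y) (dim_col X)) Y"

text \<open>
  Abstract operator spaces by Ruan's axioms. Requiring the scalar multiplication to be that of a
  vector space on the whole ambient type is no restriction, as the type may be taken to be the
  space itself. Completeness of the first matrix level gives that of all the others.
\<close>

locale operator_space =
  fixes V :: "('a::ab_group_add, 'z) matrix_normed_scheme"
  assumes ambient: "vector_space (cscale V)"
    and subspace: "module.subspace (cscale V) (vectors V)"
    and mnorm_zero: "\<And>n X. \<lbrakk>n \<ge> 1; X \<in> Mats V n\<rbrakk> \<Longrightarrow> mnorm V X = 0 \<longleftrightarrow> X = 0\<^sub>m n n"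
    and mnorm_scale: "\<And>n X c. \<lbrakk>n \<ge> 1; X \<in> Mats V n\<rbrakk>
          \<Longrightarrow> mnorm V (map_mat (cscale V c) X) = cmod c * mnorm V X"
    and mnorm_triangle: "\<And>n X Y. \<lbrakk>n \<ge> 1; X \<in> Mats V n; Y \<in> Mats V n\<rbrakk>
          \<Longrightarrow> mnorm V (X + Y) \<le> mnorm V X + mnorm V Y"
    and mnorm_conj: "\<And>n m X \<alpha> \<beta>. \<lbrakk>n \<ge> 1; m \<ge> 1; X \<in> Mats V n;
            \<alpha> \<in> carrier_mat m n; \<beta> \<in> carrier_mat n m\<rbrakk>
          \<Longrightarrow> mnorm V (scalar_conj V \<alpha> X \<beta>) \<le> cmat_norm \<alpha> * mnorm V X * cmat_norm \<beta>"
    and mnorm_direct_sum: "\<And>n m X Y. \<lbrakk>n \<ge> 1; m \<ge> 1; X \<in> Mats V n; Y \<in> Mats V m\<rbrakk>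
          \<Longrightarrow> mnorm V (direct_sum X Y) = max (mnorm V X) (mnorm V Y)"
    and complete: "\<And>s :: nat \<Rightarrow> 'a.
          \<lbrakk>\<And>i. s i \<in> vectors V;
           \<And>e. e > 0 \<Longrightarrow> \<exists>N. \<forall>i\<ge>N. \<forall>j\<ge>N. vnorm V (s i - s j) < e\<rbrakk>
          \<Longrightarrow> \<exists>x \<in> vectors V. (\<lambda>i. vnorm V (s i - x)) \<longlonglongrightarrow> 0"

definition mat_mult_tensor :: "('a \<Rightarrow> 'a \<Rightarrow> 'a) \<Rightarrow> 'a mat \<Rightarrow> 'a mat \<Rightarrow> 'a mat" where
  "mat_mult_tensor mul X Y = Matrix.mat (dim_row X * dim_row Y) (dim_col X * dim_col Y)
    (\<lambda>(i, j). mul (X $$ (i div dim_row Y, j div dim_col Y)) (Y $$ (i mod dim_row Y, j mod dim_col Y)))"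

locale completely_contractive_Banach_algebra = operator_space E
  for E :: "('a::ab_group_add, 'z) matrix_normed_scheme" +
  fixes mul :: "'a \<Rightarrow> 'a \<Rightarrow> 'a"
  assumes mul_closed: "\<And>x y. \<lbrakk>x \<in> vectors E; y \<in> vectors E\<rbrakk> \<Longrightarrow> mul x y \<in> vectors E"
    and mul_assoc: "\<And>x y z. \<lbrakk>x \<in> vectors E; y \<in> vectors E; z \<in> vectors E\<rbrakk>
          \<Longrightarrow> mul (mul x y) z = mul x (mul y z)"
    and mul_add_left: "\<And>x y z. \<lbrakk>x \<in> vectors E; y \<in> vectors E; z \<in> vectors E\<rbrakk>
          \<Longrightarrow> mul (x + y) z = mul x z + mul y z"
    and mul_add_right: "\<And>x y z. \<lbrakk>x \<in> vectors E; y \<in> vectors E; z \<in> vectors E\<rbrakk>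
          \<Longrightarrow> mul x (y + z) = mul x y + mul x z"
    and mul_scale_left: "\<And>c x y. \<lbrakk>x \<in> vectors E; y \<in> vectors E\<rbrakk>
          \<Longrightarrow> mul (cscale E c x) y = cscale E c (mul x y)"
    and mul_scale_right: "\<And>c x y. \<lbrakk>x \<in> vectors E; y \<in> vectors E\<rbrakk>
          \<Longrightarrow> mul x (cscale E c y) = cscale E c (mul x y)"
    and mul_jcc: "\<And>p q X Y. \<lbrakk>p \<ge> 1; q \<ge> 1; X \<in> Mats E p; Y \<in> Mats E q\<rbrakk>
          \<Longrightarrow> mnorm E (mat_mult_tensor mul X Y) \<le> mnorm E X * mnorm E Y"

definition bounded_clinear_map ::
  "('v::ab_group_add, 'y) matrix_normed_scheme \<Rightarrow> ('w::ab_group_add, 'z) matrix_normed_scheme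
    \<Rightarrow> ('v \<Rightarrow> 'w) \<Rightarrow> bool" where
  "bounded_clinear_map V W D \<longleftrightarrow>
    (\<forall>h\<in>vectors V. D h \<in> vectors W) \<and>
    (\<forall>h\<in>vectors V. \<forall>k\<in>vectors V. D (h + k) = D h + D k) \<and>
    (\<forall>c. \<forall>h\<in>vectors V. D (cscale V c h) = cscale W c (D h)) \<and>
    (\<exists>K. \<forall>h\<in>vectors V. vnorm W (D h) \<le> K * vnorm V h)"

definition has_frechet_derivative ::
  "('v::ab_group_add, 'y) matrix_normed_scheme \<Rightarrow> ('w::ab_group_add, 'z) matrix_normed_scheme
    \<Rightarrow> ('v \<Rightarrow> 'w) \<Rightarrow> ('v \<Rightarrow> 'w) \<Rightarrow> 'v \<Rightarrow> bool" where
  "has_frechet_derivative V W f D x \<longleftrightarrow> bounded_clinear_map V W D \<and>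
    (\<forall>e>0. \<exists>d>0. \<forall>h\<in>vectors V. vnorm V h < d \<longrightarrow>
      vnorm W (f (x + h) - f x - D h) \<le> e * vnorm V h)"

definition holomorphic_map ::
  "('v::ab_group_add, 'y) matrix_normed_scheme \<Rightarrow> ('w::ab_group_add, 'z) matrix_normed_scheme
    \<Rightarrow> ('v \<Rightarrow> 'w) \<Rightarrow> bool" where
  "holomorphic_map V W f \<longleftrightarrow>
    (\<forall>x\<in>unit_ball V. f x \<in> vectors W \<and> (\<exists>D. has_frechet_derivative V W f D x))"

definition cb_holomorphic ::
  "('v::ab_group_add, 'y) matrix_normed_scheme \<Rightarrow> ('w::ab_group_add, 'z) matrix_normed_scheme
    \<Rightarrow> ('v \<Rightarrow> 'w) \<Rightarrow> bool" where
  "cb_holomorphic V W f \<longleftrightarrow> holomorphic_map V W f \<and>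
    bdd_above {mnorm W (map_mat f X) | m X. m \<ge> 1 \<and> X \<in> mat_unit_ball V m}"

text \<open>\<open>(f\<^sub>k\<^sub>l(x\<^sub>i\<^sub>j))\<close> as a block matrix, with outer indices \<open>k, l\<close> and inner indices \<open>i, j\<close>.\<close>

definition amplify :: "('v \<Rightarrow> 'w) mat \<Rightarrow> 'v mat \<Rightarrow> 'w mat" where
  "amplify F X = Matrix.mat (dim_row F * dim_row X) (dim_col F * dim_col X)
    (\<lambda>(i, j). (F $$ (i div dim_row X, j div dim_col X)) (X $$ (i mod dim_row X, j mod dim_col X)))"

text \<open>A function on the open unit ball is represented by the total function that extends it by
  zero; addition of functions is the pointwise one of the function type.\<close>

definition Hcb ::
  "('v::ab_group_add, 'y) matrix_normed_scheme \<Rightarrow> ('w::ab_group_add, 'z) matrix_normed_scheme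
    \<Rightarrow> ('v \<Rightarrow> 'w) matrix_normed" where
  "Hcb V W = \<lparr>
    vectors = {f. cb_holomorphic V W f \<and> (\<forall>x. x \<notin> unit_ball V \<longrightarrow> f x = 0)},
    cscale = (\<lambda>c f x. cscale W c (f x)),
    mnorm = (\<lambda>F. Sup {mnorm W (amplify F X) | m X. m \<ge> 1 \<and> X \<in> mat_unit_ball V m})\<rparr>"

definition complex_os :: "complex matrix_normed" where
  "complex_os = \<lparr>vectors = UNIV, cscale = (*), mnorm = cmat_norm\<rparr>"

text \<open>Complex Hilbert spaces, with the inner product linear in the first argument. The library
  provides the underlying real Banach space, hence the type of bounded real-linear operators;
  the complex-linear ones among them are singled out below.\<close>

class complex_hilbert = banach +
  fixes scaleC :: "complex \<Rightarrow> 'a \<Rightarrow> 'a"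
    and cinner :: "'a \<Rightarrow> 'a \<Rightarrow> complex"
  assumes scaleC_add_right: "scaleC c (x + y) = scaleC c x + scaleC c y"
    and scaleC_add_left: "scaleC (c + d) x = scaleC c x + scaleC d x"
    and scaleC_scaleC: "scaleC c (scaleC d x) = scaleC (c * d) x"
    and scaleC_of_real: "scaleC (complex_of_real r) x = scaleR r x"
    and cinner_add_left: "cinner (x + y) z = cinner x z + cinner y z"
    and cinner_scaleC_left: "cinner (scaleC c x) y = c * cinner x y"
    and cinner_commute: "cinner x y = cnj (cinner y x)"
    and cinner_self: "cinner x x = complex_of_real ((norm x)\<^sup>2)"

definition op_scaleC ::
  "complex \<Rightarrow> ('h::complex_hilbert \<Rightarrow>\<^sub>L 'h) \<Rightarrow> ('h \<Rightarrow>\<^sub>L 'h)" where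
  "op_scaleC c T = Blinfun (\<lambda>x. scaleC c (blinfun_apply T x))"

lemma norm_scaleC: "norm (scaleC c x) = cmod c * norm (x :: 'h::complex_hilbert)"
proof -
  have "cinner (scaleC c x) (scaleC c x) = c * cnj c * cinner x x"
    by (metis cinner_commute cinner_scaleC_left complex_cnj_mult mult.assoc)
  then have "complex_of_real ((norm (scaleC c x))\<^sup>2) = complex_of_real ((cmod c * norm x)\<^sup>2)"
    by (simp add: cinner_self complex_norm_square power_mult_distrib flip: of_real_power)
  then have "(norm (scaleC c x))\<^sup>2 = (cmod c * norm x)\<^sup>2"
    by (simp only: of_real_eq_iff)
  then show ?thesis by simp
qed

lemma op_scaleC_apply [simp]:
  "blinfun_apply (op_scaleC c T) x = scaleC c (blinfun_apply T x)"
proof -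
  have "bounded_linear (scaleC c :: 'a \<Rightarrow> 'a)"
  proof (rule bounded_linear_intro)
    show "scaleC c (scaleR r x) = scaleR r (scaleC c x)" for r and x :: 'a
      by (simp add: scaleC_scaleC mult.commute flip: scaleC_of_real)
    show "norm (scaleC c x) \<le> norm x * cmod c" for x :: 'a
      by (simp add: norm_scaleC)
  qed (rule scaleC_add_right)
  from bounded_linear_compose[OF this blinfun.bounded_linear_right[of T]] show ?thesis
    by (simp add: op_scaleC_def bounded_linear_Blinfun_apply)
qed

definition bounded_operators :: "('h::complex_hilbert \<Rightarrow>\<^sub>L 'h) set" where
  "bounded_operators =
    {T. \<forall>c x. blinfun_apply T (scaleC c x) = scaleC c (blinfun_apply T x)}"

text \<open>The norm of \<open>M\<^sub>n(B(H)) = B(H\<^sup>n)\<close>.\<close>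

definition op_mat_norm :: "('h::complex_hilbert \<Rightarrow>\<^sub>L 'h) mat \<Rightarrow> real" where
  "op_mat_norm X =
    (SUP \<xi> \<in> {\<xi> :: nat \<Rightarrow> 'h. L2_set (\<lambda>j. norm (\<xi> j)) {..<dim_col X} \<le> 1}.
      L2_set (\<lambda>i. norm (\<Sum>j<dim_col X. blinfun_apply (X $$ (i, j)) (\<xi> j))) {..<dim_row X})"

text \<open>Norm-closed, since operator spaces are complete; neither a unit nor closure under adjoints
  is required.\<close>

definition operator_algebra :: "('h::complex_hilbert \<Rightarrow>\<^sub>L 'h) set \<Rightarrow> bool" where
  "operator_algebra A \<longleftrightarrow>
    A \<subseteq> bounded_operators \<and> module.subspace op_scaleC A \<and>
    (\<forall>S\<in>A. \<forall>T\<in>A. S o\<^sub>L T \<in> A) \<and> closed A"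

definition induced_os ::
  "('h::complex_hilbert \<Rightarrow>\<^sub>L 'h) set \<Rightarrow> ('h \<Rightarrow>\<^sub>L 'h) matrix_normed" where
  "induced_os A = \<lparr>vectors = A, cscale = op_scaleC, mnorm = op_mat_norm\<rparr>"

end

theory Submission
  imports Defs "HOL-Complex_Analysis.Conformal_Mappings"
begin

text \<open>
  The multiplication of the function space is a compression of that of the range space: the entries
  of \<open>(F G)(X)\<close> are those entries of \<open>F(X) \<otimes> G(X)\<close> in which both factors are evaluated at the same
  \<open>x\<^sub>i\<^sub>j\<close>, so joint complete contractivity is inherited from the range. Ruan's axioms are inherited
  level by level, since block matrices over functions turn into block matrices over the range.
  For completeness, composing with a norming family of functionals (vector functionals
  \<open>T \<mapsto> \<langle>T\<xi>, \<eta>\<rangle>\<close> in the concrete case, so that Hahn-Banach is not needed) and restricting to complex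
  lines gives the Schwarz lemma for vector-valued maps; hence derivatives of a uniformly Cauchy
  sequence converge and the uniform limit is again Frechet differentiable.
  Among Ruan's axioms for matrices of operators on \<open>H\<close>, the only one that uses the inner product is
  the bound for scalar matrices, \<open>\<parallel>\<alpha> \<otimes> 1\<^sub>H\<parallel> \<le> \<parallel>\<alpha>\<parallel>\<close>: expand finitely many vectors in an orthogonal system.
\<close>

section \<open>Norms of operator matrices\<close>

text \<open>Membership in the function space asks for a Frechet derivative at each point of the
  ball, and uniform limits preserve differentiability only because of holomorphy. The usual role of
  the Cauchy integral formula is taken by one estimate: if f is bounded by M on the ball, then both
  its derivative at x and its increments from x are bounded by 2 M / (1 - \<open>vnorm V x\<close>)
  times the norm of h. The denominator is the distance from x within which the ball cannot be left;
  the factor 2 arises because the Schwarz lemma needs the value at the centre subtracted, which may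
  double the bound. Applied to differences of members of a Cauchy sequence, it controls derivatives
  and remainders with the same constant. Two further points fix the form of the proof. The norms are
  suprema of sets of reals, so boundedness of amplifications comes before any inequality between
  norms. And operators enter only through an action on a Hilbert space, so that the scalar range is
  the case of the complex numbers acting on themselves.\<close>

definition act_norm :: "('a \<Rightarrow> 'h \<Rightarrow> 'h::real_normed_vector) \<Rightarrow> 'a mat \<Rightarrow> real" where
  "act_norm act X =
    (SUP \<xi> \<in> {\<xi> :: nat \<Rightarrow> 'h. L2_set (\<lambda>j. norm (\<xi> j)) {..<dim_col X} \<le> 1}.
      L2_set (\<lambda>i. norm (\<Sum>j<dim_col X. act (X $$ (i, j)) (\<xi> j))) {..<dim_row X})"

text \<open>Scalars acting by multiplication and operators acting by application give the two
  concrete matrix norms. What is proved for \<open>act_norm\<close> thus serves the scalar matrices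
  in Ruan's axioms as well as the matrix norms of the range.\<close>

lemma cmat_norm_eq_act_norm: "cmat_norm = act_norm (*)"
  by (rule ext) (simp add: cmat_norm_def act_norm_def)

lemma op_mat_norm_eq_act_norm: "op_mat_norm = act_norm blinfun_apply"
  by (rule ext) (simp add: op_mat_norm_def act_norm_def)

text \<open>A supremum of reals carries no information unless the set is bounded. On the unit ball
  each coordinate has norm at most 1, so the sum of the operator norms of all entries is a crude
  bound.\<close>

lemma act_norm_bdd_above:
  fixes act :: "'a \<Rightarrow> 'h \<Rightarrow> 'h::real_normed_vector"
  assumes "\<And>i j. i < dim_row X \<Longrightarrow> j < dim_col X \<Longrightarrow> bounded_linear (act (X $$ (i, j)))"
  shows "bdd_above ((\<lambda>\<xi>. L2_set (\<lambda>i. norm (\<Sum>j<dim_col X. act (X $$ (i, j)) (\<xi> j))) {..<dim_row X})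
    ` {\<xi> :: nat \<Rightarrow> 'h. L2_set (\<lambda>j. norm (\<xi> j)) {..<dim_col X} \<le> 1})"
proof (rule bdd_aboveI2)
  fix \<xi> :: "nat \<Rightarrow> 'h"
  assume "\<xi> \<in> {\<xi>. L2_set (\<lambda>j. norm (\<xi> j)) {..<dim_col X} \<le> 1}"
  then have \<xi>: "norm (\<xi> j) \<le> 1" if "j < dim_col X" for j
    using member_le_L2_set[of "{..<dim_col X}" j "\<lambda>j. norm (\<xi> j)"] that by simp
  have "L2_set (\<lambda>i. norm (\<Sum>j<dim_col X. act (X $$ (i, j)) (\<xi> j))) {..<dim_row X}
      \<le> (\<Sum>i<dim_row X. norm (\<Sum>j<dim_col X. act (X $$ (i, j)) (\<xi> j)))"
    by (rule L2_set_le_sum) simp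
  also have "\<dots> \<le> (\<Sum>i<dim_row X. \<Sum>j<dim_col X. onorm (act (X $$ (i, j))))"
  proof (intro sum_mono sum_norm_le)
    fix i j assume "i \<in> {..<dim_row X}" "j \<in> {..<dim_col X}"
    then have bl: "bounded_linear (act (X $$ (i, j)))" and "norm (\<xi> j) \<le> 1"
      using assms \<xi> by auto
    then show "norm (act (X $$ (i, j)) (\<xi> j)) \<le> onorm (act (X $$ (i, j)))"
      using onorm[OF bl, of "\<xi> j"] onorm_pos_le[OF bl]
      by (meson dual_order.trans mult_left_le)
  qed
  finally show "L2_set (\<lambda>i. norm (\<Sum>j<dim_col X. act (X $$ (i, j)) (\<xi> j))) {..<dim_row X}
      \<le> (\<Sum>i<dim_row X. \<Sum>j<dim_col X. onorm (act (X $$ (i, j))))" .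
qed

text \<open>Homogeneity: divide \<xi> by its norm to enter the unit ball. If that norm is 0, all
  coordinates that the matrix sees vanish.\<close>

lemma act_norm_bound:
  fixes act :: "'a \<Rightarrow> 'h \<Rightarrow> 'h::real_normed_vector"
  assumes bl: "\<And>i j. i < dim_row X \<Longrightarrow> j < dim_col X \<Longrightarrow> bounded_linear (act (X $$ (i, j)))"
  shows "L2_set (\<lambda>i. norm (\<Sum>j<dim_col X. act (X $$ (i, j)) (\<xi> j))) {..<dim_row X}
    \<le> act_norm act X * L2_set (\<lambda>j. norm (\<xi> j)) {..<dim_col X}"
proof (cases "L2_set (\<lambda>j. norm (\<xi> j)) {..<dim_col X} = 0")
  case True
  then have "\<xi> j = 0" if "j < dim_col X" for j
    using that by (simp add: L2_set_eq_0_iff)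
  then have "L2_set (\<lambda>i. norm (\<Sum>j<dim_col X. act (X $$ (i, j)) (\<xi> j))) {..<dim_row X} = 0"
    using bl by (intro L2_set_0') (simp add: linear_simps(3))
  then show ?thesis using True by simp
next
  case False
  define r where "r = L2_set (\<lambda>j. norm (\<xi> j)) {..<dim_col X}"
  then have r: "r > 0" using False by (simp add: less_le)
  let ?\<eta> = "\<lambda>j. scaleR (inverse r) (\<xi> j)"
  have "L2_set (\<lambda>j. norm (?\<eta> j)) {..<dim_col X} = inverse r * r"
    using r by (simp add: r_def L2_set_right_distrib)
  then have "?\<eta> \<in> {\<xi>. L2_set (\<lambda>j. norm (\<xi> j)) {..<dim_col X} \<le> 1}"
    using r by simp
  from cSUP_upper[OF this act_norm_bdd_above[where act = act and X = X, OF bl]]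
  have "L2_set (\<lambda>i. norm (\<Sum>j<dim_col X. act (X $$ (i, j)) (?\<eta> j))) {..<dim_row X} \<le> act_norm act X"
    by (simp add: act_norm_def)
  moreover have "L2_set (\<lambda>i. norm (\<Sum>j<dim_col X. act (X $$ (i, j)) (?\<eta> j))) {..<dim_row X}
      = L2_set (\<lambda>i. inverse r * norm (\<Sum>j<dim_col X. act (X $$ (i, j)) (\<xi> j))) {..<dim_row X}"
    using bl r by (intro L2_set_cong) (simp_all add: linear_simps(5) flip: scaleR_right.sum)
  ultimately have "inverse r * L2_set (\<lambda>i. norm (\<Sum>j<dim_col X. act (X $$ (i, j)) (\<xi> j))) {..<dim_row X}
      \<le> act_norm act X"
    using r by (simp add: L2_set_right_distrib)
  then show ?thesis using r by (simp add: r_def[symmetric] field_simps)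
qed

lemma act_norm_least:
  fixes act :: "'a \<Rightarrow> 'h \<Rightarrow> 'h::real_normed_vector"
  assumes "\<And>\<xi>. L2_set (\<lambda>i. norm (\<Sum>j<dim_col X. act (X $$ (i, j)) (\<xi> j))) {..<dim_row X}
    \<le> C * L2_set (\<lambda>j. norm (\<xi> j)) {..<dim_col X}" "C \<ge> 0"
  shows "act_norm act X \<le> C"
  unfolding act_norm_def
proof (rule cSUP_least)
  have "(\<lambda>_. 0) \<in> {\<xi> :: nat \<Rightarrow> 'h. L2_set (\<lambda>j. norm (\<xi> j)) {..<dim_col X} \<le> 1}"
    by (simp add: L2_set_def)
  then show "{\<xi> :: nat \<Rightarrow> 'h. L2_set (\<lambda>j. norm (\<xi> j)) {..<dim_col X} \<le> 1} \<noteq> {}"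
    by (rule ex_in_conv[THEN iffD1, OF exI])
  show "L2_set (\<lambda>i. norm (\<Sum>j<dim_col X. act (X $$ (i, j)) (\<xi> j))) {..<dim_row X} \<le> C"
    if "\<xi> \<in> {\<xi> :: nat \<Rightarrow> 'h. L2_set (\<lambda>j. norm (\<xi> j)) {..<dim_col X} \<le> 1}" for \<xi>
    using assms(1)[of \<xi>] assms(2) that by (auto intro: order_trans mult_left_le)
qed

lemma act_norm_nonneg:
  fixes act :: "'a \<Rightarrow> 'h \<Rightarrow> 'h::real_normed_vector"
  assumes "\<And>i j. i < dim_row X \<Longrightarrow> j < dim_col X \<Longrightarrow> bounded_linear (act (X $$ (i, j)))"
  shows "act_norm act X \<ge> 0"
proof -
  have "(\<lambda>_. 0) \<in> {\<xi> :: nat \<Rightarrow> 'h. L2_set (\<lambda>j. norm (\<xi> j)) {..<dim_col X} \<le> 1}"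
    by (simp add: L2_set_def)
  from cSUP_upper[OF this act_norm_bdd_above[where act = act and X = X, OF assms]] show ?thesis
    unfolding act_norm_def by (rule order_trans[rotated]) simp_all
qed

text \<open>Squared norms add over blocks of coordinates while the norms do not. This lemma and its
  converse below allow index sums to be split, swapped and reassembled in squared form.\<close>

lemma sum_power2_le_of_L2_set_le:
  assumes "L2_set f A \<le> C * L2_set g B"
  shows "(\<Sum>i\<in>A. (f i)\<^sup>2) \<le> C\<^sup>2 * (\<Sum>i\<in>B. (g i)\<^sup>2)"
proof -
  have "(L2_set f A)\<^sup>2 \<le> (C * L2_set g B)\<^sup>2"
    by (rule power_mono[OF assms]) simp
  then show ?thesis by (simp add: L2_set_def sum_nonneg power_mult_distrib)
qed

lemma L2_set_le_of_sum_power2_le: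
  assumes "(\<Sum>i\<in>A. (f i)\<^sup>2) \<le> C\<^sup>2 * (\<Sum>i\<in>B. (g i)\<^sup>2)" "C \<ge> 0"
  shows "L2_set f A \<le> C * L2_set g B"
proof -
  have "L2_set f A \<le> sqrt (C\<^sup>2 * (\<Sum>i\<in>B. (g i)\<^sup>2))"
    unfolding L2_set_def using assms(1) by simp
  also have "\<dots> = C * L2_set g B"
    using assms(2) by (simp add: L2_set_def real_sqrt_mult)
  finally show ?thesis .
qed

section \<open>Norms of scalar matrices\<close>

lemma cmat_norm_nonneg: "cmat_norm \<alpha> \<ge> 0"
  unfolding cmat_norm_eq_act_norm
  by (rule act_norm_nonneg[where act = "(*)" and X = \<alpha>]) (simp add: bounded_linear_mult_right)

lemma cmat_norm_bound:
  "L2_set (\<lambda>i. cmod (\<Sum>j<dim_col \<alpha>. \<alpha> $$ (i, j) * \<xi> j)) {..<dim_row \<alpha>}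
    \<le> cmat_norm \<alpha> * L2_set (\<lambda>j. cmod (\<xi> j)) {..<dim_col \<alpha>}"
  unfolding cmat_norm_eq_act_norm
  by (rule act_norm_bound[where act = "(*)" and X = \<alpha>]) (simp add: bounded_linear_mult_right)

lemma cmat_norm_least:
  assumes "\<And>\<xi>. L2_set (\<lambda>i. cmod (\<Sum>j<dim_col \<alpha>. \<alpha> $$ (i, j) * \<xi> j)) {..<dim_row \<alpha>}
    \<le> C * L2_set (\<lambda>j. cmod (\<xi> j)) {..<dim_col \<alpha>}" "C \<ge> 0"
  shows "cmat_norm \<alpha> \<le> C"
  unfolding cmat_norm_eq_act_norm using assms by (rule act_norm_least[where act = "(*)" and X = \<alpha>])

text \<open>The norm of \<open>\<alpha> \<otimes> 1\<^sub>m\<close>.\<close>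

lemma cmat_norm_amplification:
  "cmat_norm (Matrix.mat (dim_row \<alpha> * m) (dim_col \<alpha> * m)
     (\<lambda>(i, j). if i mod m = j mod m then \<alpha> $$ (i div m, j div m) else 0)) \<le> cmat_norm \<alpha>"
    (is "cmat_norm ?A \<le> _")
proof (rule cmat_norm_least)
  fix \<xi> :: "nat \<Rightarrow> complex"
  have row: "(\<Sum>j<dim_col \<alpha> * m. ?A $$ (u + i * m, j) * \<xi> j)
      = (\<Sum>k<dim_col \<alpha>. \<alpha> $$ (i, k) * \<xi> (u + k * m))" if "i < dim_row \<alpha>" "u < m" for i u
  proof -
    have lt: "u + i * m < dim_row \<alpha> * m"
    proof -
      have "u + i * m < Suc i * m" using that by simp
      also have "\<dots> \<le> dim_row \<alpha> * m" using that by (intro mult_le_mono1) simp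
      finally show ?thesis .
    qed
    have "(\<Sum>j<dim_col \<alpha> * m. ?A $$ (u + i * m, j) * \<xi> j)
      = (\<Sum>j<dim_col \<alpha> * m. (if u = j mod m then \<alpha> $$ (i, j div m) else 0) * \<xi> j)"
      using that lt by (intro sum.cong) auto
    also have "\<dots> = (\<Sum>k<dim_col \<alpha>. \<Sum>v<m. if v = u then \<alpha> $$ (i, k) * \<xi> (u + k * m) else 0)"
      unfolding sum_mult_product by (intro sum.cong) auto
    also have "\<dots> = (\<Sum>k<dim_col \<alpha>. \<alpha> $$ (i, k) * \<xi> (u + k * m))"
      using that by simp
    finally show ?thesis .
  qed
  have "(\<Sum>i<dim_row \<alpha> * m. (cmod (\<Sum>j<dim_col \<alpha> * m. ?A $$ (i, j) * \<xi> j))\<^sup>2)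
    = (\<Sum>i<dim_row \<alpha>. \<Sum>u<m. (cmod (\<Sum>k<dim_col \<alpha>. \<alpha> $$ (i, k) * \<xi> (u + k * m)))\<^sup>2)"
    by (subst sum_mult_product) (intro sum.cong refl, simp add: row)
  \<comment> \<open>For a fixed inner index u the coordinates u + k * m form one slice of \<xi>. The
    amplified matrix acts on each of the m slices as \<alpha>, and the squares of the slices add
    up.\<close>
  also have "\<dots> = (\<Sum>u<m. \<Sum>i<dim_row \<alpha>. (cmod (\<Sum>k<dim_col \<alpha>. \<alpha> $$ (i, k) * \<xi> (u + k * m)))\<^sup>2)"
    by (rule sum.swap)
  also have "\<dots> \<le> (\<Sum>u<m. (cmat_norm \<alpha>)\<^sup>2 * (\<Sum>k<dim_col \<alpha>. (cmod (\<xi> (u + k * m)))\<^sup>2))"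
    by (intro sum_mono sum_power2_le_of_L2_set_le cmat_norm_bound)
  also have "\<dots> = (cmat_norm \<alpha>)\<^sup>2 * (\<Sum>j<dim_col \<alpha> * m. (cmod (\<xi> j))\<^sup>2)"
    unfolding sum_mult_product by (subst sum.swap) (simp add: sum_distrib_left)
  finally show "L2_set (\<lambda>i. cmod (\<Sum>j<dim_col ?A. ?A $$ (i, j) * \<xi> j)) {..<dim_row ?A}
      \<le> cmat_norm \<alpha> * L2_set (\<lambda>j. cmod (\<xi> j)) {..<dim_col ?A}"
    by (intro L2_set_le_of_sum_power2_le) (simp_all add: cmat_norm_nonneg)
qed (rule cmat_norm_nonneg)

text \<open>A partial permutation matrix when \<sigma> is injective on the rows singled out by P;
  all other rows are zero. With P constantly true it extracts submatrices, otherwise it pads a block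
  with zeros.\<close>

definition selection :: "nat \<Rightarrow> nat \<Rightarrow> (nat \<Rightarrow> bool) \<Rightarrow> (nat \<Rightarrow> nat) \<Rightarrow> complex mat" where
  "selection m n P \<sigma> = Matrix.mat m n (\<lambda>(i, k). if P i \<and> k = \<sigma> i then 1 else 0)"

text \<open>Distinct rows read distinct coordinates of \<xi>, so each square is counted at most
  once.\<close>

lemma cmat_norm_selection:
  assumes "inj_on \<sigma> {i. i < m \<and> P i}" "\<And>i. i < m \<Longrightarrow> P i \<Longrightarrow> \<sigma> i < n"
  shows "cmat_norm (selection m n P \<sigma>) \<le> 1"
proof (rule cmat_norm_least)
  fix \<xi> :: "nat \<Rightarrow> complex"
  have "(\<Sum>i<m. (cmod (\<Sum>k<n. selection m n P \<sigma> $$ (i, k) * \<xi> k))\<^sup>2)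
      = (\<Sum>i<m. if P i then (cmod (\<xi> (\<sigma> i)))\<^sup>2 else 0)"
  proof (intro sum.cong refl)
    fix i assume i: "i \<in> {..<m}"
    have "(\<Sum>k<n. selection m n P \<sigma> $$ (i, k) * \<xi> k) = (\<Sum>k<n. if k = \<sigma> i then (if P i then \<xi> k else 0) else 0)"
      using i by (intro sum.cong) (auto simp: selection_def)
    then show "(cmod (\<Sum>k<n. selection m n P \<sigma> $$ (i, k) * \<xi> k))\<^sup>2 = (if P i then (cmod (\<xi> (\<sigma> i)))\<^sup>2 else 0)"
      using assms(2) i by auto
  qed
  also have "\<dots> = (\<Sum>i\<in>{i. i < m \<and> P i}. (cmod (\<xi> (\<sigma> i)))\<^sup>2)"
    by (simp add: sum.If_cases) (rule sum.cong, auto)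
  also have "\<dots> = (\<Sum>k\<in>\<sigma> ` {i. i < m \<and> P i}. (cmod (\<xi> k))\<^sup>2)"
    using assms(1) by (simp add: sum.reindex)
  also have "\<dots> \<le> (\<Sum>k<n. (cmod (\<xi> k))\<^sup>2)"
    using assms(2) by (intro sum_mono2) auto
  finally show "L2_set (\<lambda>i. cmod (\<Sum>j<dim_col (selection m n P \<sigma>). selection m n P \<sigma> $$ (i, j) * \<xi> j))
      {..<dim_row (selection m n P \<sigma>)} \<le> 1 * L2_set (\<lambda>j. cmod (\<xi> j)) {..<dim_col (selection m n P \<sigma>)}"
    by (intro L2_set_le_of_sum_power2_le) (simp_all add: selection_def)
qed simp

text \<open>This is the right factor in a conjugation. It writes the coordinates of \<xi> chosen by
  P into distinct positions, so no two of them are ever added.\<close>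

lemma cmat_norm_selection_transpose:
  assumes inj: "inj_on \<sigma> {i. i < m \<and> P i}" and lt: "\<And>i. i < m \<Longrightarrow> P i \<Longrightarrow> \<sigma> i < n"
  shows "cmat_norm (transpose_mat (selection m n P \<sigma>)) \<le> 1"
proof (rule cmat_norm_least)
  fix \<xi> :: "nat \<Rightarrow> complex"
  let ?S = "{i. i < m \<and> P i}" and ?B = "transpose_mat (selection m n P \<sigma>)"
  have entry: "(\<Sum>i<m. ?B $$ (k, i) * \<xi> i) = (\<Sum>i\<in>?S. if \<sigma> i = k then \<xi> i else 0)"
    if "k < n" for k
    using that by (intro sum.mono_neutral_cong_right) (auto simp: selection_def)
  have "(\<Sum>k<n. (cmod (\<Sum>i<m. ?B $$ (k, i) * \<xi> i))\<^sup>2)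
      = (\<Sum>k<n. (cmod (\<Sum>i\<in>?S. if \<sigma> i = k then \<xi> i else 0))\<^sup>2)"
    by (intro sum.cong refl) (simp add: entry)
  also have "\<dots> = (\<Sum>k\<in>\<sigma> ` ?S. (cmod (\<Sum>i\<in>?S. if \<sigma> i = k then \<xi> i else 0))\<^sup>2)"
    using lt by (intro sum.mono_neutral_cong_right) (auto intro!: sum.neutral)
  also have "\<dots> = (\<Sum>k\<in>?S. (cmod (\<Sum>i\<in>?S. if \<sigma> i = \<sigma> k then \<xi> i else 0))\<^sup>2)"
    using inj by (simp add: sum.reindex)
  also have "\<dots> = (\<Sum>k\<in>?S. (cmod (\<xi> k))\<^sup>2)"
  proof (intro sum.cong refl)
    fix k assume k: "k \<in> ?S"
    then have "(\<Sum>i\<in>?S. if \<sigma> i = \<sigma> k then \<xi> i else 0) = (\<Sum>i\<in>?S. if i = k then \<xi> i else 0)"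
      using inj by (intro sum.cong refl) (auto dest: inj_onD)
    also have "\<dots> = \<xi> k" using k by simp
    finally show "(cmod (\<Sum>i\<in>?S. if \<sigma> i = \<sigma> k then \<xi> i else 0))\<^sup>2 = (cmod (\<xi> k))\<^sup>2"
      by simp
  qed
  also have "\<dots> \<le> (\<Sum>k<m. (cmod (\<xi> k))\<^sup>2)"
    by (intro sum_mono2) auto
  finally show "L2_set (\<lambda>i. cmod (\<Sum>j<dim_col ?B. ?B $$ (i, j) * \<xi> j)) {..<dim_row ?B}
      \<le> 1 * L2_set (\<lambda>j. cmod (\<xi> j)) {..<dim_col ?B}"
    by (intro L2_set_le_of_sum_power2_le) (simp_all add: selection_def)
qed simp

section \<open>Abstract operator spaces\<close>

lemma Mats_iff:
  "X \<in> Mats V n \<longleftrightarrow> X \<in> carrier_mat n n \<and> (\<forall>i<n. \<forall>j<n. X $$ (i, j) \<in> vectors V)"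
proof (cases "X \<in> carrier_mat n n")
  case True
  then have "elements_mat X = (\<lambda>(i, j). X $$ (i, j)) ` ({..<n} \<times> {..<n})"
    by (auto simp: elements_mat_def)
  then show ?thesis using True by (auto simp: Mats_def)
qed (simp add: Mats_def)

lemma mat_in_Mats [simp]:
  "Matrix.mat n n f \<in> Mats V n \<longleftrightarrow> (\<forall>i<n. \<forall>j<n. f (i, j) \<in> vectors V)"
  by (simp add: Mats_iff)

lemma Mats_carrier: "X \<in> Mats V n \<Longrightarrow> X \<in> carrier_mat n n"
  by (simp add: Mats_iff)

lemma Mats_dim: "X \<in> Mats V n \<Longrightarrow> dim_row X = n" "X \<in> Mats V n \<Longrightarrow> dim_col X = n"
  by (auto dest: Mats_carrier)

lemma Mats_entry: "X \<in> Mats V n \<Longrightarrow> i < n \<Longrightarrow> j < n \<Longrightarrow> X $$ (i, j) \<in> vectors V"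
  by (simp add: Mats_iff)

text \<open>A pair of an outer index a and an inner index i is coded as i + a * m throughout, which
  is the form in which \<open>sum_mult_product\<close> splits a sum over a product range.\<close>

lemma block_index_less: "a < p \<Longrightarrow> i < m \<Longrightarrow> i + a * m < p * (m::nat)"
proof -
  assume "a < p" "i < m"
  then have "i + a * m < Suc a * m" by simp
  also have "\<dots> \<le> p * m" using \<open>a < p\<close> by (intro mult_le_mono1) simp
  finally show ?thesis .
qed

lemma mod_less_of_less_mult: "i < p * m \<Longrightarrow> i mod m < (m::nat)"
  by (cases m) auto

lemma div_less_of_less_mult: "i < p * m \<Longrightarrow> i div m < (p::nat)"
  by (simp add: less_mult_imp_div_less)

context operator_space
begin

interpretation scale: vector_space "cscale V" by (rule ambient)

lemmas cscale_simps [simp] = scale.scale_zero_left scale.scale_zero_right scale.scale_one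

lemmas cscale_algebra = scale.scale_scale scale.scale_right_distrib scale.scale_left_distrib
  scale.scale_minus_left scale.scale_minus_right scale.scale_right_diff_distrib
  scale.scale_left_diff_distrib scale.scale_sum_right scale.scale_sum_left

lemma zero_in_vectors [simp, intro]: "0 \<in> vectors V"
  using subspace by (rule scale.subspace_0)

lemma add_in_vectors [simp, intro]: "x \<in> vectors V \<Longrightarrow> y \<in> vectors V \<Longrightarrow> x + y \<in> vectors V"
  using subspace by (rule scale.subspace_add)

lemma cscale_in_vectors [simp, intro]: "x \<in> vectors V \<Longrightarrow> cscale V c x \<in> vectors V"
  using subspace by (rule scale.subspace_scale)

lemma uminus_in_vectors [simp, intro]: "x \<in> vectors V \<Longrightarrow> - x \<in> vectors V"
  using subspace by (rule scale.subspace_neg)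

lemma diff_in_vectors [simp, intro]: "x \<in> vectors V \<Longrightarrow> y \<in> vectors V \<Longrightarrow> x - y \<in> vectors V"
  using subspace by (rule scale.subspace_diff)

text \<open>Positivity is not among the axioms; it follows from 0 = norm of X - X, which is at most
  twice the norm of X.\<close>

lemma mnorm_nonneg:
  assumes "n \<ge> 1" "X \<in> Mats V n"
  shows "mnorm V X \<ge> 0"
proof -
  have neg: "map_mat (cscale V (- 1)) X \<in> Mats V n"
    using assms(2) by (auto simp: Mats_iff)
  have "X + map_mat (cscale V (- 1)) X = 0\<^sub>m n n"
    using assms(2) by (intro eq_matI) (auto simp: Mats_iff scale.scale_minus_left)
  moreover have "0\<^sub>m n n \<in> Mats V n" by (simp add: Mats_iff)
  ultimately have "0 = mnorm V (X + map_mat (cscale V (- 1)) X)"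
    using mnorm_zero[OF assms(1)] by simp
  also have "\<dots> \<le> mnorm V X + mnorm V X"
    using mnorm_triangle[OF assms neg] mnorm_scale[OF assms, of "- 1"] by simp
  finally show ?thesis by simp
qed

lemma vnorm_nonneg [simp]: "x \<in> vectors V \<Longrightarrow> vnorm V x \<ge> 0"
  unfolding vnorm_def by (rule mnorm_nonneg[of 1]) simp_all

lemma vnorm_eq_0_iff [simp]: "x \<in> vectors V \<Longrightarrow> vnorm V x = 0 \<longleftrightarrow> x = 0"
proof -
  assume "x \<in> vectors V"
  then have "vnorm V x = 0 \<longleftrightarrow> Matrix.mat 1 1 (\<lambda>_. x) = 0\<^sub>m 1 1"
    unfolding vnorm_def by (intro mnorm_zero) simp_all
  also have "\<dots> \<longleftrightarrow> x = 0" by (auto simp: mat_eq_iff)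
  finally show ?thesis .
qed

lemma vnorm_zero [simp]: "vnorm V 0 = 0"
  by simp

lemma vnorm_triangle:
  assumes "x \<in> vectors V" "y \<in> vectors V"
  shows "vnorm V (x + y) \<le> vnorm V x + vnorm V y"
proof -
  have "Matrix.mat 1 1 (\<lambda>_. x + y) = Matrix.mat 1 1 (\<lambda>_. x) + Matrix.mat 1 1 (\<lambda>_. y)"
    by (rule eq_matI) auto
  then show ?thesis
    unfolding vnorm_def using assms by (auto intro!: mnorm_triangle)
qed

lemma vnorm_cscale: "x \<in> vectors V \<Longrightarrow> vnorm V (cscale V c x) = cmod c * vnorm V x"
proof -
  assume "x \<in> vectors V"
  moreover have "Matrix.mat 1 1 (\<lambda>_. cscale V c x) = map_mat (cscale V c) (Matrix.mat 1 1 (\<lambda>_. x))"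
    by (rule eq_matI) auto
  ultimately show ?thesis unfolding vnorm_def by (simp add: mnorm_scale[of 1])
qed

lemma vnorm_uminus [simp]: "x \<in> vectors V \<Longrightarrow> vnorm V (- x) = vnorm V x"
  using vnorm_cscale[of x "- 1"] by (simp add: scale.scale_minus_left)

lemma vnorm_diff: "x \<in> vectors V \<Longrightarrow> y \<in> vectors V \<Longrightarrow> vnorm V (x - y) \<le> vnorm V x + vnorm V y"
  using vnorm_triangle[of x "- y"] by simp

lemma vnorm_minus_commute: "x \<in> vectors V \<Longrightarrow> y \<in> vectors V \<Longrightarrow> vnorm V (x - y) = vnorm V (y - x)"
  using vnorm_uminus[of "x - y"] by simp

text \<open>Conjugation by two selection matrices is a contraction, by Ruan's axiom
  \<open>mnorm_conj\<close>. Extraction of submatrices and padding by zeros are both derived from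
  this.\<close>

lemma mnorm_selection:
  assumes "n \<ge> 1" "m \<ge> 1" and X: "X \<in> Mats V n"
    and \<sigma>: "inj_on \<sigma> {i. i < m \<and> P i}" "\<And>i. i < m \<Longrightarrow> P i \<Longrightarrow> \<sigma> i < n"
    and \<tau>: "inj_on \<tau> {j. j < m \<and> Q j}" "\<And>j. j < m \<Longrightarrow> Q j \<Longrightarrow> \<tau> j < n"
  shows "mnorm V (Matrix.mat m m (\<lambda>(i, j). if P i \<and> Q j then X $$ (\<sigma> i, \<tau> j) else 0)) \<le> mnorm V X"
proof -
  let ?\<alpha> = "selection m n P \<sigma>" and ?\<beta> = "transpose_mat (selection m n Q \<tau>)"
  have c: "?\<alpha> \<in> carrier_mat m n" "?\<beta> \<in> carrier_mat n m"
    by (simp_all add: selection_def)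
  have "Matrix.mat m m (\<lambda>(i, j). if P i \<and> Q j then X $$ (\<sigma> i, \<tau> j) else 0) = scalar_conj V ?\<alpha> X ?\<beta>"
  proof (rule eq_matI)
    fix i j assume "i < dim_row (scalar_conj V ?\<alpha> X ?\<beta>)" "j < dim_col (scalar_conj V ?\<alpha> X ?\<beta>)"
    then have ij: "i < m" "j < m" by (simp_all add: scalar_conj_def selection_def)
    have "scalar_conj V ?\<alpha> X ?\<beta> $$ (i, j)
        = (\<Sum>k<n. \<Sum>l<n. cscale V (?\<alpha> $$ (i, k) * ?\<beta> $$ (l, j)) (X $$ (k, l)))"
      using ij Mats_dim[OF X] by (simp add: scalar_conj_def selection_def)
    also have "\<dots> = (\<Sum>k<n. \<Sum>l<n. if l = \<tau> j then (if k = \<sigma> i \<and> P i \<and> Q j then X $$ (k, l) else 0) else 0)"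
      using ij by (intro sum.cong refl) (auto simp: selection_def)
    also have "\<dots> = (\<Sum>k<n. if k = \<sigma> i then (if P i \<and> Q j then X $$ (k, \<tau> j) else 0) else 0)"
      using ij \<tau>(2) by (intro sum.cong refl) auto
    also have "\<dots> = (if P i \<and> Q j then X $$ (\<sigma> i, \<tau> j) else 0)"
      using ij \<sigma>(2) by auto
    finally show "Matrix.mat m m (\<lambda>(i, j). if P i \<and> Q j then X $$ (\<sigma> i, \<tau> j) else 0) $$ (i, j)
        = scalar_conj V ?\<alpha> X ?\<beta> $$ (i, j)"
      using ij by simp
  qed (simp_all add: scalar_conj_def selection_def)
  also have "mnorm V \<dots> \<le> cmat_norm ?\<alpha> * mnorm V X * cmat_norm ?\<beta>"
    using assms(1,2) X c by (rule mnorm_conj)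
  also have "\<dots> \<le> 1 * mnorm V X * 1"
    using mnorm_nonneg[OF assms(1) X] \<sigma> \<tau>
    by (intro mult_mono cmat_norm_selection cmat_norm_selection_transpose)
       (auto simp: cmat_norm_nonneg)
  finally show ?thesis by simp
qed

lemma mnorm_submatrix:
  assumes "n \<ge> 1" "m \<ge> 1" "X \<in> Mats V n"
    and "inj_on \<sigma> {..<m}" "\<And>i. i < m \<Longrightarrow> \<sigma> i < n"
    and "inj_on \<tau> {..<m}" "\<And>j. j < m \<Longrightarrow> \<tau> j < n"
  shows "mnorm V (Matrix.mat m m (\<lambda>(i, j). X $$ (\<sigma> i, \<tau> j))) \<le> mnorm V X"
proof -
  have "mnorm V (Matrix.mat m m (\<lambda>(i, j). if True \<and> True then X $$ (\<sigma> i, \<tau> j) else 0)) \<le> mnorm V X"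
    by (rule mnorm_selection[where P = "\<lambda>_. True" and Q = "\<lambda>_. True", OF assms(1-3)])
       (use assms(4-) in \<open>simp_all add: lessThan_def\<close>)
  then show ?thesis by (simp only: simp_thms if_True)
qed

text \<open>A block matrix is the sum of its blocks, each padded with zeros to full size, and
  padding does not increase the norm.\<close>

lemma mnorm_le_sum_blocks:
  assumes "n \<ge> 1" "m \<ge> 1" and Y: "Y \<in> Mats V (n * m)"
  shows "mnorm V Y \<le> (\<Sum>k<n. \<Sum>l<n. mnorm V (Matrix.mat m m (\<lambda>(i, j). Y $$ (i + k * m, j + l * m))))"
proof -
  define blk where "blk k l = Matrix.mat m m (\<lambda>(i, j). Y $$ (i + k * m, j + l * m))" for k l
  \<comment> \<open>\<open>R S\<close> keeps the blocks whose positions lie in S and replaces the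
    rest by zero, so that the triangle inequality can be used one block at a time, by induction on
    S.\<close>
  define R where "R S = Matrix.mat (n * m) (n * m)
    (\<lambda>(i, j). if (i div m, j div m) \<in> S then Y $$ (i, j) else 0)" for S
  have nm: "n * m \<ge> 1" using assms by simp
  have R: "R S \<in> Mats V (n * m)" for S
    using Y by (auto simp: R_def Mats_iff)
  have blk: "blk k l \<in> Mats V m" if "k < n" "l < n" for k l
    using that Y by (auto simp: blk_def Mats_iff block_index_less)
  have "mnorm V (R S) \<le> (\<Sum>(k, l)\<in>S. mnorm V (blk k l))" if "finite S" "S \<subseteq> {..<n} \<times> {..<n}" for S
    using that
  proof (induction S)
    case empty
    have "R {} = 0\<^sub>m (n * m) (n * m)" by (rule eq_matI) (auto simp: R_def)
    then show ?case using mnorm_zero[OF nm R, of "{}"] by simp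
  next
    case (insert p S)
    obtain k l where p: "p = (k, l)" by (cases p)
    then have kl: "k < n" "l < n" using insert.prems by auto
    let ?E = "Matrix.mat (n * m) (n * m)
      (\<lambda>(i, j). if i div m = k \<and> j div m = l then blk k l $$ (i mod m, j mod m) else 0)"
    have inj: "inj_on (\<lambda>i. i mod m) {i. i < n * m \<and> i div m = k}" for k
      by (auto intro!: inj_onI) (metis div_mult_mod_eq)
    have E: "mnorm V ?E \<le> mnorm V (blk k l)"
      by (rule mnorm_selection[OF \<open>m \<ge> 1\<close> nm blk[OF kl] inj _ inj]) (auto intro: mod_less_of_less_mult)
    have EM: "?E \<in> Mats V (n * m)"
      using blk[OF kl] by (auto simp: Mats_iff intro: mod_less_of_less_mult)
    have "R (insert p S) = R S + ?E"
    proof (rule eq_matI)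
      fix i j assume "i < dim_row (R S + ?E)" "j < dim_col (R S + ?E)"
      then have "i < n * m" "j < n * m" by auto
      with \<open>p \<notin> S\<close> p show "R (insert p S) $$ (i, j) = (R S + ?E) $$ (i, j)"
        by (auto simp: R_def blk_def mod_less_of_less_mult mod_div_mult_eq)
    qed (auto simp: R_def)
    then have "mnorm V (R (insert p S)) \<le> mnorm V (R S) + mnorm V ?E"
      using mnorm_triangle[OF nm R EM] by (simp only:)
    also have "\<dots> \<le> (\<Sum>(k, l)\<in>S. mnorm V (blk k l)) + mnorm V (blk k l)"
      using insert.prems by (intro add_mono E insert.IH) simp
    also have "\<dots> = (\<Sum>(k, l)\<in>insert p S. mnorm V (blk k l))"
      using insert.hyps p by simp
    finally show ?case .
  qed
  from this[of "{..<n} \<times> {..<n}"]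
  have "mnorm V (R ({..<n} \<times> {..<n})) \<le> (\<Sum>k<n. \<Sum>l<n. mnorm V (blk k l))"
    by (simp add: sum.cartesian_product)
  moreover have "R ({..<n} \<times> {..<n}) = Y"
    using Y by (intro eq_matI) (auto simp: R_def Mats_iff div_less_of_less_mult)
  ultimately show ?thesis by (simp add: blk_def)
qed

text \<open>An entry is a 1 x 1 submatrix. This puts the entries of every matrix in the matrix unit
  ball into the unit ball itself, where the maps under study are differentiable.\<close>

lemma vnorm_entry_le_mnorm:
  assumes "X \<in> Mats V n" "i < n" "j < n"
  shows "vnorm V (X $$ (i, j)) \<le> mnorm V X"
proof -
  have "mnorm V (Matrix.mat 1 1 (\<lambda>(a, b). X $$ ((\<lambda>_. i) a, (\<lambda>_. j) b))) \<le> mnorm V X"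
    using assms by (intro mnorm_submatrix[where n = n]) (auto simp: inj_on_def)
  moreover have "Matrix.mat 1 1 (\<lambda>(a, b). X $$ ((\<lambda>_. i) a, (\<lambda>_. j) b)) = Matrix.mat 1 1 (\<lambda>_. X $$ (i, j))"
    by (rule eq_matI) auto
  ultimately show ?thesis by (simp only: vnorm_def)
qed

lemma mnorm_le_sum_vnorm:
  assumes "n \<ge> 1" "X \<in> Mats V n"
  shows "mnorm V X \<le> (\<Sum>i<n. \<Sum>j<n. vnorm V (X $$ (i, j)))"
proof -
  have "Matrix.mat 1 1 (\<lambda>(i, j). X $$ (i + k * 1, j + l * 1)) = Matrix.mat 1 1 (\<lambda>_. X $$ (k, l))" for k l
    by (rule eq_matI) auto
  then show ?thesis
    using mnorm_le_sum_blocks[of n 1 X] assms by (simp add: vnorm_def)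
qed

text \<open>The norm of X exceeds that of Y k by at most the sum of the norms of the entries of the
  difference, and this sum tends to 0. The lemma is the means of passing to the limit in a Cauchy
  condition at every matrix level. Limits are stated through \<open>vnorm\<close> because the
  ambient type carries no topology.\<close>

lemma mnorm_limit_le:
  assumes n: "n \<ge> 1" and X: "X \<in> Mats V n" and Y: "\<And>k :: nat. Y k \<in> Mats V n"
    and lim: "\<And>i j. i < n \<Longrightarrow> j < n \<Longrightarrow> (\<lambda>k. vnorm V (Y k $$ (i, j) - X $$ (i, j))) \<longlonglongrightarrow> 0"
    and le: "\<forall>\<^sub>F k in sequentially. mnorm V (Y k) \<le> C"
  shows "mnorm V X \<le> C"
proof (rule tendsto_lowerbound)
  show "(\<lambda>k. C + (\<Sum>i<n. \<Sum>j<n. vnorm V (Y k $$ (i, j) - X $$ (i, j)))) \<longlonglongrightarrow> C"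
    using lim by (auto intro!: tendsto_eq_intros)
  show "\<forall>\<^sub>F k in sequentially. mnorm V X \<le> C + (\<Sum>i<n. \<Sum>j<n. vnorm V (Y k $$ (i, j) - X $$ (i, j)))"
    using le
  proof eventually_elim
    case (elim k)
    let ?D = "Matrix.mat n n (\<lambda>(i, j). X $$ (i, j) - Y k $$ (i, j))"
    have D: "?D \<in> Mats V n" using X Y by (simp add: Mats_iff)
    have "X = Y k + ?D"
      using X Y[of k] by (intro eq_matI) (auto simp: Mats_iff)
    then have "mnorm V X = mnorm V (Y k + ?D)" by (rule arg_cong)
    also have "\<dots> \<le> mnorm V (Y k) + mnorm V ?D"
      using n Y D by (rule mnorm_triangle)
    also have "mnorm V ?D \<le> (\<Sum>i<n. \<Sum>j<n. vnorm V (X $$ (i, j) - Y k $$ (i, j)))"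
      using mnorm_le_sum_vnorm[OF n D] by simp
    also have "\<dots> = (\<Sum>i<n. \<Sum>j<n. vnorm V (Y k $$ (i, j) - X $$ (i, j)))"
      using X Y[of k] by (intro sum.cong refl vnorm_minus_commute) (auto simp: Mats_iff)
    finally show ?case using elim by simp
  qed
qed simp

lemma vnorm_limit_le:
  assumes "x \<in> vectors V" "\<And>k :: nat. s k \<in> vectors V" "(\<lambda>k. vnorm V (s k - x)) \<longlonglongrightarrow> 0"
    and "\<forall>\<^sub>F k in sequentially. vnorm V (s k) \<le> C"
  shows "vnorm V x \<le> C"
  unfolding vnorm_def
  by (rule mnorm_limit_le[where Y = "\<lambda>k. Matrix.mat 1 1 (\<lambda>_. s k)"])
     (use assms in \<open>auto simp: vnorm_def\<close>)

lemma zero_in_unit_ball: "0 \<in> unit_ball V"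
  by (simp add: unit_ball_def)

lemma mat_unit_ballD:
  assumes "X \<in> mat_unit_ball V m"
  shows "X \<in> carrier_mat m m" "\<And>i j. i < m \<Longrightarrow> j < m \<Longrightarrow> X $$ (i, j) \<in> unit_ball V"
  using assms vnorm_entry_le_mnorm[of X m]
  by (auto simp: mat_unit_ball_def Mats_iff unit_ball_def intro: le_less_trans)

lemma singleton_in_mat_unit_ball:
  "x \<in> unit_ball V \<Longrightarrow> Matrix.mat 1 1 (\<lambda>_. x) \<in> mat_unit_ball V 1"
  by (simp add: mat_unit_ball_def unit_ball_def vnorm_def)

end

section \<open>Frechet differentiable maps\<close>

lemma sum_fun_apply: "(\<Sum>i\<in>I. f i) x = (\<Sum>i\<in>I. f i x)"
  by (induction I rule: infinite_finite_induct) simp_all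

text \<open>The Schwarz lemma after rescaling the disc to radius 1 and moving the value at the
  centre to 0.\<close>

lemma schwarz_bound:
  assumes holo: "\<psi> holomorphic_on ball 0 R" and R: "R > 0"
    and M: "\<And>z. z \<in> ball 0 R \<Longrightarrow> cmod (\<psi> z) < M"
  shows "cmod (deriv \<psi> 0) \<le> 2 * M / R"
    and "\<And>z. z \<in> ball 0 R \<Longrightarrow> cmod (\<psi> z - \<psi> 0) \<le> 2 * M / R * cmod z"
proof -
  have M0: "M > 0" using M[of 0] R norm_ge_zero[of "\<psi> 0"] by (simp del: norm_ge_zero)
  \<comment> \<open>The difference of two values of \<psi> is smaller than 2 * M, so dividing by 2 *
    M makes g a self-map of the unit disc that fixes 0.\<close>
  define g where "g u = (\<psi> (of_real R * u) - \<psi> 0) / of_real (2 * M)" for u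
  have in_ball: "of_real R * u \<in> ball 0 R" if "u \<in> ball 0 1" for u :: complex
    using that R by (simp add: norm_mult)
  have "(\<lambda>u. \<psi> (of_real R * u)) holomorphic_on ball 0 1"
    using in_ball by (intro holomorphic_on_compose_gen[OF _ holo, unfolded o_def] holomorphic_intros) auto
  then have g: "g holomorphic_on ball 0 1"
    unfolding g_def using M0 by (intro holomorphic_intros) auto
  have g0: "g 0 = 0" by (simp add: g_def)
  have g1: "cmod (g u) < 1" if "cmod u < 1" for u
  proof -
    have "cmod (\<psi> (of_real R * u) - \<psi> 0) \<le> cmod (\<psi> (of_real R * u)) + cmod (\<psi> 0)"
      by (rule norm_triangle_ineq4)
    also have "\<dots> < 2 * M"
      using M[OF in_ball[of u]] M[of 0] that R by simp
    finally show ?thesis using M0 by (simp add: g_def norm_divide)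
  qed
  have "(\<psi> has_field_derivative deriv \<psi> 0) (at (of_real R * 0))"
    using holomorphic_derivI[OF holo, of 0] R by simp
  then have "(g has_field_derivative (of_real R * deriv \<psi> 0) / of_real (2 * M)) (at 0)"
    unfolding g_def using M0
    by (auto intro!: derivative_eq_intros DERIV_chain2[where f = \<psi>])
  then have "deriv g 0 = of_real R * deriv \<psi> 0 / of_real (2 * M)"
    by (rule DERIV_imp_deriv)
  with Schwarz_Lemma(2)[OF g g0 g1, of 0] have "R * cmod (deriv \<psi> 0) / (2 * M) \<le> 1"
    using R M0 by (simp add: norm_divide norm_mult)
  then show "cmod (deriv \<psi> 0) \<le> 2 * M / R"
    using R M0 by (simp add: field_simps)
  fix z :: complex assume z: "z \<in> ball 0 R"
  then have "cmod (z / of_real R) < 1" using R by (simp add: norm_divide)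
  from Schwarz_Lemma(1)[OF g g0 g1 this] have "cmod (g (z / of_real R)) \<le> cmod z / R"
    using R by (simp add: norm_divide)
  moreover have "cmod (g (z / of_real R)) = cmod (\<psi> z - \<psi> 0) / (2 * M)"
    using R M0 by (simp add: g_def norm_divide)
  ultimately show "cmod (\<psi> z - \<psi> 0) \<le> 2 * M / R * cmod z"
    using R M0 by (simp add: field_simps)
qed

text \<open>Such functionals turn a W-valued map restricted to a complex line into an ordinary
  holomorphic function. They are constrained on \<open>vectors W\<close> only, as the ambient type
  may be larger than the space.\<close>

definition contractive_functional :: "('w::ab_group_add, 'z) matrix_normed_scheme \<Rightarrow> ('w \<Rightarrow> complex) \<Rightarrow> bool" where
  "contractive_functional W \<phi> \<longleftrightarrow>
    (\<forall>x\<in>vectors W. \<forall>y\<in>vectors W. \<phi> (x + y) = \<phi> x + \<phi> y) \<and>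
    (\<forall>c. \<forall>x\<in>vectors W. \<phi> (cscale W c x) = c * \<phi> x) \<and>
    (\<forall>x\<in>vectors W. cmod (\<phi> x) \<le> vnorm W x)"

lemma has_frechet_derivativeD:
  assumes "has_frechet_derivative V W f D x"
  shows "\<And>h. h \<in> vectors V \<Longrightarrow> D h \<in> vectors W"
    and "\<And>h k. h \<in> vectors V \<Longrightarrow> k \<in> vectors V \<Longrightarrow> D (h + k) = D h + D k"
    and "\<And>c h. h \<in> vectors V \<Longrightarrow> D (cscale V c h) = cscale W c (D h)"
    and "\<And>e. e > 0 \<Longrightarrow> \<exists>d>0. \<forall>h\<in>vectors V. vnorm V h < d \<longrightarrow>
      vnorm W (f (x + h) - f x - D h) \<le> e * vnorm V h"
  using assms by (auto simp: has_frechet_derivative_def bounded_clinear_map_def)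

lemma bounded_clinear_mapI:
  assumes "\<And>h. h \<in> vectors V \<Longrightarrow> D h \<in> vectors W"
    and "\<And>h k. h \<in> vectors V \<Longrightarrow> k \<in> vectors V \<Longrightarrow> D (h + k) = D h + D k"
    and "\<And>c h. h \<in> vectors V \<Longrightarrow> D (cscale V c h) = cscale W c (D h)"
    and "\<And>h. h \<in> vectors V \<Longrightarrow> vnorm W (D h) \<le> K * vnorm V h"
  shows "bounded_clinear_map V W D"
  using assms unfolding bounded_clinear_map_def by blast

locale operator_space_pair = dom: operator_space V + cod: operator_space W
  for V :: "('v::ab_group_add, 'y) matrix_normed_scheme"
    and W :: "('w::ab_group_add, 'z) matrix_normed_scheme"
begin

lemma frechet_bounded:
  assumes "has_frechet_derivative V W f D x"
  obtains K where "K \<ge> 0" "\<And>h. h \<in> vectors V \<Longrightarrow> vnorm W (D h) \<le> K * vnorm V h"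
proof -
  obtain K where K: "\<And>h. h \<in> vectors V \<Longrightarrow> vnorm W (D h) \<le> K * vnorm V h"
    using assms unfolding has_frechet_derivative_def bounded_clinear_map_def by blast
  \<comment> \<open>The constant in \<open>bounded_clinear_map\<close> may be negative when V is the
    zero space; later estimates multiply by it and want a nonnegative one.\<close>
  have "vnorm W (D h) \<le> max K 0 * vnorm V h" if h: "h \<in> vectors V" for h
    using K[OF h] mult_right_mono[of K "max K 0" "vnorm V h"] dom.vnorm_nonneg[OF h] by linarith
  then show thesis using that[of "max K 0"] by simp
qed

lemma frechet_zero: "has_frechet_derivative V W (\<lambda>_. 0) (\<lambda>_. 0) x"
  unfolding has_frechet_derivative_def bounded_clinear_map_def
  by (auto intro!: exI[of _ 0] exI[of _ 1])

text \<open>Values are required to lie in W at every point. Maps extended by zero satisfy this, so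
  increments x + h that leave the ball call for no further restriction on h.\<close>

lemma frechet_add:
  assumes f: "has_frechet_derivative V W f D x" and g: "has_frechet_derivative V W g E x"
    and W: "\<And>y. f y \<in> vectors W" "\<And>y. g y \<in> vectors W"
  shows "has_frechet_derivative V W (\<lambda>y. f y + g y) (\<lambda>h. D h + E h) x"
proof -
  note D = has_frechet_derivativeD[OF f] and E = has_frechet_derivativeD[OF g]
  obtain K where K: "\<And>h. h \<in> vectors V \<Longrightarrow> vnorm W (D h) \<le> K * vnorm V h"
    using frechet_bounded[OF f] by blast
  obtain L where L: "\<And>h. h \<in> vectors V \<Longrightarrow> vnorm W (E h) \<le> L * vnorm V h"
    using frechet_bounded[OF g] by blast
  have "vnorm W (D h + E h) \<le> (K + L) * vnorm V h" if h: "h \<in> vectors V" for h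
    using cod.vnorm_triangle[OF D(1)[OF h] E(1)[OF h]] K[OF h] L[OF h] by (simp add: distrib_right)
  then have lin: "bounded_clinear_map V W (\<lambda>h. D h + E h)"
    using D(1-3) E(1-3)
    by (intro bounded_clinear_mapI[where K = "K + L"]) (auto simp: cod.cscale_algebra algebra_simps)
  have "\<exists>d>0. \<forall>h\<in>vectors V. vnorm V h < d \<longrightarrow>
      vnorm W (f (x + h) + g (x + h) - (f x + g x) - (D h + E h)) \<le> e * vnorm V h"
    if e: "e > 0" for e
  proof -
    obtain d1 where d1: "d1 > 0" "\<And>h. h \<in> vectors V \<Longrightarrow> vnorm V h < d1 \<Longrightarrow>
        vnorm W (f (x + h) - f x - D h) \<le> e / 2 * vnorm V h"
      using D(4)[of "e / 2"] e by (auto)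
    obtain d2 where d2: "d2 > 0" "\<And>h. h \<in> vectors V \<Longrightarrow> vnorm V h < d2 \<Longrightarrow>
        vnorm W (g (x + h) - g x - E h) \<le> e / 2 * vnorm V h"
      using E(4)[of "e / 2"] e by (auto)
    have "vnorm W (f (x + h) + g (x + h) - (f x + g x) - (D h + E h)) \<le> e * vnorm V h"
      if h: "h \<in> vectors V" "vnorm V h < min d1 d2" for h
    proof -
      have eq: "f (x + h) + g (x + h) - (f x + g x) - (D h + E h)
          = (f (x + h) - f x - D h) + (g (x + h) - g x - E h)"
        by (simp add: algebra_simps)
      have "vnorm W ((f (x + h) - f x - D h) + (g (x + h) - g x - E h))
          \<le> vnorm W (f (x + h) - f x - D h) + vnorm W (g (x + h) - g x - E h)"
        using h W D(1) E(1) by (intro cod.vnorm_triangle) auto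
      then show ?thesis unfolding eq using d1(2)[of h] d2(2)[of h] h by simp
    qed
    then show ?thesis using d1(1) d2(1) by (intro exI[of _ "min d1 d2"]) simp
  qed
  then show ?thesis using lin by (simp add: has_frechet_derivative_def)
qed

lemma frechet_cscale:
  assumes f: "has_frechet_derivative V W f D x" and W: "\<And>y. f y \<in> vectors W"
  shows "has_frechet_derivative V W (\<lambda>y. cscale W c (f y)) (\<lambda>h. cscale W c (D h)) x"
proof -
  note D = has_frechet_derivativeD[OF f]
  obtain K where K: "\<And>h. h \<in> vectors V \<Longrightarrow> vnorm W (D h) \<le> K * vnorm V h"
    using frechet_bounded[OF f] by blast
  have "vnorm W (cscale W c (D h)) \<le> (cmod c * K) * vnorm V h" if h: "h \<in> vectors V" for h
    using mult_left_mono[OF K[OF h], of "cmod c"] by (simp add: cod.vnorm_cscale D(1) h mult.assoc)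
  then have lin: "bounded_clinear_map V W (\<lambda>h. cscale W c (D h))"
    using D(1-3)
    by (intro bounded_clinear_mapI[where K = "cmod c * K"]) (auto simp: cod.cscale_algebra mult.commute)
  have "\<exists>d>0. \<forall>h\<in>vectors V. vnorm V h < d \<longrightarrow>
      vnorm W (cscale W c (f (x + h)) - cscale W c (f x) - cscale W c (D h)) \<le> e * vnorm V h"
    if e: "e > 0" for e
  proof -
    \<comment> \<open>Adding 1 keeps the divisor positive when c = 0.\<close>
    have c1: "cmod c + 1 > 0" by (simp add: add_nonneg_pos)
    obtain d where d: "d > 0" "\<And>h. h \<in> vectors V \<Longrightarrow> vnorm V h < d \<Longrightarrow>
        vnorm W (f (x + h) - f x - D h) \<le> e / (cmod c + 1) * vnorm V h"
      using D(4)[of "e / (cmod c + 1)"] e c1 by auto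
    have "vnorm W (cscale W c (f (x + h)) - cscale W c (f x) - cscale W c (D h)) \<le> e * vnorm V h"
      if h: "h \<in> vectors V" "vnorm V h < d" for h
    proof -
      have "vnorm W (cscale W c (f (x + h) - f x - D h)) = cmod c * vnorm W (f (x + h) - f x - D h)"
        using W D(1) h by (intro cod.vnorm_cscale) auto
      also have "\<dots> \<le> (cmod c + 1) * (e / (cmod c + 1) * vnorm V h)"
        using d(2)[OF h] W D(1) h c1 by (intro mult_mono) auto
      also have "\<dots> = e * vnorm V h" using c1 by simp
      finally show ?thesis by (simp add: cod.cscale_algebra)
    qed
    then show ?thesis using d(1) by blast
  qed
  then show ?thesis using lin by (simp add: has_frechet_derivative_def)
qed

lemma frechet_diff:
  assumes f: "has_frechet_derivative V W f D x" and g: "has_frechet_derivative V W g E x"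
    and W: "\<And>y. f y \<in> vectors W" "\<And>y. g y \<in> vectors W"
  shows "has_frechet_derivative V W (\<lambda>y. f y - g y) (\<lambda>h. D h - E h) x"
proof -
  have "has_frechet_derivative V W (\<lambda>y. f y + cscale W (- 1) (g y)) (\<lambda>h. D h + cscale W (- 1) (E h)) x"
    using W by (intro frechet_add frechet_cscale f g) auto
  then show ?thesis by (simp add: cod.cscale_algebra)
qed

text \<open>The chain rule for the line followed by f followed by \<phi>. D is the derivative at the
  point of the line with parameter z.\<close>

lemma frechet_deriv_on_line:
  assumes f: "has_frechet_derivative V W f D (x + cscale V z h)" and W: "\<And>y. f y \<in> vectors W"
    and \<phi>: "contractive_functional W \<phi>" and h: "h \<in> vectors V"
  shows "((\<lambda>z. \<phi> (f (x + cscale V z h))) has_field_derivative \<phi> (D h)) (at z)"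
proof -
  note D = has_frechet_derivativeD[OF f]
  have \<phi>_diff: "\<phi> (a - b) = \<phi> a - \<phi> b" if "a \<in> vectors W" "b \<in> vectors W" for a b
  proof -
    have "\<phi> (a + cscale W (- 1) b) = \<phi> a + (- 1) * \<phi> b"
      using \<phi> that by (simp only: contractive_functional_def cod.cscale_in_vectors)
    then show ?thesis by (simp add: cod.cscale_algebra)
  qed
  have "\<exists>d>0. \<forall>w. norm (w - z) < d \<longrightarrow> norm (\<phi> (f (x + cscale V w h)) - \<phi> (f (x + cscale V z h))
      - \<phi> (D h) * (w - z)) \<le> e * norm (w - z)" if e: "e > 0" for e
  proof -
    \<comment> \<open>The increment along the line is (w - z) h. Dividing d and e by
      \<open>vnorm V h + 1\<close> makes this increment smaller than d and the resulting error at
      most e * \<open>norm (w - z)\<close>, also for h = 0.\<close>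
    have n1: "vnorm V h + 1 > 0" using dom.vnorm_nonneg[OF h] by linarith
    obtain d where d: "d > 0" "\<And>k. k \<in> vectors V \<Longrightarrow> vnorm V k < d \<Longrightarrow>
        vnorm W (f (x + cscale V z h + k) - f (x + cscale V z h) - D k) \<le> e / (vnorm V h + 1) * vnorm V k"
      using D(4)[of "e / (vnorm V h + 1)"] e n1 by auto
    have "norm (\<phi> (f (x + cscale V w h)) - \<phi> (f (x + cscale V z h)) - \<phi> (D h) * (w - z)) \<le> e * norm (w - z)"
      if w: "norm (w - z) < d / (vnorm V h + 1)" for w
    proof -
      let ?k = "cscale V (w - z) h"
      have k: "?k \<in> vectors V" using h by simp
      have nk: "vnorm V ?k = norm (w - z) * vnorm V h" using h by (simp add: dom.vnorm_cscale)
      also have "\<dots> \<le> norm (w - z) * (vnorm V h + 1)" by (intro mult_left_mono) auto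
      also have "\<dots> < d" using w n1 by (simp add: field_simps)
      finally have kd: "vnorm V ?k < d" .
      have eq: "x + cscale V z h + ?k = x + cscale V w h"
        by (simp add: dom.cscale_algebra)
      have "\<phi> (f (x + cscale V w h) - f (x + cscale V z h) - D ?k)
          = \<phi> (f (x + cscale V w h)) - \<phi> (f (x + cscale V z h)) - \<phi> (D ?k)"
        using W D(1)[OF k] by (simp add: \<phi>_diff cod.diff_in_vectors)
      also have "\<phi> (D ?k) = \<phi> (D h) * (w - z)"
        using \<phi> D(1)[OF h] by (simp add: D(3)[OF h] contractive_functional_def mult.commute)
      finally have "norm (\<phi> (f (x + cscale V w h)) - \<phi> (f (x + cscale V z h)) - \<phi> (D h) * (w - z))
          = norm (\<phi> (f (x + cscale V w h) - f (x + cscale V z h) - D ?k))" by simp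
      also have "\<dots> \<le> vnorm W (f (x + cscale V w h) - f (x + cscale V z h) - D ?k)"
        using \<phi> W D(1)[OF k] by (simp add: contractive_functional_def cod.diff_in_vectors)
      also have "\<dots> \<le> e / (vnorm V h + 1) * vnorm V ?k"
        using d(2)[OF k kd] by (simp only: eq)
      also have "\<dots> = e * norm (w - z) * (vnorm V h / (vnorm V h + 1))"
        by (simp add: nk)
      also have "\<dots> \<le> e * norm (w - z) * 1"
        using e n1 h by (intro mult_left_mono) auto
      finally show ?thesis by simp
    qed
    then show ?thesis using d(1) n1 by (intro exI[of _ "d / (vnorm V h + 1)"]) auto
  qed
  then show ?thesis
    unfolding has_field_derivative_def has_derivative_at_alt by (simp add: bounded_linear_mult_right)
qed

end

text \<open>The norm is only approximated from below by functionals, not attained, because vector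
  functionals of an operator provide no more than that.\<close>

locale normed_pair = operator_space_pair V W
  for V :: "('v::ab_group_add, 'y) matrix_normed_scheme"
    and W :: "('w::ab_group_add, 'z) matrix_normed_scheme" +
  assumes norming: "\<And>w c. w \<in> vectors W \<Longrightarrow> c < vnorm W w \<Longrightarrow>
    \<exists>\<phi>. contractive_functional W \<phi> \<and> c < cmod (\<phi> w)"
begin

text \<open>For nonzero h, the points x + z h stay in the unit ball while \<open>cmod z\<close> is
  below (1 - \<open>vnorm V x\<close>) / \<open>vnorm V h\<close>. On this disc
  \<open>schwarz_bound\<close> applies to \<phi> composed with f: its derivative at 0 gives the
  first bound and its value at z = 1 the second. A norming family of \<phi> then recovers the norm
  in W.\<close>

lemma frechet_schwarz:
  assumes holo: "holomorphic_map V W f" and W: "\<And>y. f y \<in> vectors W"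
    and M: "\<And>y. y \<in> unit_ball V \<Longrightarrow> vnorm W (f y) < M"
    and x: "x \<in> unit_ball V" and D: "has_frechet_derivative V W f D x" and h: "h \<in> vectors V"
  shows "vnorm W (D h) \<le> 2 * M / (1 - vnorm V x) * vnorm V h"
    and "vnorm V h < 1 - vnorm V x \<Longrightarrow>
      vnorm W (f (x + h) - f x) \<le> 2 * M / (1 - vnorm V x) * vnorm V h"
proof -
  define r where "r = 1 - vnorm V x"
  have r: "r > 0" using x by (simp add: r_def unit_ball_def)
  have "vnorm W (D h) \<le> 2 * M / r * vnorm V h \<and>
    (vnorm V h < r \<longrightarrow> vnorm W (f (x + h) - f x) \<le> 2 * M / r * vnorm V h)"
  \<comment> \<open>For h = 0 the radius r / n below would be 0 by the convention for division, and
    the disc empty.\<close>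
  proof (cases "h = 0")
    case True
    have "D (0 + 0) = D 0 + D 0" by (rule has_frechet_derivativeD(2)[OF D]) simp_all
    then have "D 0 = 0" by simp
    then show ?thesis using True by simp
  next
    case False
    define n where "n = vnorm V h"
    have n: "n > 0" using False h dom.vnorm_nonneg[OF h] dom.vnorm_eq_0_iff[OF h] by (simp add: n_def less_le)
    have line: "x + cscale V z h \<in> unit_ball V" if z: "z \<in> ball 0 (r / n)" for z :: complex
    proof -
      have "vnorm V (x + cscale V z h) \<le> vnorm V x + cmod z * n"
        using dom.vnorm_triangle[of x "cscale V z h"] x h by (simp add: dom.vnorm_cscale n_def unit_ball_def)
      also have "\<dots> < 1" using z n by (simp add: field_simps r_def)
      finally show ?thesis using x h by (simp add: unit_ball_def)
    qed
    have R: "r / n > 0" using r n by simp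
    have D0: "has_frechet_derivative V W f D (x + cscale V 0 h)" using D by simp
    have main: "cmod (\<phi> (D h)) \<le> 2 * M / r * n" 
      "n < r \<Longrightarrow> cmod (\<phi> (f (x + h)) - \<phi> (f x)) \<le> 2 * M / r * n"
      if \<phi>: "contractive_functional W \<phi>" for \<phi>
    proof -
      let ?\<psi> = "\<lambda>z. \<phi> (f (x + cscale V z h))"
      have "?\<psi> holomorphic_on ball 0 (r / n)"
        unfolding holomorphic_on_open[OF open_ball]
      proof
        fix z :: complex assume "z \<in> ball 0 (r / n)"
        then obtain E where "has_frechet_derivative V W f E (x + cscale V z h)"
          using holo line by (auto simp: holomorphic_map_def)
        then show "\<exists>f'. (?\<psi> has_field_derivative f') (at z)"
          using frechet_deriv_on_line[where f = f, OF _ W \<phi> h] by blast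
      qed
      moreover have "cmod (?\<psi> z) < M" if "z \<in> ball 0 (r / n)" for z :: complex
      proof -
        have "cmod (?\<psi> z) \<le> vnorm W (f (x + cscale V z h))"
          using \<phi> W by (simp add: contractive_functional_def)
        also have "\<dots> < M" using M line that by blast
        finally show ?thesis .
      qed
      ultimately have S: "cmod (deriv ?\<psi> 0) \<le> 2 * M / (r / n)"
        "\<And>z. z \<in> ball 0 (r / n) \<Longrightarrow> cmod (?\<psi> z - ?\<psi> 0) \<le> 2 * M / (r / n) * cmod z"
        using schwarz_bound[OF _ R] by blast+
      have "deriv ?\<psi> 0 = \<phi> (D h)"
        using frechet_deriv_on_line[where f = f, OF D0 W \<phi> h] by (rule DERIV_imp_deriv)
      then show "cmod (\<phi> (D h)) \<le> 2 * M / r * n" using S(1) by simp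
      \<comment> \<open>The point z = 1 lies in the disc of radius r / n exactly when n < r.\<close>
      show "cmod (\<phi> (f (x + h)) - \<phi> (f x)) \<le> 2 * M / r * n" if "n < r"
        using S(2)[of 1] that n by simp
    qed
    have "vnorm W (D h) \<le> 2 * M / r * n"
    proof (rule ccontr)
      assume "\<not> ?thesis"
      then obtain \<phi> where "contractive_functional W \<phi>" "2 * M / r * n < cmod (\<phi> (D h))"
        using norming[OF has_frechet_derivativeD(1)[OF D h]] by (meson not_le)
      then show False using main(1) by fastforce
    qed
    moreover have "vnorm W (f (x + h) - f x) \<le> 2 * M / r * n" if "n < r"
    proof (rule ccontr)
      assume "\<not> ?thesis"
      then obtain \<phi> where \<phi>: "contractive_functional W \<phi>" "2 * M / r * n < cmod (\<phi> (f (x + h) - f x))"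
        using norming[of "f (x + h) - f x" "2 * M / r * n"] W by (auto simp: not_le)
      have "\<phi> (f x + (f (x + h) - f x)) = \<phi> (f x) + \<phi> (f (x + h) - f x)"
        using \<phi>(1) W by (simp only: contractive_functional_def cod.diff_in_vectors)
      then have "\<phi> (f (x + h) - f x) = \<phi> (f (x + h)) - \<phi> (f x)" by simp
      then show False using main(2)[OF \<phi>(1) that] \<phi>(2) by simp
    qed
    ultimately show ?thesis by (simp add: n_def)
  qed
  then show "vnorm W (D h) \<le> 2 * M / (1 - vnorm V x) * vnorm V h"
    and "vnorm V h < 1 - vnorm V x \<Longrightarrow>
      vnorm W (f (x + h) - f x) \<le> 2 * M / (1 - vnorm V x) * vnorm V h"
    by (simp_all add: r_def)
qed

end

section \<open>The operator space of completely bounded holomorphic maps\<close>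

lemma amplify_dims [simp]:
  "dim_row (amplify F X) = dim_row F * dim_row X" "dim_col (amplify F X) = dim_col F * dim_col X"
  by (simp_all add: amplify_def)

lemma amplify_index:
  assumes "F \<in> carrier_mat n n" "X \<in> carrier_mat m m" "i < n * m" "j < n * m"
  shows "amplify F X $$ (i, j) = (F $$ (i div m, j div m)) (X $$ (i mod m, j mod m))"
  using assms by (auto simp: amplify_def)

lemma amplify_singleton: "X \<in> carrier_mat m m \<Longrightarrow> amplify (Matrix.mat 1 1 (\<lambda>_. f)) X = map_mat f X"
  by (rule eq_matI) (auto simp: amplify_def)

lemma Hcb_simps:
  "vectors (Hcb V W) = {f. cb_holomorphic V W f \<and> (\<forall>x. x \<notin> unit_ball V \<longrightarrow> f x = 0)}"
  "cscale (Hcb V W) = (\<lambda>c f x. cscale W c (f x))"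
  by (simp_all add: Hcb_def)

lemma mnorm_Hcb:
  "mnorm (Hcb V W) F = Sup {mnorm W (amplify F X) | m X. m \<ge> 1 \<and> X \<in> mat_unit_ball V m}"
  by (simp add: Hcb_def)

lemma cb_holomorphicI:
  assumes "holomorphic_map V W f"
    and "\<And>m X. m \<ge> 1 \<Longrightarrow> X \<in> mat_unit_ball V m \<Longrightarrow> mnorm W (map_mat f X) \<le> K"
  shows "cb_holomorphic V W f"
  using assms unfolding cb_holomorphic_def by (auto intro!: bdd_aboveI[where M = K])

lemma cb_holomorphic_bounded:
  assumes "cb_holomorphic V W f"
  obtains K where "\<And>m X. m \<ge> 1 \<Longrightarrow> X \<in> mat_unit_ball V m \<Longrightarrow> mnorm W (map_mat f X) \<le> K"
proof -
  obtain K where "\<forall>y\<in>{mnorm W (map_mat f X) | m X. m \<ge> 1 \<and> X \<in> mat_unit_ball V m}. y \<le> K"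
    using assms unfolding cb_holomorphic_def bdd_above_def by blast
  then show thesis by (intro that[of K]) blast
qed

context operator_space_pair
begin

lemma Hcb_value:
  assumes "f \<in> vectors (Hcb V W)"
  shows "f x \<in> vectors W"
  using assms by (cases "x \<in> unit_ball V")
    (auto simp: Hcb_simps cb_holomorphic_def holomorphic_map_def)

lemma Hcb_outside: "f \<in> vectors (Hcb V W) \<Longrightarrow> x \<notin> unit_ball V \<Longrightarrow> f x = 0"
  by (simp add: Hcb_simps)

lemma Hcb_frechet:
  assumes "f \<in> vectors (Hcb V W)" "x \<in> unit_ball V"
  obtains D where "has_frechet_derivative V W f D x"
  using assms by (auto simp: Hcb_simps cb_holomorphic_def holomorphic_map_def)

lemma Hcb_bounded:
  assumes "f \<in> vectors (Hcb V W)"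
  obtains K where "\<And>m X. m \<ge> 1 \<Longrightarrow> X \<in> mat_unit_ball V m \<Longrightarrow> mnorm W (map_mat f X) \<le> K"
  using assms cb_holomorphic_bounded[of V W f] by (auto simp: Hcb_simps)

lemma HcbI:
  assumes W: "\<And>x. f x \<in> vectors W" and "\<And>x. x \<notin> unit_ball V \<Longrightarrow> f x = 0"
    and D: "\<And>x. x \<in> unit_ball V \<Longrightarrow> \<exists>D. has_frechet_derivative V W f D x"
    and K: "\<And>m X. m \<ge> 1 \<Longrightarrow> X \<in> mat_unit_ball V m \<Longrightarrow> mnorm W (map_mat f X) \<le> K"
  shows "f \<in> vectors (Hcb V W)"
proof -
  have "holomorphic_map V W f" using W D by (simp add: holomorphic_map_def)
  then show ?thesis using cb_holomorphicI[OF _ K] assms(2) by (simp add: Hcb_simps)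
qed

lemma map_mat_in_Mats:
  "(\<And>x. f x \<in> vectors W) \<Longrightarrow> X \<in> mat_unit_ball V m \<Longrightarrow> map_mat f X \<in> Mats W m"
  using dom.mat_unit_ballD(1)[of X m] by (auto simp: Mats_iff)

lemma amplify_in_Mats:
  assumes "F \<in> Mats (Hcb V W) n" "X \<in> mat_unit_ball V m"
  shows "amplify F X \<in> Mats W (n * m)"
proof -
  note c = Mats_carrier[OF assms(1)] dom.mat_unit_ballD(1)[OF assms(2)]
  show ?thesis
    unfolding Mats_iff
  proof (intro conjI allI impI)
    show "amplify F X \<in> carrier_mat (n * m) (n * m)"
      using c by (intro carrier_matI) auto
    fix i j assume ij: "i < n * m" "j < n * m"
    then have "F $$ (i div m, j div m) \<in> vectors (Hcb V W)"
      using assms(1) by (intro Mats_entry) (auto intro: div_less_of_less_mult)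
    then show "amplify F X $$ (i, j) \<in> vectors W"
      unfolding amplify_index[OF c ij] by (rule Hcb_value)
  qed
qed

text \<open>The blocks of \<open>amplify F X\<close> are the matrices of the single entries of F
  applied to X, and each is bounded uniformly in X by complete boundedness. Without this the
  supremum defining the norm could not be compared with its members.\<close>

lemma amplify_bdd:
  assumes n: "n \<ge> 1" and F: "F \<in> Mats (Hcb V W) n"
  shows "bdd_above {mnorm W (amplify F X) | m X. m \<ge> 1 \<and> X \<in> mat_unit_ball V m}"
proof -
  have "\<exists>K. \<forall>m X. m \<ge> 1 \<longrightarrow> X \<in> mat_unit_ball V m \<longrightarrow> mnorm W (map_mat (F $$ (k, l)) X) \<le> K"
    if "k < n" "l < n" for k l
    using Hcb_bounded[OF Mats_entry[OF F that]] by metis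
  then obtain K where K: "mnorm W (map_mat (F $$ (k, l)) X) \<le> K k l"
    if "k < n" "l < n" "m \<ge> 1" "X \<in> mat_unit_ball V m" for k l m X
    by metis
  have "mnorm W (amplify F X) \<le> (\<Sum>k<n. \<Sum>l<n. K k l)" if m: "m \<ge> 1" and X: "X \<in> mat_unit_ball V m" for m X
  proof -
    note c = Mats_carrier[OF F] dom.mat_unit_ballD(1)[OF X]
    have "mnorm W (amplify F X)
        \<le> (\<Sum>k<n. \<Sum>l<n. mnorm W (Matrix.mat m m (\<lambda>(i, j). amplify F X $$ (i + k * m, j + l * m))))"
      using n m amplify_in_Mats[OF F X] by (rule cod.mnorm_le_sum_blocks)
    also have "\<dots> = (\<Sum>k<n. \<Sum>l<n. mnorm W (map_mat (F $$ (k, l)) X))"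
    proof (intro sum.cong refl arg_cong[where f = "mnorm W"] eq_matI)
      fix k l i j
      assume "k \<in> {..<n}" "l \<in> {..<n}" "i < dim_row (map_mat (F $$ (k, l)) X)" "j < dim_col (map_mat (F $$ (k, l)) X)"
      then have lt: "k < n" "l < n" "i < m" "j < m" using c by auto
      then show "Matrix.mat m m (\<lambda>(i, j). amplify F X $$ (i + k * m, j + l * m)) $$ (i, j)
          = map_mat (F $$ (k, l)) X $$ (i, j)"
        using c by (simp add: amplify_index[OF c] block_index_less)
    qed (use c in auto)
    also have "\<dots> \<le> (\<Sum>k<n. \<Sum>l<n. K k l)"
      using K m X by (intro sum_mono) auto
    finally show ?thesis .
  qed
  then show ?thesis by (intro bdd_aboveI[where M = "\<Sum>k<n. \<Sum>l<n. K k l"]) blast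
qed

lemma amplify_le_mnorm:
  assumes "n \<ge> 1" "F \<in> Mats (Hcb V W) n" "m \<ge> 1" "X \<in> mat_unit_ball V m"
  shows "mnorm W (amplify F X) \<le> mnorm (Hcb V W) F"
  unfolding mnorm_Hcb using assms by (intro cSup_upper amplify_bdd) auto

lemma mnorm_Hcb_least:
  assumes "\<And>m X. m \<ge> 1 \<Longrightarrow> X \<in> mat_unit_ball V m \<Longrightarrow> mnorm W (amplify F X) \<le> C"
  shows "mnorm (Hcb V W) F \<le> C"
  unfolding mnorm_Hcb
proof (rule cSup_least)
  show "{mnorm W (amplify F X) | m X. m \<ge> 1 \<and> X \<in> mat_unit_ball V m} \<noteq> {}"
    using dom.singleton_in_mat_unit_ball[OF dom.zero_in_unit_ball] by auto
qed (use assms in auto)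

lemma mnorm_Hcb_nonneg:
  assumes "n \<ge> 1" "F \<in> Mats (Hcb V W) n"
  shows "mnorm (Hcb V W) F \<ge> 0"
proof -
  note X = dom.singleton_in_mat_unit_ball[OF dom.zero_in_unit_ball]
  have "0 \<le> mnorm W (amplify F (Matrix.mat 1 1 (\<lambda>_. 0)))"
    using assms amplify_in_Mats[OF assms(2) X] by (intro cod.mnorm_nonneg[of "n * 1"]) simp_all
  also have "\<dots> \<le> mnorm (Hcb V W) F"
    using assms X by (intro amplify_le_mnorm) auto
  finally show ?thesis .
qed

lemma map_mat_le_vnorm:
  assumes "f \<in> vectors (Hcb V W)" "m \<ge> 1" "X \<in> mat_unit_ball V m"
  shows "mnorm W (map_mat f X) \<le> vnorm (Hcb V W) f"
proof -
  have "mnorm W (amplify (Matrix.mat 1 1 (\<lambda>_. f)) X) \<le> vnorm (Hcb V W) f"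
    unfolding vnorm_def using assms by (intro amplify_le_mnorm[of 1]) auto
  then show ?thesis
    by (simp only: amplify_singleton[OF dom.mat_unit_ballD(1)[OF assms(3)]])
qed

lemma vnorm_Hcb_least:
  assumes "\<And>m X. m \<ge> 1 \<Longrightarrow> X \<in> mat_unit_ball V m \<Longrightarrow> mnorm W (map_mat f X) \<le> C"
  shows "vnorm (Hcb V W) f \<le> C"
  unfolding vnorm_def
  by (rule mnorm_Hcb_least) (simp only: amplify_singleton[OF dom.mat_unit_ballD(1)] assms)

lemma value_le_vnorm:
  assumes "f \<in> vectors (Hcb V W)" "x \<in> unit_ball V"
  shows "vnorm W (f x) \<le> vnorm (Hcb V W) f"
proof -
  have "mnorm W (map_mat f (Matrix.mat 1 1 (\<lambda>_. x))) \<le> vnorm (Hcb V W) f"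
    using assms by (intro map_mat_le_vnorm[of _ 1] dom.singleton_in_mat_unit_ball) auto
  moreover have "map_mat f (Matrix.mat 1 1 (\<lambda>_. x)) = Matrix.mat 1 1 (\<lambda>_. f x)"
    by (rule eq_matI) auto
  ultimately show ?thesis by (simp only: vnorm_def)
qed

lemma Hcb_zero: "0 \<in> vectors (Hcb V W)"
proof (rule HcbI)
  fix m X assume m: "m \<ge> (1 :: nat)" and X: "X \<in> mat_unit_ball V m"
  have "map_mat (0 :: 'v \<Rightarrow> 'w) X = 0\<^sub>m m m"
    using dom.mat_unit_ballD(1)[OF X] by (intro eq_matI) auto
  then show "mnorm W (map_mat (0 :: 'v \<Rightarrow> 'w) X) \<le> 0"
    using cod.mnorm_zero[OF m, of "0\<^sub>m m m"] by (simp add: Mats_iff)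
qed (use frechet_zero in \<open>auto simp: zero_fun_def\<close>)

lemma Hcb_add:
  assumes f: "f \<in> vectors (Hcb V W)" and g: "g \<in> vectors (Hcb V W)"
  shows "f + g \<in> vectors (Hcb V W)"
proof -
  note W = Hcb_value[OF f] Hcb_value[OF g]
  obtain K where K: "\<And>m X. m \<ge> 1 \<Longrightarrow> X \<in> mat_unit_ball V m \<Longrightarrow> mnorm W (map_mat f X) \<le> K"
    using Hcb_bounded[OF f] by blast
  obtain L where L: "\<And>m X. m \<ge> 1 \<Longrightarrow> X \<in> mat_unit_ball V m \<Longrightarrow> mnorm W (map_mat g X) \<le> L"
    using Hcb_bounded[OF g] by blast
  show ?thesis
  proof (rule HcbI)
    show "(f + g) x \<in> vectors W" for x using W by simp
    show "x \<notin> unit_ball V \<Longrightarrow> (f + g) x = 0" for x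
      using Hcb_outside[OF f] Hcb_outside[OF g] by simp
    show "\<exists>D. has_frechet_derivative V W (f + g) D x" if x: "x \<in> unit_ball V" for x
    proof -
      obtain D where D: "has_frechet_derivative V W f D x" using Hcb_frechet[OF f x] .
      obtain E where E: "has_frechet_derivative V W g E x" using Hcb_frechet[OF g x] .
      show ?thesis using frechet_add[OF D E W] unfolding plus_fun_def by blast
    qed
    fix m X assume m: "m \<ge> (1 :: nat)" and X: "X \<in> mat_unit_ball V m"
    have "map_mat (f + g) X = map_mat f X + map_mat g X" by (rule eq_matI) auto
    then show "mnorm W (map_mat (f + g) X) \<le> K + L"
      using cod.mnorm_triangle[OF m map_mat_in_Mats[where f = f, OF W(1) X] map_mat_in_Mats[where f = g, OF W(2) X]]
        K[OF m X] L[OF m X] by simp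
  qed
qed

lemma Hcb_cscale:
  assumes f: "f \<in> vectors (Hcb V W)"
  shows "cscale (Hcb V W) c f \<in> vectors (Hcb V W)"
proof -
  note W = Hcb_value[OF f]
  obtain K where K: "\<And>m X. m \<ge> 1 \<Longrightarrow> X \<in> mat_unit_ball V m \<Longrightarrow> mnorm W (map_mat f X) \<le> K"
    using Hcb_bounded[OF f] by blast
  have "(\<lambda>x. cscale W c (f x)) \<in> vectors (Hcb V W)"
  proof (rule HcbI)
    show "cscale W c (f x) \<in> vectors W" for x using W by simp
    show "x \<notin> unit_ball V \<Longrightarrow> cscale W c (f x) = 0" for x
      using Hcb_outside[OF f] by simp
    show "\<exists>D. has_frechet_derivative V W (\<lambda>x. cscale W c (f x)) D x" if x: "x \<in> unit_ball V" for x
    proof -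
      obtain D where D: "has_frechet_derivative V W f D x" using Hcb_frechet[OF f x] .
      show ?thesis using frechet_cscale[OF D W] by blast
    qed
    fix m X assume m: "m \<ge> (1 :: nat)" and X: "X \<in> mat_unit_ball V m"
    have "map_mat (\<lambda>x. cscale W c (f x)) X = map_mat (cscale W c) (map_mat f X)" by (rule eq_matI) auto
    then show "mnorm W (map_mat (\<lambda>x. cscale W c (f x)) X) \<le> cmod c * K"
      using cod.mnorm_scale[OF m map_mat_in_Mats[where f = f, OF W X], of c] K[OF m X] by (simp add: mult_left_mono)
  qed
  then show ?thesis by (simp add: Hcb_simps(2))
qed

lemma vector_space_Hcb: "vector_space (cscale (Hcb V W))"
  unfolding Hcb_simps(2)
  by unfold_locales (auto simp: cod.cscale_algebra)

lemma subspace_Hcb: "module.subspace (cscale (Hcb V W)) (vectors (Hcb V W))"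
proof -
  interpret H: vector_space "cscale (Hcb V W)" by (rule vector_space_Hcb)
  show ?thesis by (intro H.subspaceI Hcb_zero Hcb_add Hcb_cscale)
qed

lemma Hcb_diff:
  assumes "f \<in> vectors (Hcb V W)" "g \<in> vectors (Hcb V W)"
  shows "f - g \<in> vectors (Hcb V W)"
proof -
  interpret H: vector_space "cscale (Hcb V W)" by (rule vector_space_Hcb)
  show ?thesis using subspace_Hcb assms by (rule H.subspace_diff)
qed

text \<open>Matrices X of size 1 recover the values of all entries on the ball. Off the ball the
  convention of extension by zero decides; otherwise different total functions could have distance
  0.\<close>

lemma mnorm_Hcb_eq_0:
  assumes n: "n \<ge> 1" and F: "F \<in> Mats (Hcb V W) n"
  shows "mnorm (Hcb V W) F = 0 \<longleftrightarrow> F = 0\<^sub>m n n"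
proof
  assume eq0: "mnorm (Hcb V W) F = 0"
  show "F = 0\<^sub>m n n"
  proof (rule eq_matI)
    fix k l assume "k < dim_row (0\<^sub>m n n :: ('v \<Rightarrow> 'w) mat)" "l < dim_col (0\<^sub>m n n :: ('v \<Rightarrow> 'w) mat)"
    then have kl: "k < n" "l < n" by auto
    have "(F $$ (k, l)) x = 0" for x
    proof (cases "x \<in> unit_ball V")
      case True
      note X = dom.singleton_in_mat_unit_ball[OF True]
      have A: "amplify F (Matrix.mat 1 1 (\<lambda>_. x)) \<in> Mats W n"
        using amplify_in_Mats[OF F X] by simp
      have "mnorm W (amplify F (Matrix.mat 1 1 (\<lambda>_. x))) = 0"
        using amplify_le_mnorm[OF n F _ X] eq0 cod.mnorm_nonneg[OF n A] by simp
      then have "amplify F (Matrix.mat 1 1 (\<lambda>_. x)) $$ (k, l) = 0"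
        using cod.mnorm_zero[OF n A] kl by simp
      then show ?thesis
        using kl by (simp add: amplify_index[OF Mats_carrier[OF F], of _ 1])
    next
      case False
      then show ?thesis by (rule Hcb_outside[OF Mats_entry[OF F kl]])
    qed
    then show "F $$ (k, l) = 0\<^sub>m n n $$ (k, l)" using kl by (simp add: fun_eq_iff)
  qed (use Mats_dim[OF F] in auto)
next
  assume F0: "F = 0\<^sub>m n n"
  have "mnorm (Hcb V W) F \<le> 0"
  proof (rule mnorm_Hcb_least)
    fix m X assume m: "m \<ge> (1 :: nat)" and X: "X \<in> mat_unit_ball V m"
    note c = Mats_carrier[OF F] dom.mat_unit_ballD(1)[OF X]
    have nm: "n * m \<ge> 1" using n m by simp
    have "amplify F X = 0\<^sub>m (n * m) (n * m)"
    proof (rule eq_matI)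
      fix i j assume "i < dim_row (0\<^sub>m (n * m) (n * m) :: 'w mat)" "j < dim_col (0\<^sub>m (n * m) (n * m) :: 'w mat)"
      then have ij: "i < n * m" "j < n * m" by auto
      then show "amplify F X $$ (i, j) = 0\<^sub>m (n * m) (n * m) $$ (i, j)"
        unfolding amplify_index[OF c ij] unfolding F0 by (simp add: div_less_of_less_mult)
    qed (use c in auto)
    then show "mnorm W (amplify F X) \<le> 0"
      using cod.mnorm_zero[OF nm amplify_in_Mats[OF F X]] by simp
  qed
  then show "mnorm (Hcb V W) F = 0" using mnorm_Hcb_nonneg[OF n F] by simp
qed

lemma map_mat_cscale_in_Mats:
  assumes "F \<in> Mats (Hcb V W) n"
  shows "map_mat (cscale (Hcb V W) c) F \<in> Mats (Hcb V W) n"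
  using assms Mats_dim[OF assms] by (auto simp: Mats_iff Hcb_cscale)

lemma amplify_cscale:
  assumes "F \<in> Mats (Hcb V W) n" "X \<in> mat_unit_ball V m"
  shows "amplify (map_mat (cscale (Hcb V W) c) F) X = map_mat (cscale W c) (amplify F X)"
proof (rule eq_matI)
  note c = Mats_carrier[OF assms(1)] dom.mat_unit_ballD(1)[OF assms(2)]
  note c' = Mats_carrier[OF map_mat_cscale_in_Mats[OF assms(1)]] c(2)
  fix i j assume "i < dim_row (map_mat (cscale W c) (amplify F X))" "j < dim_col (map_mat (cscale W c) (amplify F X))"
  then have ij: "i < n * m" "j < n * m" using c by auto
  then show "amplify (map_mat (cscale (Hcb V W) c) F) X $$ (i, j) = map_mat (cscale W c) (amplify F X) $$ (i, j)"
    unfolding amplify_index[OF c' ij]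
    using c by (simp add: amplify_index[OF c ij] Hcb_simps(2) div_less_of_less_mult)
qed auto

lemma mnorm_Hcb_scale_le:
  assumes n: "n \<ge> 1" and F: "F \<in> Mats (Hcb V W) n"
  shows "mnorm (Hcb V W) (map_mat (cscale (Hcb V W) c) F) \<le> cmod c * mnorm (Hcb V W) F"
proof (rule mnorm_Hcb_least)
  fix m X assume m: "m \<ge> (1 :: nat)" and X: "X \<in> mat_unit_ball V m"
  have "mnorm W (amplify (map_mat (cscale (Hcb V W) c) F) X) = cmod c * mnorm W (amplify F X)"
    unfolding amplify_cscale[OF F X]
    using n m by (intro cod.mnorm_scale[OF _ amplify_in_Mats[OF F X]]) simp
  also have "\<dots> \<le> cmod c * mnorm (Hcb V W) F"
    using amplify_le_mnorm[OF n F m X] by (rule mult_left_mono) simp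
  finally show "mnorm W (amplify (map_mat (cscale (Hcb V W) c) F) X) \<le> cmod c * mnorm (Hcb V W) F" .
qed

text \<open>The reverse inequality is \<open>mnorm_Hcb_scale_le\<close> for the inverse of c,
  applied to the scaled matrix.\<close>

lemma mnorm_Hcb_scale:
  assumes n: "n \<ge> 1" and F: "F \<in> Mats (Hcb V W) n"
  shows "mnorm (Hcb V W) (map_mat (cscale (Hcb V W) c) F) = cmod c * mnorm (Hcb V W) F"
proof (cases "c = 0")
  case True
  then show ?thesis
    using mnorm_Hcb_scale_le[OF n F, of c] mnorm_Hcb_nonneg[OF n map_mat_cscale_in_Mats[OF F, of c]] by simp
next
  case False
  let ?G = "map_mat (cscale (Hcb V W) c) F"
  have "map_mat (cscale (Hcb V W) (inverse c)) ?G = F"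
    using False by (intro eq_matI) (auto simp: Hcb_simps(2) cod.cscale_algebra)
  then have "mnorm (Hcb V W) F \<le> cmod (inverse c) * mnorm (Hcb V W) ?G"
    using mnorm_Hcb_scale_le[OF n map_mat_cscale_in_Mats[OF F], of "inverse c" c] by simp
  then have "cmod c * mnorm (Hcb V W) F \<le> mnorm (Hcb V W) ?G"
    using False by (simp add: norm_divide field_simps)
  then show ?thesis using mnorm_Hcb_scale_le[OF n F, of c] by simp
qed

lemma mnorm_Hcb_triangle:
  assumes n: "n \<ge> 1" and F: "F \<in> Mats (Hcb V W) n" and G: "G \<in> Mats (Hcb V W) n"
  shows "mnorm (Hcb V W) (F + G) \<le> mnorm (Hcb V W) F + mnorm (Hcb V W) G"
proof (rule mnorm_Hcb_least)
  fix m X assume m: "m \<ge> (1 :: nat)" and X: "X \<in> mat_unit_ball V m"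
  note X' = dom.mat_unit_ballD(1)[OF X]
  note F' = Mats_carrier[OF F] and G' = Mats_carrier[OF G]
  have FG: "F + G \<in> carrier_mat n n" using F' G' by simp
  have "amplify (F + G) X = amplify F X + amplify G X"
  proof (rule eq_matI)
    fix i j assume "i < dim_row (amplify F X + amplify G X)" "j < dim_col (amplify F X + amplify G X)"
    then have ij: "i < n * m" "j < n * m" using G' X' by auto
    then show "amplify (F + G) X $$ (i, j) = (amplify F X + amplify G X) $$ (i, j)"
      using G' X' by (simp add: amplify_index[OF FG X' ij] amplify_index[OF F' X' ij]
        amplify_index[OF G' X' ij] div_less_of_less_mult)
  qed auto
  then have "mnorm W (amplify (F + G) X) \<le> mnorm W (amplify F X) + mnorm W (amplify G X)"
    using n m cod.mnorm_triangle[OF _ amplify_in_Mats[OF F X] amplify_in_Mats[OF G X]] by simp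
  also have "\<dots> \<le> mnorm (Hcb V W) F + mnorm (Hcb V W) G"
    by (rule add_mono[OF amplify_le_mnorm[OF n F m X] amplify_le_mnorm[OF n G m X]])
  finally show "mnorm W (amplify (F + G) X) \<le> mnorm (Hcb V W) F + mnorm (Hcb V W) G" .
qed

text \<open>Since the index of the function matrix is the outer one, the first n * m positions
  belong to F and the others to G. Amplification therefore respects direct sums without any
  permutation of indices.\<close>

lemma amplify_direct_sum:
  assumes F: "F \<in> carrier_mat n n" and G: "G \<in> carrier_mat p p" and X: "X \<in> carrier_mat m m"
  shows "amplify (direct_sum F G) X = direct_sum (amplify F X) (amplify G X)"
proof (rule eq_matI)
  fix i j
  assume "i < dim_row (direct_sum (amplify F X) (amplify G X))" "j < dim_col (direct_sum (amplify F X) (amplify G X))"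
  then have ij: "i < (n + p) * m" "j < (n + p) * m"
    using F G X by (auto simp: direct_sum_def add_mult_distrib)
  have FG: "direct_sum F G \<in> carrier_mat (n + p) (n + p)"
    using F G by (simp add: direct_sum_def)
  have m: "m > 0" using ij by (cases m) auto
  have div: "a div m < n \<longleftrightarrow> a < n * m" for a
    using m by (simp add: div_less_iff_less_mult)
  have shift: "(a - n * m) div m = a div m - n" "(a - n * m) mod m = a mod m" if "\<not> a < n * m" for a
  proof -
    have "a = n * m + (a - n * m)" using that by simp
    then obtain b where "a = n * m + b" by blast
    then show "(a - n * m) div m = a div m - n" "(a - n * m) mod m = a mod m" using m by auto
  qed
  have lt: "a - n * m < p * m" if "a < (n + p) * m" "\<not> a < n * m" for a
    using that by (simp add: add_mult_distrib)
  have sub: "a div m - n < p" if "a < n * m + p * m" "\<not> a < n * m" for a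
    using div_less_of_less_mult[OF lt, of a] shift that by (simp add: add_mult_distrib)
  have dlt: "a div m < n + p" if "a < (n + p) * m" for a
    using that by (rule div_less_of_less_mult)
  show "amplify (direct_sum F G) X $$ (i, j) = direct_sum (amplify F X) (amplify G X) $$ (i, j)"
    unfolding amplify_index[OF FG X ij]
    using F G X ij dlt[OF ij(1)] dlt[OF ij(2)] m
    by (auto simp: direct_sum_def add_mult_distrib div shift amplify_index[OF F X] amplify_index[OF G X] lt sub
        div_less_of_less_mult)
qed (use F G X in \<open>auto simp: direct_sum_def add_mult_distrib\<close>)

text \<open>At each X the axiom in W gives a maximum of two numbers, and the supremum of a maximum
  is the maximum of the suprema.\<close>

lemma mnorm_Hcb_direct_sum:
  assumes n: "n \<ge> 1" and p: "p \<ge> 1" and F: "F \<in> Mats (Hcb V W) n" and G: "G \<in> Mats (Hcb V W) p"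
  shows "mnorm (Hcb V W) (direct_sum F G) = max (mnorm (Hcb V W) F) (mnorm (Hcb V W) G)"
proof -
  have amp: "mnorm W (amplify (direct_sum F G) X) = max (mnorm W (amplify F X)) (mnorm W (amplify G X))"
    if "m \<ge> 1" "X \<in> mat_unit_ball V m" for m X
    using that n p
    by (simp add: amplify_direct_sum[OF Mats_carrier[OF F] Mats_carrier[OF G] dom.mat_unit_ballD(1)]
        cod.mnorm_direct_sum[OF _ _ amplify_in_Mats[OF F] amplify_in_Mats[OF G]])
  have FG: "direct_sum F G \<in> Mats (Hcb V W) (n + p)"
    using F G Hcb_zero by (auto simp: Mats_iff direct_sum_def)
  have np: "n + p \<ge> 1" using n by simp
  show ?thesis
  proof (rule antisym)
    show "mnorm (Hcb V W) (direct_sum F G) \<le> max (mnorm (Hcb V W) F) (mnorm (Hcb V W) G)"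
    proof (rule mnorm_Hcb_least)
      fix m X assume m: "m \<ge> (1 :: nat)" and X: "X \<in> mat_unit_ball V m"
      show "mnorm W (amplify (direct_sum F G) X) \<le> max (mnorm (Hcb V W) F) (mnorm (Hcb V W) G)"
        unfolding amp[OF m X] by (rule max.mono[OF amplify_le_mnorm[OF n F m X] amplify_le_mnorm[OF p G m X]])
    qed
    have "mnorm (Hcb V W) F \<le> mnorm (Hcb V W) (direct_sum F G)"
      by (rule mnorm_Hcb_least) (use amplify_le_mnorm[OF np FG] amp in force)
    moreover have "mnorm (Hcb V W) G \<le> mnorm (Hcb V W) (direct_sum F G)"
      by (rule mnorm_Hcb_least) (use amplify_le_mnorm[OF np FG] amp in force)
    ultimately show "max (mnorm (Hcb V W) F) (mnorm (Hcb V W) G) \<le> mnorm (Hcb V W) (direct_sum F G)"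
      by simp
  qed
qed

text \<open>Scalar matrices act on the outer index alone: conjugating F by \<alpha> and \<beta>
  conjugates F(X) by their tensor products with the m x m identity, whose norms
  \<open>cmat_norm_amplification\<close> bounds.\<close>

lemma amplify_scalar_conj:
  assumes F: "F \<in> carrier_mat n n" and X: "X \<in> carrier_mat m m"
    and \<alpha>: "\<alpha> \<in> carrier_mat r n" and \<beta>: "\<beta> \<in> carrier_mat n r"
  shows "amplify (scalar_conj (Hcb V W) \<alpha> F \<beta>) X = scalar_conj W
    (Matrix.mat (dim_row \<alpha> * m) (dim_col \<alpha> * m) (\<lambda>(i, j). if i mod m = j mod m then \<alpha> $$ (i div m, j div m) else 0))
    (amplify F X)
    (Matrix.mat (dim_row \<beta> * m) (dim_col \<beta> * m) (\<lambda>(i, j). if i mod m = j mod m then \<beta> $$ (i div m, j div m) else 0))"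
    (is "_ = scalar_conj W ?A _ ?B")
proof (rule eq_matI)
  fix i j assume "i < dim_row (scalar_conj W ?A (amplify F X) ?B)" "j < dim_col (scalar_conj W ?A (amplify F X) ?B)"
  then have ij: "i < r * m" "j < r * m" using \<alpha> \<beta> by (auto simp: scalar_conj_def)
  then have ijd: "i div m < r" "j div m < r" "i mod m < m" "j mod m < m"
    by (auto intro: div_less_of_less_mult mod_less_of_less_mult)
  have S: "scalar_conj (Hcb V W) \<alpha> F \<beta> \<in> carrier_mat r r"
    using \<alpha> \<beta> by (simp add: scalar_conj_def)
  have "amplify (scalar_conj (Hcb V W) \<alpha> F \<beta>) X $$ (i, j)
      = (\<Sum>k<n. \<Sum>l<n. cscale W (\<alpha> $$ (i div m, k) * \<beta> $$ (l, j div m)) ((F $$ (k, l)) (X $$ (i mod m, j mod m))))"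
    unfolding amplify_index[OF S X ij]
    using \<alpha> \<beta> F ijd by (simp add: scalar_conj_def sum_fun_apply Hcb_simps(2))
  moreover have "scalar_conj W ?A (amplify F X) ?B $$ (i, j)
      = (\<Sum>k<n * m. \<Sum>l<n * m. cscale W (?A $$ (i, k) * ?B $$ (l, j)) (amplify F X $$ (k, l)))"
    using \<alpha> \<beta> F X ij by (simp add: scalar_conj_def)
  \<comment> \<open>The identity factors force the inner indices u and v to equal those of the entry
    in question, so only the sums over the outer indices survive.\<close>
  moreover have "\<dots> = (\<Sum>k<n. \<Sum>u<m. \<Sum>l<n. \<Sum>v<m. if v = j mod m then
      (if u = i mod m then cscale W (\<alpha> $$ (i div m, k) * \<beta> $$ (l, j div m)) ((F $$ (k, l)) (X $$ (u, v))) else 0) else 0)"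
    unfolding sum_mult_product
    using \<alpha> \<beta> ij by (intro sum.cong refl) (auto simp: block_index_less amplify_index[OF F X])
  moreover have "\<dots> = (\<Sum>k<n. \<Sum>u<m. if u = i mod m then
      (\<Sum>l<n. cscale W (\<alpha> $$ (i div m, k) * \<beta> $$ (l, j div m)) ((F $$ (k, l)) (X $$ (u, j mod m)))) else 0)"
    using ijd by (intro sum.cong refl) auto
  moreover have "\<dots> = (\<Sum>k<n. \<Sum>l<n. cscale W (\<alpha> $$ (i div m, k) * \<beta> $$ (l, j div m)) ((F $$ (k, l)) (X $$ (i mod m, j mod m))))"
    by (rule sum.cong[OF refl]) (use ijd in simp)
  ultimately show "amplify (scalar_conj (Hcb V W) \<alpha> F \<beta>) X $$ (i, j) = scalar_conj W ?A (amplify F X) ?B $$ (i, j)"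
    by (simp only:)
qed (use \<alpha> \<beta> X in \<open>auto simp: scalar_conj_def\<close>)

lemma mnorm_Hcb_conj:
  assumes n: "n \<ge> 1" and r: "r \<ge> 1" and F: "F \<in> Mats (Hcb V W) n"
    and \<alpha>: "\<alpha> \<in> carrier_mat r n" and \<beta>: "\<beta> \<in> carrier_mat n r"
  shows "mnorm (Hcb V W) (scalar_conj (Hcb V W) \<alpha> F \<beta>) \<le> cmat_norm \<alpha> * mnorm (Hcb V W) F * cmat_norm \<beta>"
proof (rule mnorm_Hcb_least)
  fix m X assume m: "m \<ge> (1 :: nat)" and X: "X \<in> mat_unit_ball V m"
  define A where "A = Matrix.mat (dim_row \<alpha> * m) (dim_col \<alpha> * m)
    (\<lambda>(i, j). if i mod m = j mod m then \<alpha> $$ (i div m, j div m) else 0)"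
  define B where "B = Matrix.mat (dim_row \<beta> * m) (dim_col \<beta> * m)
    (\<lambda>(i, j). if i mod m = j mod m then \<beta> $$ (i div m, j div m) else 0)"
  have AB: "A \<in> carrier_mat (r * m) (n * m)" "B \<in> carrier_mat (n * m) (r * m)"
    using \<alpha> \<beta> by (simp_all add: A_def B_def)
  have nm: "n * m \<ge> 1" "r * m \<ge> 1" using n r m by simp_all
  have "mnorm W (amplify (scalar_conj (Hcb V W) \<alpha> F \<beta>) X) = mnorm W (scalar_conj W A (amplify F X) B)"
    unfolding A_def B_def using Mats_carrier[OF F] dom.mat_unit_ballD(1)[OF X] \<alpha> \<beta> by (subst amplify_scalar_conj) auto
  also have "\<dots> \<le> cmat_norm A * mnorm W (amplify F X) * cmat_norm B"
    using nm amplify_in_Mats[OF F X] AB by (rule cod.mnorm_conj)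
  also have "\<dots> \<le> cmat_norm \<alpha> * mnorm (Hcb V W) F * cmat_norm \<beta>"
    unfolding A_def B_def
    by (intro mult_mono cmat_norm_amplification amplify_le_mnorm[OF n F m X] mult_nonneg_nonneg
        cmat_norm_nonneg mnorm_Hcb_nonneg[OF n F] cod.mnorm_nonneg[OF nm(1) amplify_in_Mats[OF F X]])
  finally show "mnorm W (amplify (scalar_conj (Hcb V W) \<alpha> F \<beta>) X) \<le> cmat_norm \<alpha> * mnorm (Hcb V W) F * cmat_norm \<beta>" .
qed

end

section \<open>Limits of sequences with respect to the first matrix norm\<close>

context operator_space
begin

lemma vlim_add:
  assumes "\<And>i. a i \<in> vectors V" "\<And>i. b i \<in> vectors V" "x \<in> vectors V" "y \<in> vectors V"
    and a: "(\<lambda>i :: nat. vnorm V (a i - x)) \<longlonglongrightarrow> 0" and b: "(\<lambda>i. vnorm V (b i - y)) \<longlonglongrightarrow> 0"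
  shows "(\<lambda>i. vnorm V (a i + b i - (x + y))) \<longlonglongrightarrow> 0"
proof (rule Lim_null_comparison[OF always_eventually])
  show "\<forall>i. norm (vnorm V (a i + b i - (x + y))) \<le> vnorm V (a i - x) + vnorm V (b i - y)"
  proof
    fix i
    have "vnorm V ((a i - x) + (b i - y)) \<le> vnorm V (a i - x) + vnorm V (b i - y)"
      using assms(1-4) by (intro vnorm_triangle) auto
    then show "norm (vnorm V (a i + b i - (x + y))) \<le> vnorm V (a i - x) + vnorm V (b i - y)"
      using assms(1-4) by (simp add: algebra_simps)
  qed
  show "(\<lambda>i. vnorm V (a i - x) + vnorm V (b i - y)) \<longlonglongrightarrow> 0"
    using tendsto_add[OF a b] by simp
qed

lemma vlim_cscale:
  assumes "\<And>i. a i \<in> vectors V" "x \<in> vectors V"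
    and a: "(\<lambda>i :: nat. vnorm V (a i - x)) \<longlonglongrightarrow> 0"
  shows "(\<lambda>i. vnorm V (cscale V c (a i) - cscale V c x)) \<longlonglongrightarrow> 0"
proof -
  have "vnorm V (cscale V c (a i) - cscale V c x) = cmod c * vnorm V (a i - x)" for i
    using vnorm_cscale[of "a i - x" c] assms(1,2) by (simp add: cscale_algebra)
  then show ?thesis using tendsto_mult_right_zero[OF a] by simp
qed

lemma vlim_uminus:
  assumes "\<And>i. a i \<in> vectors V" "x \<in> vectors V" "(\<lambda>i :: nat. vnorm V (a i - x)) \<longlonglongrightarrow> 0"
  shows "(\<lambda>i. vnorm V (- a i - (- x))) \<longlonglongrightarrow> 0"
  using vlim_cscale[of a x "- 1"] assms by (simp add: cscale_algebra)

lemma vlim_diff: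
  assumes "\<And>i. a i \<in> vectors V" "\<And>i. b i \<in> vectors V" "x \<in> vectors V" "y \<in> vectors V"
    and a: "(\<lambda>i :: nat. vnorm V (a i - x)) \<longlonglongrightarrow> 0" and b: "(\<lambda>i. vnorm V (b i - y)) \<longlonglongrightarrow> 0"
  shows "(\<lambda>i. vnorm V (a i - b i - (x - y))) \<longlonglongrightarrow> 0"
  using vlim_add[of a "\<lambda>i. - b i" x "- y"] vlim_uminus[of b y] assms by simp

lemma vlim_const: "(\<lambda>i :: nat. vnorm V (x - x)) \<longlonglongrightarrow> 0"
  by simp

lemma vlim_unique:
  assumes a: "\<And>i. a i \<in> vectors V" and x: "x \<in> vectors V" "y \<in> vectors V"
    and "(\<lambda>i :: nat. vnorm V (a i - x)) \<longlonglongrightarrow> 0" "(\<lambda>i. vnorm V (a i - y)) \<longlonglongrightarrow> 0"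
  shows "x = y"
proof -
  have "(\<lambda>i. vnorm V (a i - a i - (x - y))) \<longlonglongrightarrow> 0"
    using assms by (intro vlim_diff) auto
  then have "(\<lambda>i. vnorm V (x - y)) \<longlonglongrightarrow> 0"
    using x by (simp add: vnorm_minus_commute)
  then have "vnorm V (x - y) = 0" by (simp add: LIMSEQ_const_iff)
  then show ?thesis using x by simp
qed

end

text \<open>At a fixed x the Schwarz estimate for s j - s i is linear in the norm of h, with a
  constant that is small uniformly in j. Letting j tend to infinity carries it over to f - s N, so f
  inherits differentiability from a single s N.\<close>

lemma (in normed_pair) frechet_limit:
  fixes s :: "nat \<Rightarrow> 'v \<Rightarrow> 'w"
  assumes s: "\<And>i. s i \<in> vectors (Hcb V W)"
    and cauchy: "\<And>e. e > 0 \<Longrightarrow> \<exists>N. \<forall>i\<ge>N. \<forall>j\<ge>N. vnorm (Hcb V W) (s i - s j) < e"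
    and f: "\<And>x. f x \<in> vectors W" and lim: "\<And>x. (\<lambda>i. vnorm W (s i x - f x)) \<longlonglongrightarrow> 0"
    and x: "x \<in> unit_ball V"
  shows "\<exists>D. has_frechet_derivative V W f D x"
proof -
  note sW = Hcb_value[OF s]
  define r where "r = 1 - vnorm V x"
  have r: "r > 0" using x by (simp add: r_def unit_ball_def)
  have "\<forall>i. \<exists>D. has_frechet_derivative V W (s i) D x"
    using Hcb_frechet[OF s x] by metis
  then obtain Ds where Ds: "\<And>i. has_frechet_derivative V W (s i) (Ds i) x" by metis
  note DsW = has_frechet_derivativeD(1)[OF Ds]
  have holo_diff: "s j - s i \<in> vectors (Hcb V W)" for i j by (intro Hcb_diff s)
  have est: "vnorm W (Ds j h - Ds i h) \<le> 2 * e / r * vnorm V h"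
    "vnorm V h < r \<Longrightarrow> vnorm W ((s j (x + h) - s i (x + h)) - (s j x - s i x)) \<le> 2 * e / r * vnorm V h"
    if e: "vnorm (Hcb V W) (s j - s i) < e" and h: "h \<in> vectors V" for i j e h
  proof -
    have holo: "holomorphic_map V W (s j - s i)"
      using holo_diff by (simp add: Hcb_simps cb_holomorphic_def)
    have M: "vnorm W ((s j - s i) y) < e" if "y \<in> unit_ball V" for y
      using value_le_vnorm[OF holo_diff that] e by (rule le_less_trans)
    have D: "has_frechet_derivative V W (s j - s i) (\<lambda>h. Ds j h - Ds i h) x"
      using frechet_diff[OF Ds Ds sW sW] by (simp add: fun_diff_def)
    note S = frechet_schwarz[OF holo Hcb_value[OF holo_diff] M x D h, folded r_def]
    show "vnorm W (Ds j h - Ds i h) \<le> 2 * e / r * vnorm V h" using S(1) by simp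
    show "vnorm V h < r \<Longrightarrow> vnorm W ((s j (x + h) - s i (x + h)) - (s j x - s i x)) \<le> 2 * e / r * vnorm V h"
      using S(2) by simp
  qed
  have "\<exists>d\<in>vectors W. (\<lambda>i. vnorm W (Ds i h - d)) \<longlonglongrightarrow> 0" if h: "h \<in> vectors V" for h
  proof (rule cod.complete)
    show "Ds i h \<in> vectors W" for i by (rule DsW[OF h])
    fix e :: real assume e: "e > 0"
    define k where "k = vnorm V h + 1"
    \<comment> \<open>Chosen so that 2 * e1 / r times the norm of h equals e times
      \<open>vnorm V h / k\<close>, which is below e.\<close>
    define e1 where "e1 = e * r / (2 * k)"
    have k: "k > 0" "vnorm V h < k" using dom.vnorm_nonneg[OF h] by (simp_all add: k_def add_nonneg_pos)
    then have "e1 > 0" using e r by (simp add: e1_def)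
    then obtain N where N: "\<And>i j. i \<ge> N \<Longrightarrow> j \<ge> N \<Longrightarrow> vnorm (Hcb V W) (s i - s j) < e1"
      using cauchy by blast
    have "vnorm W (Ds i h - Ds j h) < e" if "i \<ge> N" "j \<ge> N" for i j
    proof -
      have "vnorm W (Ds i h - Ds j h) \<le> 2 * e1 / r * vnorm V h"
        using est(1)[OF N h] that by blast
      also have "\<dots> = e * (vnorm V h / k)" using r k by (simp add: e1_def)
      also have "\<dots> < e * 1" using e k by (intro mult_strict_left_mono) simp_all
      finally show ?thesis by simp
    qed
    then show "\<exists>N. \<forall>i\<ge>N. \<forall>j\<ge>N. vnorm W (Ds i h - Ds j h) < e" by blast
  qed
  then obtain D where DW: "\<And>h. h \<in> vectors V \<Longrightarrow> D h \<in> vectors W"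
    and Dlim: "\<And>h. h \<in> vectors V \<Longrightarrow> (\<lambda>i. vnorm W (Ds i h - D h)) \<longlonglongrightarrow> 0"
    by metis
  \<comment> \<open>The two estimates of \<open>est\<close> with i = N fixed and j tending to
    infinity.\<close>
  have estD: "vnorm W (D h - Ds N h) \<le> 2 * e / r * vnorm V h"
    "vnorm V h < r \<Longrightarrow> vnorm W ((f (x + h) - s N (x + h)) - (f x - s N x)) \<le> 2 * e / r * vnorm V h"
    if N: "\<And>j. j \<ge> N \<Longrightarrow> vnorm (Hcb V W) (s j - s N) < e" and h: "h \<in> vectors V" for N e h
  proof -
    have ev: "\<forall>\<^sub>F j in sequentially. vnorm (Hcb V W) (s j - s N) < e"
      using N by (auto simp: eventually_sequentially)
    show "vnorm W (D h - Ds N h) \<le> 2 * e / r * vnorm V h"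
    proof (rule cod.vnorm_limit_le)
      show "(\<lambda>j. vnorm W (Ds j h - Ds N h - (D h - Ds N h))) \<longlonglongrightarrow> 0"
        using DsW[OF h] DW[OF h] Dlim[OF h] by (intro cod.vlim_diff cod.vlim_const)
      show "\<forall>\<^sub>F j in sequentially. vnorm W (Ds j h - Ds N h) \<le> 2 * e / r * vnorm V h"
        using ev by eventually_elim (rule est(1)[OF _ h])
    qed (use DsW[OF h] DW[OF h] in auto)
    assume hr: "vnorm V h < r"
    show "vnorm W ((f (x + h) - s N (x + h)) - (f x - s N x)) \<le> 2 * e / r * vnorm V h"
    proof (rule cod.vnorm_limit_le)
      show "(\<lambda>j. vnorm W ((s j (x + h) - s N (x + h)) - (s j x - s N x)
          - ((f (x + h) - s N (x + h)) - (f x - s N x)))) \<longlonglongrightarrow> 0"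
        using sW f lim by (intro cod.vlim_diff cod.vlim_const cod.diff_in_vectors)
      show "\<forall>\<^sub>F j in sequentially. vnorm W ((s j (x + h) - s N (x + h)) - (s j x - s N x)) \<le> 2 * e / r * vnorm V h"
        using ev by eventually_elim (rule est(2)[OF _ h hr])
    qed (use sW f in auto)
  qed
  have "has_frechet_derivative V W f D x"
    unfolding has_frechet_derivative_def
  proof (intro conjI allI impI)
    \<comment> \<open>One index at distance less than 1 from all later ones suffices for boundedness
      of D: D differs from the bounded map \<open>Ds N\<close> by at most 2 / r times the norm of
      h.\<close>
    obtain N where N: "\<And>j. j \<ge> N \<Longrightarrow> vnorm (Hcb V W) (s j - s N) < 1"
      using cauchy[of 1] by auto
    obtain K where K: "\<And>h. h \<in> vectors V \<Longrightarrow> vnorm W (Ds N h) \<le> K * vnorm V h"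
      using frechet_bounded[OF Ds] by blast
    show "bounded_clinear_map V W D"
    proof (rule bounded_clinear_mapI[where K = "2 * 1 / r + K"])
      fix h assume h: "h \<in> vectors V"
      show "D h \<in> vectors W" by (rule DW[OF h])
      show "D (h + k) = D h + D k" if k: "k \<in> vectors V" for k
      proof (rule cod.vlim_unique)
        have hk: "h + k \<in> vectors V" using h k by simp
        show "(\<lambda>i. vnorm W (Ds i (h + k) - D (h + k))) \<longlonglongrightarrow> 0" by (rule Dlim[OF hk])
        show "(\<lambda>i. vnorm W (Ds i (h + k) - (D h + D k))) \<longlonglongrightarrow> 0"
          unfolding has_frechet_derivativeD(2)[OF Ds h k]
          by (intro cod.vlim_add DsW h k DW Dlim)
        show "Ds i (h + k) \<in> vectors W" for i by (rule DsW[OF hk])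
        show "D (h + k) \<in> vectors W" by (rule DW[OF hk])
        show "D h + D k \<in> vectors W" using DW h k by simp
      qed
      show "D (cscale V c h) = cscale W c (D h)" for c
      proof (rule cod.vlim_unique)
        have ch: "cscale V c h \<in> vectors V" using h by simp
        show "(\<lambda>i. vnorm W (Ds i (cscale V c h) - D (cscale V c h))) \<longlonglongrightarrow> 0" by (rule Dlim[OF ch])
        show "(\<lambda>i. vnorm W (Ds i (cscale V c h) - cscale W c (D h))) \<longlonglongrightarrow> 0"
          unfolding has_frechet_derivativeD(3)[OF Ds h]
          by (intro cod.vlim_cscale DsW h DW Dlim)
        show "Ds i (cscale V c h) \<in> vectors W" for i by (rule DsW[OF ch])
        show "D (cscale V c h) \<in> vectors W" by (rule DW[OF ch])
        show "cscale W c (D h) \<in> vectors W" using DW h by simp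
      qed
      have "vnorm W ((D h - Ds N h) + Ds N h) \<le> vnorm W (D h - Ds N h) + vnorm W (Ds N h)"
        using DW[OF h] DsW[OF h] by (intro cod.vnorm_triangle) auto
      then show "vnorm W (D h) \<le> (2 * 1 / r + K) * vnorm V h"
        using estD(1)[OF N h] K[OF h] by (simp add: distrib_right)
    qed
  next
    fix e :: real assume e: "e > 0"
    \<comment> \<open>With this distance both bounds of \<open>estD\<close> become e / 4 times the
      norm of h. Together with e / 2 from the remainder of s N they add up to e.\<close>
    have "e * r / 8 > 0" using e r by simp
    then obtain N where N: "\<And>j. j \<ge> N \<Longrightarrow> vnorm (Hcb V W) (s j - s N) < e * r / 8"
      using cauchy by blast
    obtain d where d: "d > 0" "\<And>h. h \<in> vectors V \<Longrightarrow> vnorm V h < d \<Longrightarrow>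
        vnorm W (s N (x + h) - s N x - Ds N h) \<le> e / 2 * vnorm V h"
      using has_frechet_derivativeD(4)[OF Ds, of "e / 2" N] e by auto
    have "vnorm W (f (x + h) - f x - D h) \<le> e * vnorm V h"
      if h: "h \<in> vectors V" "vnorm V h < min d r" for h
    proof -
      \<comment> \<open>Increment of f - s N, remainder of s N, and difference of the two
        derivatives.\<close>
      let ?a = "(f (x + h) - s N (x + h)) - (f x - s N x)"
        and ?b = "s N (x + h) - s N x - Ds N h" and ?c = "D h - Ds N h"
      have mem: "?a \<in> vectors W" "?b \<in> vectors W" "?c \<in> vectors W"
        using f sW DW[OF h(1)] DsW[OF h(1)] by auto
      have eq: "f (x + h) - f x - D h = ?a + ?b - ?c" by (simp add: algebra_simps)
      have "vnorm W (?a + ?b - ?c) \<le> vnorm W (?a + ?b) + vnorm W ?c"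
        by (intro cod.vnorm_diff cod.add_in_vectors mem)
      also have "\<dots> \<le> vnorm W ?a + vnorm W ?b + vnorm W ?c"
        by (intro add_right_mono cod.vnorm_triangle mem)
      also have "\<dots> \<le> e / 4 * vnorm V h + e / 2 * vnorm V h + e / 4 * vnorm V h"
        using estD[OF N h(1)] d(2)[OF h(1)] h(2) r by (intro add_mono) auto
      also have "\<dots> = e * vnorm V h" by (simp add: field_simps)
      finally show ?thesis unfolding eq .
    qed
    then show "\<exists>d>0. \<forall>h\<in>vectors V. vnorm V h < d \<longrightarrow> vnorm W (f (x + h) - f x - D h) \<le> e * vnorm V h"
      using d(1) r by (intro exI[of _ "min d r"]) simp
  qed
  then show ?thesis by blast
qed

section \<open>Completeness of the function space\<close>

context normed_pair
begin

lemma Hcb_complete: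
  fixes s :: "nat \<Rightarrow> 'v \<Rightarrow> 'w"
  assumes s: "\<And>i. s i \<in> vectors (Hcb V W)"
    and cauchy: "\<And>e. e > 0 \<Longrightarrow> \<exists>N. \<forall>i\<ge>N. \<forall>j\<ge>N. vnorm (Hcb V W) (s i - s j) < e"
  shows "\<exists>f\<in>vectors (Hcb V W). (\<lambda>i. vnorm (Hcb V W) (s i - f)) \<longlonglongrightarrow> 0"
proof -
  note sW = Hcb_value[OF s]
  \<comment> \<open>The value off the ball is fixed along with the limit, so that the chosen f
    already obeys the convention of extension by zero.\<close>
  have "\<exists>l\<in>vectors W. (\<lambda>i. vnorm W (s i x - l)) \<longlonglongrightarrow> 0 \<and> (x \<notin> unit_ball V \<longrightarrow> l = 0)" for x
  proof (cases "x \<in> unit_ball V")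
    case True
    have "\<exists>l\<in>vectors W. (\<lambda>i. vnorm W (s i x - l)) \<longlonglongrightarrow> 0"
    proof (rule cod.complete[OF sW])
      fix e :: real assume "e > 0"
      then obtain N where N: "\<forall>i\<ge>N. \<forall>j\<ge>N. vnorm (Hcb V W) (s i - s j) < e"
        using cauchy by blast
      have "vnorm W (s i x - s j x) \<le> vnorm (Hcb V W) (s i - s j)" for i j
        using value_le_vnorm[OF Hcb_diff[OF s s] True] by simp
      then show "\<exists>N. \<forall>i\<ge>N. \<forall>j\<ge>N. vnorm W (s i x - s j x) < e"
        using N by (intro exI[of _ N]) (meson le_less_trans)
    qed
    then show ?thesis using True by blast
  next
    case False
    then show ?thesis using Hcb_outside[OF s] by (intro bexI[of _ 0]) auto
  qed
  then obtain f where f: "\<And>x. f x \<in> vectors W" and lim: "\<And>x. (\<lambda>i. vnorm W (s i x - f x)) \<longlonglongrightarrow> 0"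
    and outside: "\<And>x. x \<notin> unit_ball V \<Longrightarrow> f x = 0"
    by metis
  \<comment> \<open>Let j tend to infinity in the bound for s i - s j, entry by entry. The bound e
    is the same for all m and X, which yields complete boundedness of f and convergence in the norm
    of the function space.\<close>
  have unif: "mnorm W (map_mat (s i - f) X) \<le> e"
    if N: "\<And>j. j \<ge> N \<Longrightarrow> vnorm (Hcb V W) (s i - s j) < e"
      and m: "m \<ge> 1" and X: "X \<in> mat_unit_ball V m" for i N e m X
  proof (rule cod.mnorm_limit_le[OF m])
    note X' = dom.mat_unit_ballD(1)[OF X]
    show "map_mat (s i - f) X \<in> Mats W m"
      using sW f by (intro map_mat_in_Mats[OF _ X]) simp
    show "map_mat (s i - s j) X \<in> Mats W m" for j
      using sW by (intro map_mat_in_Mats[OF _ X]) simp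
    show "(\<lambda>j. vnorm W (map_mat (s i - s j) X $$ (k, l) - map_mat (s i - f) X $$ (k, l))) \<longlonglongrightarrow> 0"
      if "k < m" "l < m" for k l
    proof -
      let ?x = "X $$ (k, l)"
      have "(\<lambda>j. vnorm W (s i ?x - s j ?x - (s i ?x - f ?x))) \<longlonglongrightarrow> 0"
        using sW f lim by (intro cod.vlim_diff cod.vlim_const)
      then show ?thesis using X' that by simp
    qed
    have "mnorm W (map_mat (s i - s j) X) \<le> e" if "j \<ge> N" for j
      using map_mat_le_vnorm[OF Hcb_diff[OF s s] m X, of i j] N[OF that] by linarith
    then show "\<forall>\<^sub>F j in sequentially. mnorm W (map_mat (s i - s j) X) \<le> e"
      by (auto simp: eventually_sequentially)
  qed
  obtain N where N: "\<And>j. j \<ge> N \<Longrightarrow> vnorm (Hcb V W) (s N - s j) < 1"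
    using cauchy[of 1] by auto
  obtain K where K: "\<And>m X. m \<ge> 1 \<Longrightarrow> X \<in> mat_unit_ball V m \<Longrightarrow> mnorm W (map_mat (s N) X) \<le> K"
    using Hcb_bounded[OF s] by blast
  have fH: "f \<in> vectors (Hcb V W)"
  proof (rule HcbI[OF f outside])
    show "\<exists>D. has_frechet_derivative V W f D x" if "x \<in> unit_ball V" for x
      using s cauchy f lim that by (rule frechet_limit)
    fix m X assume m: "m \<ge> (1 :: nat)" and X: "X \<in> mat_unit_ball V m"
    have M: "map_mat (s N) X \<in> Mats W m" "map_mat (s N - f) X \<in> Mats W m"
      using sW f by (auto intro!: map_mat_in_Mats[OF _ X])
    have M': "map_mat (cscale W (- 1)) (map_mat (s N - f) X) \<in> Mats W m"
      using M(2) Mats_dim[OF M(2)] by (auto simp: Mats_iff)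
    \<comment> \<open>f is s N minus (s N - f), whose parts are bounded by K and 1. The difference
      is written with the scalar -1 because the axioms speak of sums and multiples.\<close>
    have "map_mat f X = map_mat (s N) X + map_mat (cscale W (- 1)) (map_mat (s N - f) X)"
      by (rule eq_matI) (auto simp: cod.cscale_algebra)
    then have "mnorm W (map_mat f X) \<le> mnorm W (map_mat (s N) X) + mnorm W (map_mat (s N - f) X)"
      using cod.mnorm_triangle[OF m M(1) M'] cod.mnorm_scale[OF m M(2), of "- 1"] by simp
    then show "mnorm W (map_mat f X) \<le> K + 1"
      using K[OF m X] unif[where i = N and N = N, OF N m X] by simp
  qed
  moreover have "(\<lambda>i. vnorm (Hcb V W) (s i - f)) \<longlonglongrightarrow> 0"
  proof (rule LIMSEQ_I)
    fix e :: real assume e: "e > 0"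
    \<comment> \<open>Half of e, since a strict bound becomes a weak one in the limit.\<close>
    then obtain N where N: "\<And>i j. i \<ge> N \<Longrightarrow> j \<ge> N \<Longrightarrow> vnorm (Hcb V W) (s i - s j) < e / 2"
      using cauchy[of "e / 2"] by auto
    have "norm (vnorm (Hcb V W) (s i - f) - 0) < e" if "i \<ge> N" for i
    proof -
      have "vnorm (Hcb V W) (s i - f) \<le> e / 2"
        using N[OF that] by (intro vnorm_Hcb_least unif)
      moreover have "vnorm (Hcb V W) (s i - f) \<ge> 0"
        unfolding vnorm_def using Hcb_diff[OF s fH] by (intro mnorm_Hcb_nonneg[of 1]) simp_all
      ultimately show ?thesis using e by simp
    qed
    then show "\<exists>N. \<forall>i\<ge>N. norm (vnorm (Hcb V W) (s i - f) - 0) < e" by blast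
  qed
  ultimately show ?thesis by blast
qed

lemma operator_space_Hcb: "operator_space (Hcb V W)"
  by (rule operator_space.intro)
     (fact vector_space_Hcb subspace_Hcb mnorm_Hcb_eq_0 mnorm_Hcb_scale mnorm_Hcb_triangle
       mnorm_Hcb_conj mnorm_Hcb_direct_sum Hcb_complete)+

end

section \<open>Pointwise products of completely bounded holomorphic maps\<close>

locale algebra_pair = normed_pair V W + alg: completely_contractive_Banach_algebra W mul
  for V :: "('v::ab_group_add, 'y) matrix_normed_scheme"
    and W :: "('w::ab_group_add, 'z) matrix_normed_scheme" and mul
begin

lemma vnorm_mul:
  assumes "a \<in> vectors W" "b \<in> vectors W"
  shows "vnorm W (mul a b) \<le> vnorm W a * vnorm W b"
proof -
  have "mat_mult_tensor mul (Matrix.mat 1 1 (\<lambda>_. a)) (Matrix.mat 1 1 (\<lambda>_. b)) = Matrix.mat 1 1 (\<lambda>_. mul a b)"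
    by (rule eq_matI) (auto simp: mat_mult_tensor_def)
  then show ?thesis
    using alg.mul_jcc[of 1 1 "Matrix.mat 1 1 (\<lambda>_. a)" "Matrix.mat 1 1 (\<lambda>_. b)"] assms
    by (simp add: vnorm_def)
qed

lemma mul_zero_left: "b \<in> vectors W \<Longrightarrow> mul 0 b = 0"
  using alg.mul_add_left[of 0 0 b] by simp

lemma mul_diff_left:
  assumes "a \<in> vectors W" "b \<in> vectors W" "c \<in> vectors W"
  shows "mul (a - b) c = mul a c - mul b c"
  using alg.mul_add_left[of "a - b" b c] assms by (simp add: eq_diff_eq)

lemma mul_diff_right:
  assumes "a \<in> vectors W" "b \<in> vectors W" "c \<in> vectors W"
  shows "mul a (b - c) = mul a b - mul a c"
  using alg.mul_add_right[of a "b - c" c] assms by (simp add: eq_diff_eq)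

text \<open>The product rule; at the first matrix level joint complete contractivity says that
  multiplication is bounded by the product of the norms.\<close>

lemma frechet_mul:
  assumes f: "has_frechet_derivative V W f D x" and g: "has_frechet_derivative V W g E x"
    and W: "\<And>y. f y \<in> vectors W" "\<And>y. g y \<in> vectors W"
  shows "has_frechet_derivative V W (\<lambda>y. mul (f y) (g y)) (\<lambda>h. mul (f x) (E h) + mul (D h) (g x)) x"
  unfolding has_frechet_derivative_def
proof (intro conjI allI impI)
  note D = has_frechet_derivativeD[OF f] and E = has_frechet_derivativeD[OF g]
  obtain K where K: "K \<ge> 0" "\<And>h. h \<in> vectors V \<Longrightarrow> vnorm W (D h) \<le> K * vnorm V h"
    using frechet_bounded[OF f] by blast
  obtain L where L: "L \<ge> 0" "\<And>h. h \<in> vectors V \<Longrightarrow> vnorm W (E h) \<le> L * vnorm V h"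
    using frechet_bounded[OF g] by blast
  define F G where "F = vnorm W (f x)" and "G = vnorm W (g x)"
  have FG: "F \<ge> 0" "G \<ge> 0" using W by (simp_all add: F_def G_def)
  show "bounded_clinear_map V W (\<lambda>h. mul (f x) (E h) + mul (D h) (g x))"
  proof (rule bounded_clinear_mapI[where K = "F * L + K * G"])
    fix h assume h: "h \<in> vectors V"
    note W' = W[of x] D(1)[OF h] E(1)[OF h]
    show "mul (f x) (E h) + mul (D h) (g x) \<in> vectors W"
      using W' by (simp add: alg.mul_closed)
    show "mul (f x) (E (h + k)) + mul (D (h + k)) (g x)
        = mul (f x) (E h) + mul (D h) (g x) + (mul (f x) (E k) + mul (D k) (g x))"
      if k: "k \<in> vectors V" for k
      using W' D(1)[OF k] E(1)[OF k]
      by (simp add: D(2)[OF h k] E(2)[OF h k] alg.mul_add_left alg.mul_add_right)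
    show "mul (f x) (E (cscale V c h)) + mul (D (cscale V c h)) (g x)
        = cscale W c (mul (f x) (E h) + mul (D h) (g x))" for c
      using W' by (simp add: D(3)[OF h] E(3)[OF h] alg.mul_scale_left alg.mul_scale_right cod.cscale_algebra)
    have "vnorm W (mul (f x) (E h) + mul (D h) (g x)) \<le> vnorm W (mul (f x) (E h)) + vnorm W (mul (D h) (g x))"
      using W' by (intro cod.vnorm_triangle alg.mul_closed)
    also have "\<dots> \<le> F * vnorm W (E h) + vnorm W (D h) * G"
      unfolding F_def G_def using W' by (intro add_mono vnorm_mul)
    also have "\<dots> \<le> F * (L * vnorm V h) + K * vnorm V h * G"
      using K(2)[OF h] L(2)[OF h] FG by (intro add_mono mult_left_mono mult_right_mono)
    finally show "vnorm W (mul (f x) (E h) + mul (D h) (g x)) \<le> (F * L + K * G) * vnorm V h"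
      by (simp add: algebra_simps)
  qed
  fix e :: real assume e: "e > 0"
  \<comment> \<open>A and B dominate what is left at the end: e1 * (F + G + L + 1) from the two
    remainders and n * (K * (L + 1)) from the product of the two increments. Each is to be at most e
    / 2.\<close>
  define A where "A = F + G + L + 2"
  define B where "B = K * (L + 1) + 1"
  have AB: "A > 0" "B > 0" using FG K(1) L(1) by (simp_all add: A_def B_def add_nonneg_pos)
  define e1 where "e1 = min 1 (e / (2 * A))"
  have e1: "e1 > 0" "e1 \<le> 1" "e1 * A \<le> e / 2"
    using e AB by (auto simp: e1_def min_def field_simps)
  obtain d1 where d1: "d1 > 0" "\<And>h. h \<in> vectors V \<Longrightarrow> vnorm V h < d1 \<Longrightarrow>
      vnorm W (f (x + h) - f x - D h) \<le> e1 * vnorm V h"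
    using D(4)[OF e1(1)] by auto
  obtain d2 where d2: "d2 > 0" "\<And>h. h \<in> vectors V \<Longrightarrow> vnorm V h < d2 \<Longrightarrow>
      vnorm W (g (x + h) - g x - E h) \<le> e1 * vnorm V h"
    using E(4)[OF e1(1)] by auto
  \<comment> \<open>The bound 1 keeps the norm of g (x + h) below L + 1 + G, and e / (2 * B) makes n
    * B at most e / 2.\<close>
  define d where "d = Min {d1, d2, 1, e / (2 * B)}"
  have d: "d > 0" "d \<le> d1" "d \<le> d2" "d \<le> 1" "d \<le> e / (2 * B)"
    using d1(1) d2(1) e AB by (auto simp: d_def)
  have "vnorm W (mul (f (x + h)) (g (x + h)) - mul (f x) (g x) - (mul (f x) (E h) + mul (D h) (g x)))
      \<le> e * vnorm V h" if h: "h \<in> vectors V" "vnorm V h < d" for h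
  proof -
    define n where "n = vnorm V h"
    have n: "n \<ge> 0" "n \<le> 1" "n \<le> d"
      using h d by (auto simp: n_def)
    then have nB: "n * B \<le> e / 2"
      using d(5) AB mult_right_mono[of n "e / (2 * B)" B] by simp
    note W' = W D(1)[OF h(1)] E(1)[OF h(1)]
    let ?u = "f (x + h) - f x - D h" and ?v = "g (x + h) - g x - E h" and ?w = "g (x + h) - g x"
    have uv: "?u \<in> vectors W" "?v \<in> vectors W" "?w \<in> vectors W" using W' by auto
    have u: "vnorm W ?u \<le> e1 * n" and v: "vnorm W ?v \<le> e1 * n"
      using d1(2)[OF h(1)] d2(2)[OF h(1)] h(2) d by (auto simp: n_def)
    have "vnorm W (?v + E h) \<le> vnorm W ?v + vnorm W (E h)"
      using uv W' by (intro cod.vnorm_triangle)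
    also have "\<dots> \<le> 1 * n + L * n"
      using v L(2)[OF h(1)] mult_right_mono[OF e1(2) n(1)] by (auto simp: n_def)
    finally have w: "vnorm W ?w \<le> (L + 1) * n" by (simp add: algebra_simps)
    have "vnorm W (?w + g x) \<le> vnorm W ?w + G"
      unfolding G_def using uv W' by (intro cod.vnorm_triangle)
    also have "\<dots> \<le> (L + 1) * n + G" using w by simp
    also have "(L + 1) * n \<le> (L + 1) * 1"
      using n L(1) by (intro mult_left_mono) auto
    finally have gx: "vnorm W (g (x + h)) \<le> L + 1 + G" by simp
    \<comment> \<open>Change one factor at a time: remainder of f times the new value of g, linear
      part of f times the full increment of g, old value of f times the remainder of g.\<close>
    have eq: "mul (f (x + h)) (g (x + h)) - mul (f x) (g x) - (mul (f x) (E h) + mul (D h) (g x))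
        = mul ?u (g (x + h)) + mul (D h) ?w + mul (f x) ?v"
      using W' by (simp add: mul_diff_left mul_diff_right alg.mul_closed)
    have "vnorm W (mul ?u (g (x + h)) + mul (D h) ?w + mul (f x) ?v)
        \<le> vnorm W (mul ?u (g (x + h)) + mul (D h) ?w) + vnorm W (mul (f x) ?v)"
      using uv W' by (intro cod.vnorm_triangle alg.mul_closed cod.add_in_vectors)
    also have "\<dots> \<le> vnorm W (mul ?u (g (x + h))) + vnorm W (mul (D h) ?w) + vnorm W (mul (f x) ?v)"
      using uv W' by (intro add_right_mono cod.vnorm_triangle alg.mul_closed)
    also have "\<dots> \<le> vnorm W ?u * vnorm W (g (x + h)) + vnorm W (D h) * vnorm W ?w + F * vnorm W ?v"
      unfolding F_def using uv W' by (intro add_mono vnorm_mul)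
    also have "\<dots> \<le> (e1 * n) * (L + 1 + G) + (K * n) * ((L + 1) * n) + F * (e1 * n)"
      using u v w gx K(2)[OF h(1)] uv W' FG n e1(1) K(1) L(1)
      by (intro add_mono mult_mono mult_nonneg_nonneg) (auto simp: n_def)
    also have "\<dots> = n * (e1 * (F + G + L + 1)) + n * (n * (K * (L + 1)))"
      by (simp add: algebra_simps)
    also have "\<dots> \<le> n * (e1 * A) + n * (n * B)"
      using n e1(1) by (intro add_mono mult_left_mono) (auto simp: A_def B_def)
    also have "\<dots> \<le> n * (e / 2) + n * (e / 2)"
      using n nB e1 by (intro add_mono mult_left_mono) auto
    finally show ?thesis unfolding eq by (simp add: n_def mult.commute)
  qed
  then show "\<exists>d>0. \<forall>h\<in>vectors V. vnorm V h < d \<longrightarrow>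
      vnorm W (mul (f (x + h)) (g (x + h)) - mul (f x) (g x) - (mul (f x) (E h) + mul (D h) (g x)))
        \<le> e * vnorm V h"
    using d(1) by blast
qed

text \<open>Since multiplication is pointwise, the amplified product only contains those entries of the
  tensor product of \<open>F(X)\<close> and \<open>G(X)\<close> in which both factors are evaluated at the same entry of
  \<open>X\<close>; it is a compression of that tensor product.\<close>

lemma amplify_mult_tensor_le:
  assumes p: "p \<ge> 1" and q: "q \<ge> 1" and m: "m \<ge> 1"
    and F: "F \<in> Mats (Hcb V W) p" and G: "G \<in> Mats (Hcb V W) q" and X: "X \<in> mat_unit_ball V m"
  shows "mnorm W (amplify (mat_mult_tensor (\<lambda>f g x. mul (f x) (g x)) F G) X)
    \<le> mnorm W (amplify F X) * mnorm W (amplify G X)"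
proof -
  note c = Mats_carrier[OF F] Mats_carrier[OF G] dom.mat_unit_ballD(1)[OF X]
  note A = amplify_in_Mats[OF F X] and B = amplify_in_Mats[OF G X]
  let ?T = "mat_mult_tensor mul (amplify F X) (amplify G X)"
  \<comment> \<open>A position a codes k = a div m div q (row of F), r = a div m mod q (row of G)
    and i = a mod m (row of X). It is sent to the row of the tensor product with outer index (k, i)
    and inner index (r, i): the same i occurs in both factors. Columns are treated alike.\<close>
  let ?\<sigma> = "\<lambda>a. (a mod m + (a div m mod q) * m) + (a mod m + (a div m div q) * m) * (q * m)"
  have dT: "?T \<in> Mats W (p * m * (q * m))"
  proof -
    have eq: "?T = Matrix.mat (p * m * (q * m)) (p * m * (q * m)) (\<lambda>(i, j).
        mul (amplify F X $$ (i div (q * m), j div (q * m))) (amplify G X $$ (i mod (q * m), j mod (q * m))))"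
      using c by (simp add: mat_mult_tensor_def)
    show ?thesis
      unfolding eq mat_in_Mats
      by (auto intro!: alg.mul_closed Mats_entry[OF A] Mats_entry[OF B]
          intro: div_less_of_less_mult mod_less_of_less_mult)
  qed
  have lt: "a mod m + (a div m mod q) * m < q * m" "a mod m + (a div m div q) * m < p * m"
    if a: "a < p * q * m" for a
  proof -
    have "a mod m < m" "a div m < p * q"
      using a by (auto intro: div_less_of_less_mult mod_less_of_less_mult)
    then show "a mod m + (a div m mod q) * m < q * m" "a mod m + (a div m div q) * m < p * m"
      by (auto intro!: block_index_less intro: div_less_of_less_mult mod_less_of_less_mult)
  qed
  have div_mod: "(u + v * k) div k = v" "(u + v * k) mod k = u" if "u < k" for u v k :: nat
    using that by simp_all
  have \<sigma>_div: "?\<sigma> a div (q * m) = a mod m + (a div m div q) * m"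
    and \<sigma>_mod: "?\<sigma> a mod (q * m) = a mod m + (a div m mod q) * m" if "a < p * q * m" for a
    by (rule div_mod[OF lt(1)[OF that]])+
  have \<sigma>_lt: "?\<sigma> a < p * m * (q * m)" if "a < p * q * m" for a
    by (rule block_index_less[OF lt(2)[OF that] lt(1)[OF that]])
  \<comment> \<open>Quotient and remainder by q * m return the two pairs, and these return k, r and
    i.\<close>
  have inj: "inj_on ?\<sigma> {..<p * q * m}"
  proof (rule inj_onI)
    fix a b assume ab: "a \<in> {..<p * q * m}" "b \<in> {..<p * q * m}" and eq: "?\<sigma> a = ?\<sigma> b"
    have 1: "a mod m + (a div m div q) * m = b mod m + (b div m div q) * m"
      using arg_cong[OF eq, of "\<lambda>k. k div (q * m)"] \<sigma>_div ab by simp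
    have 2: "a mod m + (a div m mod q) * m = b mod m + (b div m mod q) * m"
      using arg_cong[OF eq, of "\<lambda>k. k mod (q * m)"] \<sigma>_mod ab by simp
    have "a mod m = b mod m"
      using arg_cong[OF 1, of "\<lambda>k. k mod m"] by simp
    moreover have "a div m div q = b div m div q"
      using arg_cong[OF 1, of "\<lambda>k. k div m"] m by simp
    moreover have "a div m mod q = b div m mod q"
      using arg_cong[OF 2, of "\<lambda>k. k div m"] m by simp
    ultimately show "a = b" by (metis div_mult_mod_eq)
  qed
  have "amplify (mat_mult_tensor (\<lambda>f g x. mul (f x) (g x)) F G) X
      = Matrix.mat (p * q * m) (p * q * m) (\<lambda>(a, b). ?T $$ (?\<sigma> a, ?\<sigma> b))"
  proof (rule eq_matI)
    fix a b
    assume "a < dim_row (Matrix.mat (p * q * m) (p * q * m) (\<lambda>(a, b). ?T $$ (?\<sigma> a, ?\<sigma> b)))"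
      and "b < dim_col (Matrix.mat (p * q * m) (p * q * m) (\<lambda>(a, b). ?T $$ (?\<sigma> a, ?\<sigma> b)))"
    then have ab: "a < p * q * m" "b < p * q * m" by simp_all
    have FG: "mat_mult_tensor (\<lambda>f g x. mul (f x) (g x)) F G \<in> carrier_mat (p * q) (p * q)"
      using c by (auto simp: mat_mult_tensor_def)
    have d: "a div m < p * q" "b div m < p * q"
      using ab by (auto intro: div_less_of_less_mult)
    have "?T $$ (?\<sigma> a, ?\<sigma> b) = mul (amplify F X $$ (?\<sigma> a div (q * m), ?\<sigma> b div (q * m)))
        (amplify G X $$ (?\<sigma> a mod (q * m), ?\<sigma> b mod (q * m)))"
      using c \<sigma>_lt[OF ab(1)] \<sigma>_lt[OF ab(2)] by (simp add: mat_mult_tensor_def)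
    also have "\<dots> = mul ((F $$ (a div m div q, b div m div q)) (X $$ (a mod m, b mod m)))
        ((G $$ (a div m mod q, b div m mod q)) (X $$ (a mod m, b mod m)))"
      unfolding \<sigma>_div[OF ab(1)] \<sigma>_div[OF ab(2)] \<sigma>_mod[OF ab(1)] \<sigma>_mod[OF ab(2)]
        amplify_index[OF c(1,3) lt(2)[OF ab(1)] lt(2)[OF ab(2)]]
        amplify_index[OF c(2,3) lt(1)[OF ab(1)] lt(1)[OF ab(2)]]
      using m by simp
    also have "\<dots> = amplify (mat_mult_tensor (\<lambda>f g x. mul (f x) (g x)) F G) X $$ (a, b)"
      unfolding amplify_index[OF FG c(3) ab] using c d by (simp add: mat_mult_tensor_def)
    finally show "amplify (mat_mult_tensor (\<lambda>f g x. mul (f x) (g x)) F G) X $$ (a, b)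
        = Matrix.mat (p * q * m) (p * q * m) (\<lambda>(a, b). ?T $$ (?\<sigma> a, ?\<sigma> b)) $$ (a, b)"
      using ab by simp
  qed (use c in \<open>auto simp: mat_mult_tensor_def\<close>)
  also have "mnorm W \<dots> \<le> mnorm W ?T"
    using p q m by (intro cod.mnorm_submatrix[OF _ _ dT inj \<sigma>_lt inj \<sigma>_lt]) auto
  also have "\<dots> \<le> mnorm W (amplify F X) * mnorm W (amplify G X)"
    using p q m by (intro alg.mul_jcc[OF _ _ A B]) auto
  finally show ?thesis .
qed

text \<open>Complete boundedness of the product is the tensor estimate for 1 x 1 matrices of
  functions.\<close>

lemma Hcb_mul:
  assumes f: "f \<in> vectors (Hcb V W)" and g: "g \<in> vectors (Hcb V W)"
  shows "(\<lambda>x. mul (f x) (g x)) \<in> vectors (Hcb V W)"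
proof (rule HcbI)
  note W = Hcb_value[OF f] Hcb_value[OF g]
  show "mul (f x) (g x) \<in> vectors W" for x
    by (intro alg.mul_closed W)
  show "x \<notin> unit_ball V \<Longrightarrow> mul (f x) (g x) = 0" for x
    using Hcb_outside[OF f] W by (simp add: mul_zero_left)
  show "\<exists>D. has_frechet_derivative V W (\<lambda>x. mul (f x) (g x)) D x" if x: "x \<in> unit_ball V" for x
  proof -
    obtain D where D: "has_frechet_derivative V W f D x" using Hcb_frechet[OF f x] .
    obtain E where E: "has_frechet_derivative V W g E x" using Hcb_frechet[OF g x] .
    show ?thesis using frechet_mul[OF D E W] by blast
  qed
  fix m X assume m: "m \<ge> (1 :: nat)" and X: "X \<in> mat_unit_ball V m"
  note X' = dom.mat_unit_ballD(1)[OF X]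
  have 1: "(1 :: nat) \<ge> 1" by simp
  have fM: "Matrix.mat 1 1 (\<lambda>_. f) \<in> Mats (Hcb V W) 1" "Matrix.mat 1 1 (\<lambda>_. g) \<in> Mats (Hcb V W) 1"
    using f g by simp_all
  have "mat_mult_tensor (\<lambda>f g x. mul (f x) (g x)) (Matrix.mat 1 1 (\<lambda>_. f)) (Matrix.mat 1 1 (\<lambda>_. g))
      = Matrix.mat 1 1 (\<lambda>_ x. mul (f x) (g x))"
    by (rule eq_matI) (auto simp: mat_mult_tensor_def)
  then have "mnorm W (map_mat (\<lambda>x. mul (f x) (g x)) X) \<le> mnorm W (map_mat f X) * mnorm W (map_mat g X)"
    using amplify_mult_tensor_le[OF 1 1 m fM X] by (simp only: amplify_singleton[OF X'])
  also have "\<dots> \<le> vnorm (Hcb V W) f * vnorm (Hcb V W) g"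
    using cod.mnorm_nonneg[OF m map_mat_in_Mats[where f = f, OF W(1) X]]
      cod.mnorm_nonneg[OF m map_mat_in_Mats[where f = g, OF W(2) X]]
      map_mat_le_vnorm[OF f m X] map_mat_le_vnorm[OF g m X]
    by (intro mult_mono) auto
  finally show "mnorm W (map_mat (\<lambda>x. mul (f x) (g x)) X) \<le> vnorm (Hcb V W) f * vnorm (Hcb V W) g" .
qed

theorem completely_contractive_Banach_algebra_Hcb:
  "completely_contractive_Banach_algebra (Hcb V W) (\<lambda>f g x. mul (f x) (g x))"
proof (intro completely_contractive_Banach_algebra.intro operator_space_Hcb
    completely_contractive_Banach_algebra_axioms.intro)
  fix f g h :: "'v \<Rightarrow> 'w" and c
  assume f: "f \<in> vectors (Hcb V W)" and g: "g \<in> vectors (Hcb V W)"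
  note W = Hcb_value[OF f] Hcb_value[OF g]
  show "(\<lambda>x. mul (f x) (g x)) \<in> vectors (Hcb V W)" using f g by (rule Hcb_mul)
  show "(\<lambda>x. mul (cscale (Hcb V W) c f x) (g x)) = cscale (Hcb V W) c (\<lambda>x. mul (f x) (g x))"
    using W by (simp add: Hcb_simps(2) alg.mul_scale_left)
  show "(\<lambda>x. mul (f x) (cscale (Hcb V W) c g x)) = cscale (Hcb V W) c (\<lambda>x. mul (f x) (g x))"
    using W by (simp add: Hcb_simps(2) alg.mul_scale_right)
  assume h: "h \<in> vectors (Hcb V W)"
  show "(\<lambda>x. mul (mul (f x) (g x)) (h x)) = (\<lambda>x. mul (f x) (mul (g x) (h x)))"
    using W Hcb_value[OF h] by (simp add: alg.mul_assoc)
  show "(\<lambda>x. mul ((f + g) x) (h x)) = (\<lambda>x. mul (f x) (h x)) + (\<lambda>x. mul (g x) (h x))"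
    using W Hcb_value[OF h] by (simp add: alg.mul_add_left fun_eq_iff)
  show "(\<lambda>x. mul (f x) ((g + h) x)) = (\<lambda>x. mul (f x) (g x)) + (\<lambda>x. mul (f x) (h x))"
    using W Hcb_value[OF h] by (simp add: alg.mul_add_right fun_eq_iff)
next
  fix p q :: nat and F G
  assume p: "p \<ge> 1" and q: "q \<ge> 1" and F: "F \<in> Mats (Hcb V W) p" and G: "G \<in> Mats (Hcb V W) q"
  show "mnorm (Hcb V W) (mat_mult_tensor (\<lambda>f g x. mul (f x) (g x)) F G)
      \<le> mnorm (Hcb V W) F * mnorm (Hcb V W) G"
  proof (rule mnorm_Hcb_least)
    fix m X assume m: "m \<ge> (1 :: nat)" and X: "X \<in> mat_unit_ball V m"
    have "mnorm W (amplify (mat_mult_tensor (\<lambda>f g x. mul (f x) (g x)) F G) X)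
        \<le> mnorm W (amplify F X) * mnorm W (amplify G X)"
      using p q m F G X by (rule amplify_mult_tensor_le)
    also have "\<dots> \<le> mnorm (Hcb V W) F * mnorm (Hcb V W) G"
      using p q m
      by (intro mult_mono amplify_le_mnorm[OF p F m X] amplify_le_mnorm[OF q G m X] mnorm_Hcb_nonneg[OF p F]
          cod.mnorm_nonneg[OF _ amplify_in_Mats[OF G X]]) simp
    finally show "mnorm W (amplify (mat_mult_tensor (\<lambda>f g x. mul (f x) (g x)) F G) X)
        \<le> mnorm (Hcb V W) F * mnorm (Hcb V W) G" .
  qed
qed

end

section \<open>Operator spaces acting on a Hilbert space\<close>

text \<open>Makes the scalars act on a Hilbert space, so that the scalar-valued case is a special
  case of operators.\<close>

instantiation complex :: complex_hilbert
begin

definition scaleC_complex :: "complex \<Rightarrow> complex \<Rightarrow> complex" where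
  "scaleC_complex = (*)"

definition cinner_complex :: "complex \<Rightarrow> complex \<Rightarrow> complex" where
  "cinner_complex x y = x * cnj y"

instance
proof
  fix c d x y z :: complex and r :: real
  show "scaleC c (x + y) = scaleC c x + scaleC c y" "scaleC (c + d) x = scaleC c x + scaleC d x"
    "scaleC c (scaleC d x) = scaleC (c * d) x" "cinner (x + y) z = cinner x z + cinner y z"
    "cinner (scaleC c x) y = c * cinner x y" "cinner x y = cnj (cinner y x)"
    by (simp_all add: scaleC_complex_def cinner_complex_def algebra_simps)
  show "scaleC (complex_of_real r) x = r *\<^sub>R x"
    by (simp add: scaleC_complex_def scaleR_conv_of_real)
  show "cinner x x = complex_of_real ((norm x)\<^sup>2)"
    unfolding cinner_complex_def by (rule complex_norm_square[symmetric])
qed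

end

section \<open>Inner products and orthogonal expansions\<close>

lemma scaleC_zero_left [simp]: "scaleC 0 x = (0 :: 'h::complex_hilbert)"
  using scaleC_add_left[of 0 0 x] by simp

lemma scaleC_zero_right [simp]: "scaleC c 0 = (0 :: 'h::complex_hilbert)"
  using scaleC_add_right[of c 0 0] by simp

lemma scaleC_one [simp]: "scaleC 1 x = (x :: 'h::complex_hilbert)"
  using scaleC_of_real[of 1 x] by simp

lemma scaleC_sum_right: "scaleC c (\<Sum>i\<in>I. f i) = (\<Sum>i\<in>I. scaleC c (f i :: 'h::complex_hilbert))"
  by (induction I rule: infinite_finite_induct) (simp_all add: scaleC_add_right)

lemma scaleC_sum_left: "scaleC (\<Sum>i\<in>I. f i) x = (\<Sum>i\<in>I. scaleC (f i) (x :: 'h::complex_hilbert))"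
  by (induction I rule: infinite_finite_induct) (simp_all add: scaleC_add_left)

lemma cinner_zero_left [simp]: "cinner 0 (x :: 'h::complex_hilbert) = 0"
  using cinner_add_left[of 0 0 x] by simp

lemma cinner_zero_right [simp]: "cinner (x :: 'h::complex_hilbert) 0 = 0"
  by (subst cinner_commute) simp

lemma cinner_add_right: "cinner (x :: 'h::complex_hilbert) (y + z) = cinner x y + cinner x z"
  by (subst (1 2 3) cinner_commute) (simp add: cinner_add_left)

lemma cinner_diff_left: "cinner (x - y :: 'h::complex_hilbert) z = cinner x z - cinner y z"
  using cinner_add_left[of "x - y" y z] by simp

lemma cinner_scaleC_right: "cinner (x :: 'h::complex_hilbert) (scaleC c y) = cnj c * cinner x y"
  by (subst (1 2) cinner_commute) (simp add: cinner_scaleC_left)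

lemma cinner_sum_left: "cinner (\<Sum>i\<in>I. f i) (y :: 'h::complex_hilbert) = (\<Sum>i\<in>I. cinner (f i) y)"
  by (induction I rule: infinite_finite_induct) (simp_all add: cinner_add_left)

lemma norm_add_orthogonal:
  assumes "cinner x (y :: 'h::complex_hilbert) = 0"
  shows "(norm (x + y))\<^sup>2 = (norm x)\<^sup>2 + (norm y)\<^sup>2"
proof -
  have "cinner y x = 0" using assms cinner_commute[of y x] by simp
  then have "complex_of_real ((norm (x + y))\<^sup>2) = complex_of_real ((norm x)\<^sup>2 + (norm y)\<^sup>2)"
    using assms by (simp only: cinner_self[symmetric] of_real_add cinner_add_left cinner_add_right add_0_left add_0_right)
  then show ?thesis by (simp only: of_real_eq_iff)
qed

text \<open>Keeping the weights \<open>(norm (e k))\<^sup>2\<close> instead of normalising allows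
  zero vectors among the e k.\<close>

lemma norm_sum_orthogonal:
  fixes e :: "nat \<Rightarrow> 'h::complex_hilbert"
  assumes "\<And>k l. k < n \<Longrightarrow> l < n \<Longrightarrow> k \<noteq> l \<Longrightarrow> cinner (e k) (e l) = 0"
  shows "(norm (\<Sum>k<n. scaleC (a k) (e k)))\<^sup>2 = (\<Sum>k<n. (cmod (a k))\<^sup>2 * (norm (e k))\<^sup>2)"
  using assms
proof (induction n)
  case (Suc n)
  have "cinner (\<Sum>k<n. scaleC (a k) (e k)) (scaleC (a n) (e n)) = 0"
    using Suc.prems by (simp add: cinner_sum_left cinner_scaleC_left cinner_scaleC_right)
  from norm_add_orthogonal[OF this] Suc show ?case
    by (simp add: norm_scaleC power_mult_distrib)
qed simp

lemma cinner_cauchy_schwarz: "cmod (cinner x y) \<le> norm x * norm (y :: 'h::complex_hilbert)"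
proof (cases "y = 0")
  case False
  \<comment> \<open>The multiple t of y is the orthogonal projection of x to the line of y, so by
    Pythagoras its norm is at most that of x.\<close>
  define t where "t = cinner x y / complex_of_real ((norm y)\<^sup>2)"
  have "cinner (x - scaleC t y) (scaleC t y) = 0"
    using False by (simp add: cinner_diff_left cinner_scaleC_left cinner_scaleC_right cinner_self t_def)
  from norm_add_orthogonal[OF this] have "(norm x)\<^sup>2 \<ge> (norm (scaleC t y))\<^sup>2" by simp
  then have "norm (scaleC t y) \<le> norm x" by (rule power2_le_imp_le) simp
  then have "cmod (cinner x y) / norm y \<le> norm x"
    using False by (simp add: norm_scaleC t_def norm_divide norm_mult power2_eq_square)
  then show ?thesis using False by (simp add: pos_divide_le_eq)
qed simp

text \<open>Gram-Schmidt without normalisation. Linearly dependent vectors merely produce some e k =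
  0, so n vectors always have an expansion in n orthogonal ones and no rank has to be
  tracked.\<close>

lemma orthogonal_expansion:
  fixes \<xi> :: "nat \<Rightarrow> 'h::complex_hilbert"
  shows "\<exists>e c. (\<forall>k<n. \<forall>l<n. k \<noteq> l \<longrightarrow> cinner (e k) (e l) = 0) \<and>
    (\<forall>j<n. \<xi> j = (\<Sum>k<n. scaleC (c j k) (e k)))"
proof (induction n)
  case (Suc n)
  then obtain e c where orth: "\<And>k l. k < n \<Longrightarrow> l < n \<Longrightarrow> k \<noteq> l \<Longrightarrow> cinner (e k) (e l) = 0"
    and exp: "\<And>j. j < n \<Longrightarrow> \<xi> j = (\<Sum>k<n. scaleC (c j k) (e k))" by blast
  \<comment> \<open>If e k = 0 the quotient is 0 by convention, and both sides of the orthogonality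
    relation for k vanish.\<close>
  define a where "a k = cinner (\<xi> n) (e k) / cinner (e k) (e k)" for k
  define v where "v = \<xi> n - (\<Sum>k<n. scaleC (a k) (e k))"
  have v: "cinner v (e l) = 0" if l: "l < n" for l
  proof -
    have "cinner (\<Sum>k<n. scaleC (a k) (e k)) (e l) = (\<Sum>k<n. if k = l then a l * cinner (e l) (e l) else 0)"
      unfolding cinner_sum_left by (intro sum.cong refl) (use orth l in \<open>auto simp: cinner_scaleC_left\<close>)
    also have "\<dots> = cinner (\<xi> n) (e l)"
      using l by (cases "e l = 0") (auto simp: a_def cinner_self)
    finally show ?thesis by (simp add: v_def cinner_diff_left)
  qed
  then have v': "cinner (e l) v = 0" if "l < n" for l
    using that by (subst cinner_commute) simp
  show ?case
  proof (intro exI conjI allI impI)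
    \<comment> \<open>Earlier vectors get coefficient 0 at the new direction v; the vector \<xi> n
      gets the coefficients a k and the coefficient 1 at v.\<close>
    let ?e = "e(n := v)" and ?c = "\<lambda>j k. if k < n then (if j < n then c j k else a k) else if j < n then 0 else 1"
    show "cinner (?e k) (?e l) = 0" if "k < Suc n" "l < Suc n" "k \<noteq> l" for k l
      using that orth v v' by (auto simp: less_Suc_eq)
    show "\<xi> j = (\<Sum>k<Suc n. scaleC (?c j k) (?e k))" if "j < Suc n" for j
      using that exp[of j] by (auto simp: less_Suc_eq v_def)
  qed
qed auto

text \<open>For each k the coefficients at e k form a scalar vector on which \<alpha> acts with norm
  at most \<open>cmat_norm \<alpha>\<close>. Pythagoras recombines these bounds with the weights of
  the e k.\<close>

lemma norm_scalar_matrix_le: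
  fixes \<xi> :: "nat \<Rightarrow> 'h::complex_hilbert"
  shows "L2_set (\<lambda>i. norm (\<Sum>j<dim_col \<alpha>. scaleC (\<alpha> $$ (i, j)) (\<xi> j))) {..<dim_row \<alpha>}
    \<le> cmat_norm \<alpha> * L2_set (\<lambda>j. norm (\<xi> j)) {..<dim_col \<alpha>}"
proof -
  let ?n = "dim_col \<alpha>"
  obtain e c where orth: "\<And>k l. k < ?n \<Longrightarrow> l < ?n \<Longrightarrow> k \<noteq> l \<Longrightarrow> cinner (e k) (e l) = 0"
    and exp: "\<And>j. j < ?n \<Longrightarrow> \<xi> j = (\<Sum>k<?n. scaleC (c j k) (e k))"
    using orthogonal_expansion[of ?n \<xi>] by blast
  have row: "(norm (\<Sum>j<?n. scaleC (\<alpha> $$ (i, j)) (\<xi> j)))\<^sup>2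
      = (\<Sum>k<?n. (cmod (\<Sum>j<?n. \<alpha> $$ (i, j) * c j k))\<^sup>2 * (norm (e k))\<^sup>2)" for i
  proof -
    have "(\<Sum>j<?n. scaleC (\<alpha> $$ (i, j)) (\<xi> j)) = (\<Sum>j<?n. \<Sum>k<?n. scaleC (\<alpha> $$ (i, j) * c j k) (e k))"
      by (intro sum.cong refl) (simp add: exp scaleC_sum_right scaleC_scaleC)
    also have "\<dots> = (\<Sum>k<?n. scaleC (\<Sum>j<?n. \<alpha> $$ (i, j) * c j k) (e k))"
      by (subst sum.swap) (simp add: scaleC_sum_left)
    finally show ?thesis using norm_sum_orthogonal[OF orth] by simp
  qed
  have "(\<Sum>i<dim_row \<alpha>. (norm (\<Sum>j<?n. scaleC (\<alpha> $$ (i, j)) (\<xi> j)))\<^sup>2)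
      = (\<Sum>k<?n. (\<Sum>i<dim_row \<alpha>. (cmod (\<Sum>j<?n. \<alpha> $$ (i, j) * c j k))\<^sup>2) * (norm (e k))\<^sup>2)"
    unfolding row by (subst sum.swap) (simp add: sum_distrib_right)
  also have "\<dots> \<le> (\<Sum>k<?n. ((cmat_norm \<alpha>)\<^sup>2 * (\<Sum>j<?n. (cmod (c j k))\<^sup>2)) * (norm (e k))\<^sup>2)"
    by (intro sum_mono mult_right_mono sum_power2_le_of_L2_set_le cmat_norm_bound) simp
  also have "\<dots> = (cmat_norm \<alpha>)\<^sup>2 * (\<Sum>k<?n. \<Sum>j<?n. (cmod (c j k))\<^sup>2 * (norm (e k))\<^sup>2)"
    by (simp add: sum_distrib_left sum_distrib_right mult.assoc)
  also have "(\<Sum>k<?n. \<Sum>j<?n. (cmod (c j k))\<^sup>2 * (norm (e k))\<^sup>2) = (\<Sum>j<?n. (norm (\<xi> j))\<^sup>2)"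
    by (subst sum.swap) (intro sum.cong refl, simp add: exp norm_sum_orthogonal[OF orth])
  finally show ?thesis by (rule L2_set_le_of_sum_power2_le) (rule cmat_norm_nonneg)
qed

section \<open>Operator spaces given by an action on a Hilbert space\<close>

lemma sum_lessThan_add: "(\<Sum>j<n + p. g j) = (\<Sum>j<n. g j) + (\<Sum>j<p. g (n + j :: nat) :: 'a::comm_monoid_add)"
  by (induction p) (simp_all add: add.assoc)

text \<open>\<open>norm_act\<close> and \<open>norm_least\<close> together say that the norm of the
  type is the operator norm. Compatibility with complex scalars is asked on A only, because the
  ambient operators may be merely real-linear.\<close>

locale operator_action =
  fixes act :: "'a::banach \<Rightarrow> 'h::complex_hilbert \<Rightarrow> 'h"
    and sc :: "complex \<Rightarrow> 'a \<Rightarrow> 'a"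
    and A :: "'a set"
  assumes vector_space_sc: "vector_space sc"
    and subspace_A: "module.subspace sc A"
    and closed_A: "closed A"
    and act_add_left: "act (a + b) x = act a x + act b x"
    and act_sc: "act (sc c a) x = scaleC c (act a x)"
    and act_scaleC: "a \<in> A \<Longrightarrow> act a (scaleC c x) = scaleC c (act a x)"
    and bounded_linear_act: "bounded_linear (act a)"
    and norm_act: "norm (act a x) \<le> norm a * norm x"
    and norm_least: "C \<ge> 0 \<Longrightarrow> (\<And>x. norm (act a x) \<le> C * norm x) \<Longrightarrow> norm a \<le> C"
begin

definition os :: "'a matrix_normed" where
  "os = \<lparr>vectors = A, cscale = sc, mnorm = act_norm act\<rparr>"

lemma os_simps [simp]: "vectors os = A" "cscale os = sc" "mnorm os = act_norm act"
  by (simp_all add: os_def)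

interpretation sc: vector_space sc by (rule vector_space_sc)

lemma act_zero_left [simp]: "act 0 x = 0"
  using act_add_left[of 0 0 x] by simp

lemma act_zero_right [simp]: "act a 0 = 0"
  using bounded_linear_act by (rule linear_simps(3))

lemma act_add_right: "act a (x + y) = act a x + act a y"
  using bounded_linear_act by (rule linear_simps(1))

lemma act_diff_left: "act (a - b) x = act a x - act b x"
  using act_add_left[of "a - b" b x] by simp

lemma act_sum_left: "act (\<Sum>i\<in>I. f i) x = (\<Sum>i\<in>I. act (f i) x)"
  by (induction I rule: infinite_finite_induct) (simp_all add: act_add_left)

lemma act_sum_right: "act a (\<Sum>i\<in>I. f i) = (\<Sum>i\<in>I. act a (f i))"
  by (induction I rule: infinite_finite_induct) (simp_all add: act_add_right)

lemma act_faithful: "(\<And>x. act a x = act b x) \<Longrightarrow> a = b"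
  using norm_least[of 0 "a - b"] by (simp add: act_diff_left)

lemma norm_matrix_action_le:
  "L2_set (\<lambda>i. norm (\<Sum>j<dim_col X. act (X $$ (i, j)) (\<xi> j))) {..<dim_row X}
    \<le> act_norm act X * L2_set (\<lambda>j. norm (\<xi> j)) {..<dim_col X}"
  by (rule act_norm_bound[where act = act and X = X]) (rule bounded_linear_act)

lemma act_norm_ge_0: "act_norm act X \<ge> 0"
  by (rule act_norm_nonneg[where act = act and X = X]) (rule bounded_linear_act)

text \<open>Convergence at the first matrix level is thereby convergence in the ambient Banach
  space, and completeness reduces to closedness of A.\<close>

lemma vnorm_os: "vnorm os a = norm a"
proof (rule antisym)
  show "vnorm os a \<le> norm a"
    unfolding vnorm_def os_simps
    by (rule act_norm_least) (simp_all add: L2_set_def norm_act)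
  show "norm a \<le> vnorm os a"
  proof (rule norm_least)
    show "vnorm os a \<ge> 0" unfolding vnorm_def os_simps by (rule act_norm_ge_0)
    show "norm (act a x) \<le> vnorm os a * norm x" for x
      using norm_matrix_action_le[of "Matrix.mat 1 1 (\<lambda>_. a)" "\<lambda>_. x"] by (simp add: vnorm_def L2_set_def)
  qed
qed

lemma act_norm_eq_0:
  assumes "X \<in> carrier_mat n n"
  shows "act_norm act X = 0 \<longleftrightarrow> X = 0\<^sub>m n n"
proof
  assume eq0: "act_norm act X = 0"
  show "X = 0\<^sub>m n n"
  proof (rule eq_matI)
    fix i j assume "i < dim_row (0\<^sub>m n n :: 'a mat)" "j < dim_col (0\<^sub>m n n :: 'a mat)"
    then have ij: "i < n" "j < n" by auto
    have "act (X $$ (i, j)) x = 0" for x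
    proof -
      \<comment> \<open>A vector supported in coordinate j isolates column j of X.\<close>
      let ?\<xi> = "\<lambda>l. if l = j then x else 0"
      have s: "(\<Sum>l<n. act (X $$ (i, l)) (?\<xi> l)) = act (X $$ (i, j)) x"
        using ij by (subst sum.remove[of _ j]) (auto intro!: sum.neutral)
      have "norm (\<Sum>l<n. act (X $$ (i, l)) (?\<xi> l))
          \<le> L2_set (\<lambda>i. norm (\<Sum>l<n. act (X $$ (i, l)) (?\<xi> l))) {..<n}"
        using ij by (intro member_le_L2_set) auto
      also have "\<dots> \<le> 0"
        using norm_matrix_action_le[of X ?\<xi>] assms eq0 by simp
      finally show ?thesis using s by simp
    qed
    then have "X $$ (i, j) = 0" by (intro act_faithful) simp
    then show "X $$ (i, j) = 0\<^sub>m n n $$ (i, j)" using ij by simp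
  qed (use assms in auto)
next
  assume X: "X = 0\<^sub>m n n"
  have "act_norm act X \<le> 0"
    by (rule act_norm_least) (simp_all add: X L2_set_def)
  then show "act_norm act X = 0" using act_norm_ge_0[of X] by simp
qed

lemma act_norm_scale_le: "act_norm act (map_mat (sc c) X) \<le> cmod c * act_norm act X"
proof (rule act_norm_least)
  fix \<xi> :: "nat \<Rightarrow> 'h"
  have "L2_set (\<lambda>i. norm (\<Sum>j<dim_col X. act (map_mat (sc c) X $$ (i, j)) (\<xi> j))) {..<dim_row X}
      = L2_set (\<lambda>i. cmod c * norm (\<Sum>j<dim_col X. act (X $$ (i, j)) (\<xi> j))) {..<dim_row X}"
    by (intro L2_set_cong refl) (simp add: act_sc norm_scaleC flip: scaleC_sum_right)
  also have "\<dots> = cmod c * L2_set (\<lambda>i. norm (\<Sum>j<dim_col X. act (X $$ (i, j)) (\<xi> j))) {..<dim_row X}"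
    by (simp add: L2_set_right_distrib)
  also have "\<dots> \<le> cmod c * (act_norm act X * L2_set (\<lambda>j. norm (\<xi> j)) {..<dim_col X})"
    by (rule mult_left_mono[OF norm_matrix_action_le]) simp
  finally show "L2_set (\<lambda>i. norm (\<Sum>j<dim_col (map_mat (sc c) X). act (map_mat (sc c) X $$ (i, j)) (\<xi> j)))
      {..<dim_row (map_mat (sc c) X)} \<le> cmod c * act_norm act X * L2_set (\<lambda>j. norm (\<xi> j)) {..<dim_col (map_mat (sc c) X)}"
    by (simp add: mult.assoc)
qed (simp add: act_norm_ge_0)

lemma act_norm_scale: "act_norm act (map_mat (sc c) X) = cmod c * act_norm act X"
proof (cases "c = 0")
  case True
  then show ?thesis using act_norm_scale_le[of c X] act_norm_ge_0[of "map_mat (sc c) X"] by simp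
next
  case False
  have "map_mat (sc (inverse c)) (map_mat (sc c) X) = X"
    using False by (intro eq_matI) auto
  then have "act_norm act X \<le> cmod (inverse c) * act_norm act (map_mat (sc c) X)"
    using act_norm_scale_le[of "inverse c" "map_mat (sc c) X"] by simp
  then have "cmod c * act_norm act X \<le> act_norm act (map_mat (sc c) X)"
    using False by (simp add: norm_divide field_simps)
  then show ?thesis using act_norm_scale_le[of c X] by simp
qed

lemma act_norm_triangle:
  assumes "X \<in> carrier_mat n n" "Y \<in> carrier_mat n n"
  shows "act_norm act (X + Y) \<le> act_norm act X + act_norm act Y"
proof (rule act_norm_least)
  fix \<xi> :: "nat \<Rightarrow> 'h"
  let ?x = "\<lambda>i. \<Sum>j<n. act (X $$ (i, j)) (\<xi> j)" and ?y = "\<lambda>i. \<Sum>j<n. act (Y $$ (i, j)) (\<xi> j)"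
  have "L2_set (\<lambda>i. norm (\<Sum>j<n. act ((X + Y) $$ (i, j)) (\<xi> j))) {..<n} = L2_set (\<lambda>i. norm (?x i + ?y i)) {..<n}"
    using assms by (intro L2_set_cong refl) (simp add: act_add_left sum.distrib)
  also have "\<dots> \<le> L2_set (\<lambda>i. norm (?x i) + norm (?y i)) {..<n}"
    by (intro L2_set_mono norm_triangle_ineq) simp
  also have "\<dots> \<le> L2_set (\<lambda>i. norm (?x i)) {..<n} + L2_set (\<lambda>i. norm (?y i)) {..<n}"
    by (rule L2_set_triangle_ineq)
  also have "\<dots> \<le> act_norm act X * L2_set (\<lambda>j. norm (\<xi> j)) {..<n} + act_norm act Y * L2_set (\<lambda>j. norm (\<xi> j)) {..<n}"
    using norm_matrix_action_le[of X \<xi>] norm_matrix_action_le[of Y \<xi>] assms by (intro add_mono) auto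
  finally show "L2_set (\<lambda>i. norm (\<Sum>j<dim_col (X + Y). act ((X + Y) $$ (i, j)) (\<xi> j))) {..<dim_row (X + Y)}
      \<le> (act_norm act X + act_norm act Y) * L2_set (\<lambda>j. norm (\<xi> j)) {..<dim_col (X + Y)}"
    using assms by (simp add: distrib_right)
qed (simp add: act_norm_ge_0)

text \<open>The conjugated matrix acts as \<beta>, then X, then \<alpha>; \<eta> and \<zeta> are the
  two intermediate vectors, and the three bounds multiply.\<close>

lemma act_norm_conj:
  assumes X: "X \<in> Mats os n" and \<alpha>: "\<alpha> \<in> carrier_mat m n" and \<beta>: "\<beta> \<in> carrier_mat n m"
  shows "act_norm act (scalar_conj os \<alpha> X \<beta>) \<le> cmat_norm \<alpha> * act_norm act X * cmat_norm \<beta>"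
proof (rule act_norm_least)
  fix \<xi> :: "nat \<Rightarrow> 'h"
  note dX = Mats_dim[OF X]
  define \<eta> where "\<eta> l = (\<Sum>j<m. scaleC (\<beta> $$ (l, j)) (\<xi> j))" for l
  define \<zeta> where "\<zeta> k = (\<Sum>l<n. act (X $$ (k, l)) (\<eta> l))" for k
  have row: "(\<Sum>j<m. act (scalar_conj os \<alpha> X \<beta> $$ (i, j)) (\<xi> j)) = (\<Sum>k<n. scaleC (\<alpha> $$ (i, k)) (\<zeta> k))"
    if "i < m" for i
  proof -
    have "(\<Sum>j<m. act (scalar_conj os \<alpha> X \<beta> $$ (i, j)) (\<xi> j))
        = (\<Sum>j<m. \<Sum>k<n. \<Sum>l<n. scaleC (\<alpha> $$ (i, k) * \<beta> $$ (l, j)) (act (X $$ (k, l)) (\<xi> j)))"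
      using that \<alpha> \<beta> dX by (intro sum.cong refl) (simp add: scalar_conj_def act_sum_left act_sc)
    also have "\<dots> = (\<Sum>k<n. \<Sum>j<m. \<Sum>l<n. scaleC (\<alpha> $$ (i, k) * \<beta> $$ (l, j)) (act (X $$ (k, l)) (\<xi> j)))"
      by (rule sum.swap)
    also have "\<dots> = (\<Sum>k<n. \<Sum>l<n. \<Sum>j<m. scaleC (\<alpha> $$ (i, k) * \<beta> $$ (l, j)) (act (X $$ (k, l)) (\<xi> j)))"
      by (intro sum.cong refl sum.swap)
    also have "\<dots> = (\<Sum>k<n. scaleC (\<alpha> $$ (i, k)) (\<zeta> k))"
    proof (intro sum.cong refl)
      fix k assume k: "k \<in> {..<n}"
      have "act (X $$ (k, l)) (\<eta> l) = (\<Sum>j<m. scaleC (\<beta> $$ (l, j)) (act (X $$ (k, l)) (\<xi> j)))" if "l < n" for l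
      proof -
        \<comment> \<open>Complex linearity of the entries is used here: the scalars of \<beta> must
          be moved through the operator.\<close>
        have "X $$ (k, l) \<in> A" using Mats_entry[OF X, of k l] k that by simp
        then show ?thesis by (simp add: \<eta>_def act_sum_right act_scaleC)
      qed
      then show "(\<Sum>l<n. \<Sum>j<m. scaleC (\<alpha> $$ (i, k) * \<beta> $$ (l, j)) (act (X $$ (k, l)) (\<xi> j))) = scaleC (\<alpha> $$ (i, k)) (\<zeta> k)"
        by (simp add: \<zeta>_def scaleC_sum_right scaleC_scaleC)
    qed
    finally show ?thesis .
  qed
  have "L2_set (\<lambda>i. norm (\<Sum>j<m. act (scalar_conj os \<alpha> X \<beta> $$ (i, j)) (\<xi> j))) {..<m}
      = L2_set (\<lambda>i. norm (\<Sum>k<n. scaleC (\<alpha> $$ (i, k)) (\<zeta> k))) {..<m}"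
    by (intro L2_set_cong refl) (simp add: row)
  also have "\<dots> \<le> cmat_norm \<alpha> * L2_set (\<lambda>k. norm (\<zeta> k)) {..<n}"
    using norm_scalar_matrix_le[of \<alpha> \<zeta>] \<alpha> by simp
  also have "\<dots> \<le> cmat_norm \<alpha> * (act_norm act X * L2_set (\<lambda>l. norm (\<eta> l)) {..<n})"
    using norm_matrix_action_le[of X \<eta>] dX by (intro mult_left_mono cmat_norm_nonneg) (simp add: \<zeta>_def)
  also have "\<dots> \<le> cmat_norm \<alpha> * (act_norm act X * (cmat_norm \<beta> * L2_set (\<lambda>j. norm (\<xi> j)) {..<m}))"
    using norm_scalar_matrix_le[of \<beta> \<xi>] \<beta>
    by (intro mult_left_mono cmat_norm_nonneg act_norm_ge_0) (simp add: \<eta>_def)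
  finally show "L2_set (\<lambda>i. norm (\<Sum>j<dim_col (scalar_conj os \<alpha> X \<beta>). act (scalar_conj os \<alpha> X \<beta> $$ (i, j)) (\<xi> j)))
      {..<dim_row (scalar_conj os \<alpha> X \<beta>)}
      \<le> cmat_norm \<alpha> * act_norm act X * cmat_norm \<beta> * L2_set (\<lambda>j. norm (\<xi> j)) {..<dim_col (scalar_conj os \<alpha> X \<beta>)}"
    using \<alpha> \<beta> by (simp add: scalar_conj_def mult.assoc)
qed (intro mult_nonneg_nonneg cmat_norm_nonneg act_norm_ge_0)

text \<open>The first n and the last p coordinates are acted on separately and their squares add.
  For the reverse bound, vectors are extended by zero on the other summand.\<close>

lemma act_norm_direct_sum:
  assumes X: "X \<in> carrier_mat n n" and Y: "Y \<in> carrier_mat p p"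
  shows "act_norm act (direct_sum X Y) = max (act_norm act X) (act_norm act Y)"
proof (rule antisym)
  let ?S = "direct_sum X Y"
  have dS: "dim_row ?S = n + p" "dim_col ?S = n + p"
    using X Y by (simp_all add: direct_sum_def)
  have row: "(\<Sum>j<n + p. act (?S $$ (i, j)) (\<xi> j)) = (\<Sum>j<n. act (X $$ (i, j)) (\<xi> j))" if "i < n" for i \<xi>
    unfolding sum_lessThan_add using X Y that by (simp add: direct_sum_def)
  have row': "(\<Sum>j<n + p. act (?S $$ (n + i, j)) (\<xi> j)) = (\<Sum>j<p. act (Y $$ (i, j)) (\<xi> (n + j)))" if "i < p" for i \<xi>
    unfolding sum_lessThan_add using X Y that by (simp add: direct_sum_def)
  have S2: "(\<Sum>i<n + p. (norm (\<Sum>j<n + p. act (?S $$ (i, j)) (\<xi> j)))\<^sup>2)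
      = (\<Sum>i<n. (norm (\<Sum>j<n. act (X $$ (i, j)) (\<xi> j)))\<^sup>2) + (\<Sum>i<p. (norm (\<Sum>j<p. act (Y $$ (i, j)) (\<xi> (n + j))))\<^sup>2)" for \<xi>
    unfolding sum_lessThan_add[of "\<lambda>i. (norm (\<Sum>j<n + p. act (?S $$ (i, j)) (\<xi> j)))\<^sup>2"]
    by (simp add: row row')
  have X2: "(\<Sum>i<n. (norm (\<Sum>j<n. act (X $$ (i, j)) (\<xi> j)))\<^sup>2) \<le> (act_norm act X)\<^sup>2 * (\<Sum>j<n. (norm (\<xi> j))\<^sup>2)" for \<xi>
    using norm_matrix_action_le[of X \<xi>] X by (intro sum_power2_le_of_L2_set_le) auto
  have Y2: "(\<Sum>i<p. (norm (\<Sum>j<p. act (Y $$ (i, j)) (\<xi> j)))\<^sup>2) \<le> (act_norm act Y)\<^sup>2 * (\<Sum>j<p. (norm (\<xi> j))\<^sup>2)" for \<xi>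
    using norm_matrix_action_le[of Y \<xi>] Y by (intro sum_power2_le_of_L2_set_le) auto
  show "act_norm act ?S \<le> max (act_norm act X) (act_norm act Y)"
  proof (rule act_norm_least)
    fix \<xi> :: "nat \<Rightarrow> 'h"
    let ?M = "max (act_norm act X) (act_norm act Y)"
    have M: "(act_norm act X)\<^sup>2 \<le> ?M\<^sup>2" "(act_norm act Y)\<^sup>2 \<le> ?M\<^sup>2"
      using act_norm_ge_0[of X] act_norm_ge_0[of Y] by (simp_all add: power_mono)
    have "(\<Sum>i<n + p. (norm (\<Sum>j<n + p. act (?S $$ (i, j)) (\<xi> j)))\<^sup>2)
        \<le> (act_norm act X)\<^sup>2 * (\<Sum>j<n. (norm (\<xi> j))\<^sup>2) + (act_norm act Y)\<^sup>2 * (\<Sum>j<p. (norm (\<xi> (n + j)))\<^sup>2)"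
      unfolding S2 by (intro add_mono X2 Y2)
    also have "\<dots> \<le> ?M\<^sup>2 * (\<Sum>j<n. (norm (\<xi> j))\<^sup>2) + ?M\<^sup>2 * (\<Sum>j<p. (norm (\<xi> (n + j)))\<^sup>2)"
      by (intro add_mono mult_right_mono M sum_nonneg) auto
    also have "\<dots> = ?M\<^sup>2 * (\<Sum>j<n + p. (norm (\<xi> j))\<^sup>2)"
      by (simp add: sum_lessThan_add distrib_left)
    finally show "L2_set (\<lambda>i. norm (\<Sum>j<dim_col ?S. act (?S $$ (i, j)) (\<xi> j))) {..<dim_row ?S}
        \<le> ?M * L2_set (\<lambda>j. norm (\<xi> j)) {..<dim_col ?S}"
      unfolding dS by (rule L2_set_le_of_sum_power2_le) (simp add: act_norm_ge_0 le_max_iff_disj)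
  qed (simp add: act_norm_ge_0 le_max_iff_disj)
  have bS: "(\<Sum>i<n + p. (norm (\<Sum>j<n + p. act (?S $$ (i, j)) (\<xi> j)))\<^sup>2)
      \<le> (act_norm act ?S)\<^sup>2 * (\<Sum>j<n + p. (norm (\<xi> j))\<^sup>2)" for \<xi>
    using norm_matrix_action_le[of ?S \<xi>] unfolding dS by (rule sum_power2_le_of_L2_set_le)
  have "act_norm act X \<le> act_norm act ?S"
  proof (rule act_norm_least[OF _ act_norm_ge_0])
    fix \<xi> :: "nat \<Rightarrow> 'h"
    let ?\<xi> = "\<lambda>j. if j < n then \<xi> j else 0"
    have "(\<Sum>i<n. (norm (\<Sum>j<n. act (X $$ (i, j)) (\<xi> j)))\<^sup>2)
        = (\<Sum>i<n + p. (norm (\<Sum>j<n + p. act (?S $$ (i, j)) (?\<xi> j)))\<^sup>2)"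
      unfolding S2 by simp
    also have "\<dots> \<le> (act_norm act ?S)\<^sup>2 * (\<Sum>j<n. (norm (\<xi> j))\<^sup>2)"
      using bS[of ?\<xi>] unfolding sum_lessThan_add[of "\<lambda>j. (norm (?\<xi> j))\<^sup>2"] by simp
    finally show "L2_set (\<lambda>i. norm (\<Sum>j<dim_col X. act (X $$ (i, j)) (\<xi> j))) {..<dim_row X}
        \<le> act_norm act ?S * L2_set (\<lambda>j. norm (\<xi> j)) {..<dim_col X}"
      using X act_norm_ge_0 by (intro L2_set_le_of_sum_power2_le) auto
  qed
  moreover have "act_norm act Y \<le> act_norm act ?S"
  proof (rule act_norm_least[OF _ act_norm_ge_0])
    fix \<xi> :: "nat \<Rightarrow> 'h"
    let ?\<xi> = "\<lambda>j. if j < n then 0 else \<xi> (j - n)"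
    have "(\<Sum>i<p. (norm (\<Sum>j<p. act (Y $$ (i, j)) (\<xi> j)))\<^sup>2)
        = (\<Sum>i<n + p. (norm (\<Sum>j<n + p. act (?S $$ (i, j)) (?\<xi> j)))\<^sup>2)"
      unfolding S2 by simp
    also have "\<dots> \<le> (act_norm act ?S)\<^sup>2 * (\<Sum>j<p. (norm (\<xi> j))\<^sup>2)"
      using bS[of ?\<xi>] unfolding sum_lessThan_add[of "\<lambda>j. (norm (?\<xi> j))\<^sup>2"] by simp
    finally show "L2_set (\<lambda>i. norm (\<Sum>j<dim_col Y. act (Y $$ (i, j)) (\<xi> j))) {..<dim_row Y}
        \<le> act_norm act ?S * L2_set (\<lambda>j. norm (\<xi> j)) {..<dim_col Y}"
      using Y act_norm_ge_0 by (intro L2_set_le_of_sum_power2_le) auto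
  qed
  ultimately show "max (act_norm act X) (act_norm act Y) \<le> act_norm act ?S" by simp
qed

lemma operator_space_os: "operator_space os"
proof (rule operator_space.intro)
  show "vector_space (cscale os)" "module.subspace (cscale os) (vectors os)"
    using vector_space_sc subspace_A by simp_all
  fix n m :: nat and X Y :: "'a mat" and \<alpha> \<beta> :: "complex mat" and c
  assume X: "X \<in> Mats os n"
  note X' = Mats_carrier[OF X]
  show "mnorm os X = 0 \<longleftrightarrow> X = 0\<^sub>m n n" using act_norm_eq_0[OF X'] by simp
  show "mnorm os (map_mat (cscale os c) X) = cmod c * mnorm os X" by (simp add: act_norm_scale)
  show "mnorm os (X + Y) \<le> mnorm os X + mnorm os Y" if "Y \<in> Mats os n"
    using act_norm_triangle[OF X' Mats_carrier[OF that]] by simp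
  show "mnorm os (scalar_conj os \<alpha> X \<beta>) \<le> cmat_norm \<alpha> * mnorm os X * cmat_norm \<beta>"
    if "\<alpha> \<in> carrier_mat m n" "\<beta> \<in> carrier_mat n m"
    using act_norm_conj[OF X that] by simp
  show "mnorm os (direct_sum X Y) = max (mnorm os X) (mnorm os Y)" if "Y \<in> Mats os m"
    using act_norm_direct_sum[OF X' Mats_carrier[OF that]] by simp
next
  fix s :: "nat \<Rightarrow> 'a"
  assume s: "\<And>i. s i \<in> vectors os"
    and "\<And>e. e > 0 \<Longrightarrow> \<exists>N. \<forall>i\<ge>N. \<forall>j\<ge>N. vnorm os (s i - s j) < e"
  then have "Cauchy s" by (simp add: vnorm_os Cauchy_def dist_norm)
  then obtain x where x: "s \<longlonglongrightarrow> x" using Cauchy_convergent convergent_def by blast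
  have "x \<in> A" using closed_sequentially[OF closed_A _ x] s by simp
  moreover have "(\<lambda>i. norm (s i - x)) \<longlonglongrightarrow> 0"
    using x by (simp add: LIM_zero_iff tendsto_norm_zero_iff)
  ultimately show "\<exists>x\<in>vectors os. (\<lambda>i. vnorm os (s i - x)) \<longlonglongrightarrow> 0"
    by (auto simp: vnorm_os)
qed

text \<open>By \<open>norm_least\<close> a constant c below the norm of w fails as a bound at some
  x, and the functional is built from this x.\<close>

lemma norming_os:
  assumes "c < vnorm os w"
  shows "\<exists>\<phi>. contractive_functional os \<phi> \<and> c < cmod (\<phi> w)"
proof -
  have contr: "contractive_functional os (\<lambda>a. cinner (act a x) y)" if "norm x \<le> 1" "norm y \<le> 1" for x y
    unfolding contractive_functional_def os_simps vnorm_os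
  proof (intro conjI ballI allI)
    fix a b c
    show "cinner (act (a + b) x) y = cinner (act a x) y + cinner (act b x) y"
      by (simp add: act_add_left cinner_add_left)
    show "cinner (act (sc c a) x) y = c * cinner (act a x) y"
      by (simp add: act_sc cinner_scaleC_left)
    have "cmod (cinner (act a x) y) \<le> norm (act a x) * norm y" by (rule cinner_cauchy_schwarz)
    also have "\<dots> \<le> (norm a * norm x) * norm y" by (rule mult_right_mono[OF norm_act]) simp
    also have "\<dots> \<le> (norm a * 1) * 1" using that by (intro mult_mono) auto
    finally show "cmod (cinner (act a x) y) \<le> norm a" by simp
  qed
  show ?thesis
  proof (cases "c < 0")
    case True
    then show ?thesis using contr[of 0 0] by (intro exI[of _ "\<lambda>a. cinner (act a 0) 0"]) simp
  next
    case False
    have "\<exists>x. c * norm x < norm (act w x)"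
    proof (rule ccontr)
      assume "\<not> ?thesis"
      then have "norm w \<le> c" using False by (intro norm_least) (auto simp: not_less)
      then show False using assms by (simp add: vnorm_os)
    qed
    then obtain x where x: "c * norm x < norm (act w x)" by blast
    then have "x \<noteq> 0" by auto
    define x' where "x' = scaleR (inverse (norm x)) x"
    \<comment> \<open>The unit vector in the direction of w x', so that the inner product equals the
      norm of w x'.\<close>
    define y where "y = scaleR (inverse (norm (act w x'))) (act w x')"
    have x': "norm x' = 1" using \<open>x \<noteq> 0\<close> by (simp add: x'_def)
    have "act w x' = scaleR (inverse (norm x)) (act w x)"
      unfolding x'_def using bounded_linear_act by (rule linear_simps(5))
    then have gt: "norm (act w x') > c"
      using x \<open>x \<noteq> 0\<close> by (simp add: field_simps)
    then have nz: "act w x' \<noteq> 0" using False by auto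
    have y: "norm y = 1" using nz by (simp add: y_def)
    have "cinner (act w x') y = complex_of_real (norm (act w x'))"
      using nz by (simp add: y_def cinner_scaleC_right cinner_self power2_eq_square flip: scaleC_of_real)
    then have "cmod (cinner (act w x') y) > c" using gt by simp
    then show ?thesis using contr[of x' y] x' y by auto
  qed
qed

end

section \<open>Multiplication of operator matrices\<close>

locale operator_algebra_action = operator_action +
  fixes mul :: "'a \<Rightarrow> 'a \<Rightarrow> 'a"
  assumes mul_in: "a \<in> A \<Longrightarrow> b \<in> A \<Longrightarrow> mul a b \<in> A"
    and act_mul: "act (mul a b) x = act a (act b x)"
begin

text \<open>The tensor product factors as X on the outer index after Y on the inner index. Each
  factor acts in parallel on slices of coordinates, so its norm is at most that of X or Y.\<close>

lemma act_norm_mult_tensor: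
  assumes X: "X \<in> carrier_mat p p" and Y: "Y \<in> carrier_mat q q"
  shows "act_norm act (mat_mult_tensor mul X Y) \<le> act_norm act X * act_norm act Y"
proof (rule act_norm_least)
  fix \<xi> :: "nat \<Rightarrow> 'b"
  let ?T = "mat_mult_tensor mul X Y"
  have dT: "dim_row ?T = p * q" "dim_col ?T = p * q" using X Y by (simp_all add: mat_mult_tensor_def)
  \<comment> \<open>The image of \<xi> under the inner factor: Y applied within block l, entry
    r.\<close>
  define \<eta> where "\<eta> r l = (\<Sum>s<q. act (Y $$ (r, s)) (\<xi> (s + l * q)))" for r l
  have row: "(\<Sum>j<p * q. act (?T $$ (r + k * q, j)) (\<xi> j)) = (\<Sum>l<p. act (X $$ (k, l)) (\<eta> r l))"
    if "k < p" "r < q" for k r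
    unfolding sum_mult_product
  proof (intro sum.cong refl)
    fix l assume "l \<in> {..<p}"
    then have "?T $$ (r + k * q, s + l * q) = mul (X $$ (k, l)) (Y $$ (r, s))" if "s < q" for s
      using X Y \<open>k < p\<close> \<open>r < q\<close> that by (simp add: mat_mult_tensor_def block_index_less)
    then show "(\<Sum>s<q. act (?T $$ (r + k * q, s + l * q)) (\<xi> (s + l * q))) = act (X $$ (k, l)) (\<eta> r l)"
      by (simp add: \<eta>_def act_mul act_sum_right)
  qed
  have "(\<Sum>i<p * q. (norm (\<Sum>j<p * q. act (?T $$ (i, j)) (\<xi> j)))\<^sup>2)
      = (\<Sum>k<p. \<Sum>r<q. (norm (\<Sum>l<p. act (X $$ (k, l)) (\<eta> r l)))\<^sup>2)"
    by (subst sum_mult_product) (intro sum.cong refl, simp add: row)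
  also have "\<dots> = (\<Sum>r<q. \<Sum>k<p. (norm (\<Sum>l<p. act (X $$ (k, l)) (\<eta> r l)))\<^sup>2)"
    by (rule sum.swap)
  also have "\<dots> \<le> (\<Sum>r<q. (act_norm act X)\<^sup>2 * (\<Sum>l<p. (norm (\<eta> r l))\<^sup>2))"
    using norm_matrix_action_le[of X] X by (intro sum_mono sum_power2_le_of_L2_set_le) auto
  also have "\<dots> = (act_norm act X)\<^sup>2 * (\<Sum>l<p. \<Sum>r<q. (norm (\<eta> r l))\<^sup>2)"
    by (subst sum.swap) (simp add: sum_distrib_left)
  also have "\<dots> \<le> (act_norm act X)\<^sup>2 * (\<Sum>l<p. (act_norm act Y)\<^sup>2 * (\<Sum>s<q. (norm (\<xi> (s + l * q)))\<^sup>2))"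
    unfolding \<eta>_def using norm_matrix_action_le[of Y] Y by (intro mult_left_mono sum_mono sum_power2_le_of_L2_set_le) auto
  also have "\<dots> = (act_norm act X * act_norm act Y)\<^sup>2 * (\<Sum>j<p * q. (norm (\<xi> j))\<^sup>2)"
    by (simp add: sum_mult_product sum_distrib_left power_mult_distrib mult.assoc)
  finally show "L2_set (\<lambda>i. norm (\<Sum>j<dim_col ?T. act (?T $$ (i, j)) (\<xi> j))) {..<dim_row ?T}
      \<le> act_norm act X * act_norm act Y * L2_set (\<lambda>j. norm (\<xi> j)) {..<dim_col ?T}"
    unfolding dT by (rule L2_set_le_of_sum_power2_le) (simp add: act_norm_ge_0)
qed (simp add: act_norm_ge_0)

lemma completely_contractive_Banach_algebra_os: "completely_contractive_Banach_algebra os mul"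
proof (intro completely_contractive_Banach_algebra.intro operator_space_os
    completely_contractive_Banach_algebra_axioms.intro)
  show "mnorm os (mat_mult_tensor mul X Y) \<le> mnorm os X * mnorm os Y"
    if "X \<in> Mats os p" "Y \<in> Mats os q" for p q X Y
    using act_norm_mult_tensor that[THEN Mats_carrier] by simp
qed (auto simp: mul_in act_mul act_add_left act_add_right act_sc act_scaleC intro!: act_faithful)

end

section \<open>The scalars and concrete operator algebras as instances\<close>

lemma operator_algebra_action_complex:
  "operator_algebra_action (*) (*) UNIV ((*) :: complex \<Rightarrow> complex \<Rightarrow> complex)"
proof
  have "Modules.module ((*) :: complex \<Rightarrow> complex \<Rightarrow> complex)"
    by unfold_locales (simp_all add: algebra_simps)
  then show "module.subspace ((*) :: complex \<Rightarrow> complex \<Rightarrow> complex) UNIV"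
    by (rule Modules.module.subspaceI) simp_all
  show "\<exists>K. \<forall>x. norm (a * x) \<le> norm x * K" for a :: complex
    by (intro exI[of _ "norm a"]) (simp add: norm_mult)
  show "norm a \<le> C" if "\<And>x. norm (a * x) \<le> C * norm x" for a :: complex and C
    using that[of 1] by simp
qed (simp_all add: algebra_simps scaleC_complex_def norm_mult)

lemma operator_algebra_action_blinfun:
  assumes "operator_algebra (A :: ('h::complex_hilbert \<Rightarrow>\<^sub>L 'h) set)"
  shows "operator_algebra_action blinfun_apply op_scaleC A (o\<^sub>L)"
proof
  show "norm T \<le> C" if "C \<ge> 0" "\<And>x. norm (blinfun_apply T x) \<le> C * norm x"
    for T :: "'h \<Rightarrow>\<^sub>L 'h" and C
    using that by (rule norm_blinfun_bound)
  show "\<exists>K. \<forall>x. norm (blinfun_apply T x) \<le> norm x * K" for T :: "'h \<Rightarrow>\<^sub>L 'h"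
    by (intro exI[of _ "norm T"] allI) (subst mult.commute, rule norm_blinfun)
qed (use assms in \<open>auto simp: operator_algebra_def bounded_operators_def blinfun.add_left
    scaleC_add_left scaleC_add_right scaleC_scaleC norm_blinfun blinfun.add_right blinfun.scaleR_right
    intro!: blinfun_eqI\<close>)

theorem (in operator_algebra_action) completely_contractive_Banach_algebra_Hcb_os:
  assumes "operator_space V"
  shows "completely_contractive_Banach_algebra (Hcb V os) (\<lambda>f g x. mul (f x) (g x))"
proof -
  interpret algebra_pair V os mul
    by (intro algebra_pair.intro normed_pair.intro operator_space_pair.intro normed_pair_axioms.intro
        assms operator_space_os completely_contractive_Banach_algebra_os norming_os)
  show ?thesis by (rule completely_contractive_Banach_algebra_Hcb)
qed

theorem proposition3p5:
  fixes V :: "'v::ab_group_add matrix_normed"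
  assumes "operator_space V"
  shows "completely_contractive_Banach_algebra (Hcb V complex_os) (\<lambda>f g x. f x * g x)
    \<and> (\<forall>A :: ('h::complex_hilbert \<Rightarrow>\<^sub>L 'h) set. operator_algebra A \<longrightarrow>
         completely_contractive_Banach_algebra (Hcb V (induced_os A)) (\<lambda>f g x. f x o\<^sub>L g x))"
proof (intro conjI allI impI)
  interpret scalar: operator_algebra_action "(*)" "(*)" UNIV "(*) :: complex \<Rightarrow> complex \<Rightarrow> complex"
    by (rule operator_algebra_action_complex)
  have "scalar.os = complex_os"
    by (simp add: scalar.os_def complex_os_def cmat_norm_eq_act_norm)
  then show "completely_contractive_Banach_algebra (Hcb V complex_os) (\<lambda>f g x. f x * g x)"
    using scalar.completely_contractive_Banach_algebra_Hcb_os[OF assms] by simp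
next
  fix A :: "('h \<Rightarrow>\<^sub>L 'h) set"
  assume "operator_algebra A"
  then interpret alg: operator_algebra_action blinfun_apply op_scaleC A "(o\<^sub>L)"
    by (rule operator_algebra_action_blinfun)
  have "alg.os = induced_os A"
    by (simp add: alg.os_def induced_os_def op_mat_norm_eq_act_norm)
  then show "completely_contractive_Banach_algebra (Hcb V (induced_os A)) (\<lambda>f g x. f x o\<^sub>L g x)"
    using alg.completely_contractive_Banach_algebra_Hcb_os[OF assms] by simp
qed

end
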